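(* Let $\Omega\subset E_k$ be a domain which is convex with respect to the set of directions $M_u$ for all $u=1,\dots,m$, and let $f_u(E_k)=\mathbb{C}$ for all $u=1,2,\dots,m$. Let $\Phi:\Omega\to\mathbb{A}_n^m$ be a monogenic function in $\Omega$. Then for every point $\zeta_0\in\Omega$ the following equality is true: $$\lambda\,\Phi(\zeta_0)=\int_{\gamma}\Phi(\zeta)\,(\zeta-\zeta_0)^{-1}\,d\zeta,$$ where $\gamma$ is an arbitrary closed Jordan rectifiable curve in $\Omega$ that embraces once the set $\{\zeta+\zeta_0:\zeta\in\bigcup_{u=1}^m M_u\}$, and $\lambda=\int_{C(0,\varepsilon)}\zeta^{-1}\,d\zeta$, where $C(0,\varepsilon)=C(\zeta_0,\varepsilon)-\zeta_0$ is the translate to the origin (with the same orientation) of the circle $C(\zeta_0,\varepsilon)$ to which $\gamma$ is homotopic in the definition of "embraces once".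
   Context: Algebra. Let $m\le n$ be natural numbers. $\mathbb{A}_n^m$ is an arbitrary $n$-dimensional commutative associative algebra with unit over $\mathbb{C}$, having a basis $\{I_r\}_{r=1}^n$ with the multiplication rules (such a basis exists by a theorem of E. Cartan): (1) for $r,s\in\{1,\dots,m\}$, $I_rI_s=0$ if $r\ne s$ and $I_rI_r=I_r$; (2) for $r,s\in\{m+1,\dots,n\}$, $I_rI_s=\sum_{p=\max\{r,s\}+1}^n\Upsilon_{r,p}^{s}I_p$ with structure constants $\Upsilon_{r,p}^s\in\mathbb{C}$; (3) for every $s\in\{m+1,\dots,n\}$ there is a unique $u_s\in\{1,\dots,m\}$ such that for all $r\in\{1,\dots,m\}$, $I_rI_s=I_s$ if $r=u_s$ and $I_rI_s=0$ if $r\neq u_s$. The unit is $1=\sum_{u=1}^m I_u$. For $u=1,\dots,m$ the functional $f_u:\mathbb{A}_n^m\to\mathbb{C}$ is the $\mathbb{C}$-linear (multiplicative) functional with $f_u(I_u)=1$ and $f_u(I_r)=0$ for all $r\neq u$. The subspace $E_k$. Let $2\le k\le 2n$ and let $e_1=1,e_2,\dots,e_k\in\mathbb{A}_n^m$ be linearly independent over $\mathbb{R}$. Put $E_k=\{\zeta=\sum_{j=1}^k x_je_j:\ x_j\in\mathbb{R}\}$. $E_k$ is identified with $\mathbb{R}^k$ through the coordinates $(x_1,\dots,x_k)$; all topological and metric notions for subsets of $E_k$ (domain, circle, radius, rectifiability, homotopy, etc.) are those of the corresponding subsets of $\mathbb{R}^k$; for $Q\subset E_k$ the corresponding subset of $\mathbb{R}^k$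 is $Q_{\mathbb{R}}$. A domain is a nonempty open connected set. For $u=1,\dots,m$ put $M_u=\{\zeta\in E_k: f_u(\zeta)=0\}$; the noninvertible elements of $E_k$ are exactly those of $\bigcup_{u=1}^m M_u$. A domain $\Omega\subset E_k$ is convex with respect to the set of directions $M_u$ if $\Omega$ contains the segment $\{\zeta_1+\alpha(\zeta_2-\zeta_1):\alpha\in[0,1]\}$ for all $\zeta_1,\zeta_2\in\Omega$ with $\zeta_2-\zeta_1\in M_u$. Monogenic functions. A continuous function $\Phi:\Omega\to\mathbb{A}_n^m$ is monogenic in the domain $\Omega\subset E_k$ if for every $\zeta\in\Omega$ there is an element $\Phi'(\zeta)\in\mathbb{A}_n^m$ such that $\lim_{\varepsilon\to0+0}\left(\Phi(\zeta+\varepsilon h)-\Phi(\zeta)\right)\varepsilon^{-1}=h\Phi'(\zeta)$ for all $h\in E_k$. Integral. For a Jordan rectifiable curve $\gamma\subset E_k$ and a continuous $\Psi=\sum_{r=1}^n (U_r+iV_r)I_r:\gamma\to\mathbb{A}_n^m$ with real-valued functions $U_r,V_r$ of $(x_1,\dots,x_k)\in\gamma_{\mathbb{R}}$, $$\int_\gamma\Psi(\zeta)\,d\zeta:=\sum_{j=1}^k e_j\sum_{r=1}^n I_r\int_{\gamma_{\mathbb{R}}}U_r\,dx_j+i\sum_{j=1}^k e_j\sum_{r=1}^n I_r\int_{\gamma_{\mathbb{R}}}V_r\,dx_j .$$ Embracing. For $\zeta_0\in\Omega$, let $C(\zeta_0,\varepsilon)$ be an (oriented) circle of radius $\varepsilon>0$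 centered at $\zeta_0$, lying in some 2-dimensional plane of $E_k$ containing $\zeta_0$, with the circle completely contained in $\Omega$. Let $C_u\subset\mathbb{C}$ be its image under $f_u$. The circle embraces the set $\{\zeta+\zeta_0:\zeta\in\bigcup_{u=1}^m M_u\}$ if for each $u=1,\dots,m$ the curve $C_u$ bounds some domain $D_u'\subset\mathbb{C}$ and $f_u(\zeta_0)\in D_u'$. A curve $\gamma\subset\Omega$ embraces once the set $\{\zeta+\zeta_0:\zeta\in\bigcup_{u=1}^m M_u\}$ if there exists a circle $C(\zeta_0,\varepsilon)$ which embraces this set and is homotopic to $\gamma$ (as oriented closed curves) in $\Omega\setminus\{\zeta+\zeta_0:\zeta\in\bigcup_{u=1}^m M_u\}$.
   Formalization: The circle C(ζ₀,ε) being completely contained in Ω is taken to mean that the whole closed flat disc it bounds lies in Ω; with only the circumference in Ω the claim fails (A=ℂ, Ω=ℂ∖{1/2}, Φ=1/(ζ−1/2), ζ₀=0, unit circle). *)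

theory Defs
  imports "HOL-Analysis.Analysis"
begin

section \<open>Commutative algebras with a Cartan basis\<close>

text \<open>
  The carrier is the whole type \<^typ>\<open>'a\<close>; its complex vector space structure is the parameter
  \<open>scaleC\<close>. The class \<^class>\<open>euclidean_space\<close> supplies nothing but the canonical topology of a
  finite-dimensional real vector space: every finite-dimensional algebra carries some inner product,
  and no compatibility of the inner product with the multiplication is required.
\<close>

locale cartan_algebra = vector_space scaleC
  for scaleC :: "complex \<Rightarrow> 'a::{comm_ring_1,real_algebra_1,euclidean_space} \<Rightarrow> 'a" +
  fixes n m :: nat and I :: "nat \<Rightarrow> 'a"
  assumes scaleC_of_real: "scaleC (complex_of_real t) x = t *\<^sub>R x"
    and scaleC_mult_left: "scaleC c (x * y) = scaleC c x * y"
    and m_le_n: "m \<le> n"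
    and basis_inj: "inj_on I {1..n}"
    and basis_independent: "independent (I ` {1..n})"
    and basis_span: "span (I ` {1..n}) = UNIV"
    and idempotents: "\<lbrakk>r \<in> {1..m}; s \<in> {1..m}\<rbrakk> \<Longrightarrow> I r * I s = (if r = s then I r else 0)"
    and nilpotents: "\<exists>\<Upsilon> :: nat \<Rightarrow> nat \<Rightarrow> nat \<Rightarrow> complex. \<forall>r\<in>{m+1..n}. \<forall>s\<in>{m+1..n}.
          I r * I s = (\<Sum>p\<in>{max r s + 1..n}. scaleC (\<Upsilon> r p s) (I p))"
    and mixed: "s \<in> {m+1..n} \<Longrightarrow>
          \<exists>!u. u \<in> {1..m} \<and> (\<forall>r\<in>{1..m}. I r * I s = (if r = u then I s else 0))"
    and one_eq: "1 = (\<Sum>u\<in>{1..m}. I u)"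

text \<open>
  The dual basis: \<open>basis_functional scaleC n I r\<close> is the complex-linear functional that is \<open>1\<close> at
  \<open>I r\<close> and \<open>0\<close> at the other basis elements. For \<open>r \<le> m\<close> it is the multiplicative functional \<open>f\<^sub>r\<close>;
  for arbitrary \<open>r \<le> n\<close> it gives the coefficients of an element.
\<close>

definition basis_functional ::
  "(complex \<Rightarrow> 'a::ab_group_add \<Rightarrow> 'a) \<Rightarrow> nat \<Rightarrow> (nat \<Rightarrow> 'a) \<Rightarrow> nat \<Rightarrow> 'a \<Rightarrow> complex" where
  "basis_functional scaleC n I r =
     (THE g. Vector_Spaces.linear scaleC (*) g \<and> (\<forall>s\<in>{1..n}. g (I s) = (if s = r then 1 else 0)))"

context cartan_algebra
begin

lemma ex1_basis_functional:
  assumes r: "r \<in> {1..n}"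
  shows "\<exists>!g. Vector_Spaces.linear scaleC (*) g \<and> (\<forall>s\<in>{1..n}. g (I s) = (if s = r then 1 else 0))"
proof -
  interpret C: vector_space "(*) :: complex \<Rightarrow> complex \<Rightarrow> complex"
    by unfold_locales (auto simp: algebra_simps)
  interpret P: vector_space_pair scaleC "(*) :: complex \<Rightarrow> complex \<Rightarrow> complex" ..
  let ?B = "I ` {1..n}"
  define g where "g = P.construct ?B (\<lambda>b. if b = I r then 1 else 0)"
  have lin: "Vector_Spaces.linear scaleC (*) g"
    unfolding g_def by (rule P.linear_construct[OF basis_independent])
  have val: "g (I s) = (if s = r then 1 else 0)" if "s \<in> {1..n}" for s
  proof -
    have "g (I s) = (if I s = I r then 1 else 0)"
      unfolding g_def by (rule P.construct_basis[OF basis_independent imageI[OF that]])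
    also have "I s = I r \<longleftrightarrow> s = r"
      by (rule inj_on_eq_iff[OF basis_inj that r])
    finally show ?thesis .
  qed
  show ?thesis
  proof (rule ex1I[of _ g])
    show "Vector_Spaces.linear scaleC (*) g \<and> (\<forall>s\<in>{1..n}. g (I s) = (if s = r then 1 else 0))"
      using lin val by blast
  next
    fix h
    assume h: "Vector_Spaces.linear scaleC (*) h \<and> (\<forall>s\<in>{1..n}. h (I s) = (if s = r then 1 else 0))"
    show "h = g"
    proof
      fix x
      have x: "x \<in> span ?B" unfolding basis_span by (rule UNIV_I)
      have eq: "h b = g b" if "b \<in> ?B" for b
        using that h val by (elim imageE) simp
      show "h x = g x"
        by (rule P.linear_eq_on[OF conjunct1[OF h] lin x eq])
    qed
  qed
qed

lemma
  assumes "r \<in> {1..n}"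
  shows linear_basis_functional: "Vector_Spaces.linear scaleC (*) (basis_functional scaleC n I r)"
    and basis_functional_basis:
      "s \<in> {1..n} \<Longrightarrow> basis_functional scaleC n I r (I s) = (if s = r then 1 else 0)"
  using theI'[OF ex1_basis_functional[OF assms]] unfolding basis_functional_def by blast+

end

text \<open>Only meaningful for invertible \<open>a\<close>; the inverse is then unique.\<close>

definition alg_inverse :: "'a::comm_ring_1 \<Rightarrow> 'a" where
  "alg_inverse a = (THE b. a * b = 1)"


section \<open>The subspace \<open>E\<^sub>k\<close>\<close>

text \<open>
  Points of \<open>E\<^sub>k\<close> are represented by their coordinate vectors \<open>x\<close>, and \<open>elem e x\<close> is the element
  \<open>\<zeta> = \<Sum>\<^sub>j x\<^sub>j e\<^sub>j\<close>. Subsets of \<open>E\<^sub>k\<close>, curves in \<open>E\<^sub>k\<close> and functions on subsets of \<open>E\<^sub>k\<close> are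
  given in these coordinates, so that all metric notions are those of \<^typ>\<open>real^'k\<close>.
\<close>

definition elem :: "('k::finite \<Rightarrow> 'a::real_vector) \<Rightarrow> real^'k \<Rightarrow> 'a" where
  "elem e x = (\<Sum>j\<in>UNIV. (x $ j) *\<^sub>R e j)"

definition M_set ::
  "(complex \<Rightarrow> 'a::real_vector \<Rightarrow> 'a) \<Rightarrow> nat \<Rightarrow> (nat \<Rightarrow> 'a) \<Rightarrow> ('k::finite \<Rightarrow> 'a) \<Rightarrow> nat \<Rightarrow> (real^'k) set" where
  "M_set scaleC n I e u = {x. basis_functional scaleC n I u (elem e x) = 0}"

definition is_domain :: "'b::topological_space set \<Rightarrow> bool" where
  "is_domain D \<longleftrightarrow> D \<noteq> {} \<and> open D \<and> connected D"

definition convex_wrt_directions :: "'b::real_vector set \<Rightarrow> 'b set \<Rightarrow> bool" where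
  "convex_wrt_directions M \<Omega> \<longleftrightarrow> (\<forall>x\<in>\<Omega>. \<forall>y\<in>\<Omega>. y - x \<in> M \<longrightarrow> closed_segment x y \<subseteq> \<Omega>)"

definition monogenic_on ::
  "('k::finite \<Rightarrow> 'a::{real_algebra_1,real_normed_vector}) \<Rightarrow> (real^'k \<Rightarrow> 'a) \<Rightarrow> (real^'k) set \<Rightarrow> bool" where
  "monogenic_on e \<Phi> \<Omega> \<longleftrightarrow> continuous_on \<Omega> \<Phi> \<and>
     (\<forall>x\<in>\<Omega>. \<exists>d. \<forall>h.
        ((\<lambda>\<epsilon>. (\<Phi> (x + \<epsilon> *\<^sub>R h) - \<Phi> x) /\<^sub>R \<epsilon>) \<longlongrightarrow> elem e h * d) (at_right 0))"


section \<open>Integrals along rectifiable curves\<close>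

definition rectifiable :: "(real \<Rightarrow> 'b::real_normed_vector) \<Rightarrow> bool" where
  "rectifiable \<gamma> \<longleftrightarrow>
     (\<exists>L. \<forall>d. d division_of {0..1} \<longrightarrow> (\<Sum>K\<in>d. norm (\<gamma> (Sup K) - \<gamma> (Inf K))) \<le> L)"

text \<open>
  The Riemann--Stieltjes integral \<open>\<integral>\<^bsub>\<gamma>\<^esub> U dx\<^sub>j\<close>: since \<open>\<delta>\<close> is a constant, fineness bounds the
  mesh of the partition.
\<close>

definition has_line_integral ::
  "(real^'k \<Rightarrow> real) \<Rightarrow> 'k::finite \<Rightarrow> (real \<Rightarrow> real^'k) \<Rightarrow> real \<Rightarrow> bool" where
  "has_line_integral U j \<gamma> L \<longleftrightarrow>
     (\<forall>\<epsilon>>0. \<exists>\<delta>>0. \<forall>p. p tagged_division_of {0..1} \<and> (\<lambda>t. ball t \<delta>) fine p \<longrightarrow>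
        \<bar>(\<Sum>(t, K)\<in>p. U (\<gamma> t) * (\<gamma> (Sup K) $ j - \<gamma> (Inf K) $ j)) - L\<bar> < \<epsilon>)"

definition line_integral ::
  "(real^'k \<Rightarrow> real) \<Rightarrow> 'k::finite \<Rightarrow> (real \<Rightarrow> real^'k) \<Rightarrow> real" where
  "line_integral U j \<gamma> = (THE L. has_line_integral U j \<gamma> L)"

lemma line_integral_eqI:
  assumes "has_line_integral U j \<gamma> L"
  shows "line_integral U j \<gamma> = L"
  unfolding line_integral_def
proof (rule the_equality, rule assms)
  fix L' assume L': "has_line_integral U j \<gamma> L'"
  show "L' = L"
  proof (rule ccontr)
    assume "L' \<noteq> L"
    then have pos: "\<bar>L' - L\<bar> / 2 > 0" by simp
    let ?S = "\<lambda>p. \<Sum>(t, K)\<in>p. U (\<gamma> t) * (\<gamma> (Sup K) $ j - \<gamma> (Inf K) $ j)"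
    obtain d where d: "d > 0" "\<And>p. p tagged_division_of {0..1} \<Longrightarrow> (\<lambda>t. ball t d) fine p
        \<Longrightarrow> \<bar>?S p - L\<bar> < \<bar>L' - L\<bar> / 2"
      using assms pos unfolding has_line_integral_def by meson
    obtain d' where d': "d' > 0" "\<And>p. p tagged_division_of {0..1} \<Longrightarrow> (\<lambda>t. ball t d') fine p
        \<Longrightarrow> \<bar>?S p - L'\<bar> < \<bar>L' - L\<bar> / 2"
      using L' pos unfolding has_line_integral_def by meson
    have "gauge (\<lambda>t::real. ball t (min d d'))"
      using d(1) d'(1) by (intro gauge_ball_dependent) simp
    then obtain p where p: "p tagged_division_of {0..1::real}" "(\<lambda>t. ball t (min d d')) fine p"
      using fine_division_exists_real by blast
    have "ball t (min d d') \<subseteq> ball t d" "ball t (min d d') \<subseteq> ball t d'" for t :: real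
      by (rule subset_ball, simp)+
    then have "(\<lambda>t. ball t d) fine p" "(\<lambda>t. ball t d') fine p"
      using p(2) unfolding fine_def by blast+
    then have "\<bar>?S p - L\<bar> < \<bar>L' - L\<bar> / 2" "\<bar>?S p - L'\<bar> < \<bar>L' - L\<bar> / 2"
      using d(2)[OF p(1)] d'(2)[OF p(1)] by blast+
    moreover have False if "\<bar>s - L\<bar> < \<bar>L' - L\<bar> / 2" "\<bar>s - L'\<bar> < \<bar>L' - L\<bar> / 2" for s
      using that by (simp add: abs_if field_simps split: if_splits)
    ultimately show False by blast
  qed
qed

definition alg_integral ::
  "(complex \<Rightarrow> 'a::{real_algebra_1,real_normed_vector} \<Rightarrow> 'a) \<Rightarrow> nat \<Rightarrow> (nat \<Rightarrow> 'a) \<Rightarrow> ('k::finite \<Rightarrow> 'a) \<Rightarrow>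
   (real \<Rightarrow> real^'k) \<Rightarrow> (real^'k \<Rightarrow> 'a) \<Rightarrow> 'a" where
  "alg_integral scaleC n I e \<gamma> \<Psi> =
     (\<Sum>j\<in>UNIV. e j * (\<Sum>r\<in>{1..n}.
        line_integral (\<lambda>x. Re (basis_functional scaleC n I r (\<Psi> x))) j \<gamma> *\<^sub>R I r)) +
     scaleC \<i> (\<Sum>j\<in>UNIV. e j * (\<Sum>r\<in>{1..n}.
        line_integral (\<lambda>x. Im (basis_functional scaleC n I r (\<Psi> x))) j \<gamma> *\<^sub>R I r))"


section \<open>Circles and the embracing condition\<close>

text \<open>
  The circle of radius \<open>\<rho>\<close> about \<open>x0\<close> in the plane through \<open>x0\<close> spanned by the orthonormal
  pair \<open>a\<close>, \<open>b\<close>, oriented from \<open>a\<close> to \<open>b\<close>.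
\<close>

definition circle :: "'b::real_vector \<Rightarrow> real \<Rightarrow> 'b \<Rightarrow> 'b \<Rightarrow> real \<Rightarrow> 'b" where
  "circle x0 \<rho> a b t = x0 + \<rho> *\<^sub>R (cos (2 * pi * t) *\<^sub>R a + sin (2 * pi * t) *\<^sub>R b)"

definition plane_disc :: "'b::real_normed_vector \<Rightarrow> real \<Rightarrow> 'b \<Rightarrow> 'b \<Rightarrow> 'b set" where
  "plane_disc x0 \<rho> a b = {x0 + v |v. v \<in> span {a, b} \<and> norm v \<le> \<rho>}"

definition orthonormal_pair :: "'b::real_inner \<Rightarrow> 'b \<Rightarrow> bool" where
  "orthonormal_pair a b \<longleftrightarrow> norm a = 1 \<and> norm b = 1 \<and> a \<bullet> b = 0"

definition singular_set ::
  "(complex \<Rightarrow> 'a::real_vector \<Rightarrow> 'a) \<Rightarrow> nat \<Rightarrow> nat \<Rightarrow> (nat \<Rightarrow> 'a) \<Rightarrow> ('k::finite \<Rightarrow> 'a) \<Rightarrow> real^'k \<Rightarrow> (real^'k) set" where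
  "singular_set scaleC n m I e x0 = {x + x0 |x. x \<in> (\<Union>u\<in>{1..m}. M_set scaleC n I e u)}"

text \<open>
  ``The circle is completely contained in \<open>\<Omega>\<close>'' refers to the round disc, not only to its
  circumference. Otherwise Cauchy's formula already fails for the algebra of complex numbers: take
  \<open>\<Omega>\<close> to be the plane without the point \<open>1/2\<close>, \<open>\<Phi> \<zeta> = 1 / (\<zeta> - 1/2)\<close> and the unit circle.
\<close>

definition circle_embraces ::
  "(complex \<Rightarrow> 'a::real_vector \<Rightarrow> 'a) \<Rightarrow> nat \<Rightarrow> nat \<Rightarrow> (nat \<Rightarrow> 'a) \<Rightarrow> ('k::finite \<Rightarrow> 'a) \<Rightarrow>
   (real^'k) set \<Rightarrow> real^'k \<Rightarrow> real \<Rightarrow> real^'k \<Rightarrow> real^'k \<Rightarrow> bool" where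
  "circle_embraces scaleC n m I e \<Omega> x0 \<rho> a b \<longleftrightarrow>
     \<rho> > 0 \<and> orthonormal_pair a b \<and> plane_disc x0 \<rho> a b \<subseteq> \<Omega> \<and>
     (\<forall>u\<in>{1..m}. \<exists>D. is_domain D \<and> bounded D \<and>
        frontier D = (\<lambda>x. basis_functional scaleC n I u (elem e x)) ` path_image (circle x0 \<rho> a b) \<and>
        basis_functional scaleC n I u (elem e x0) \<in> D)"

text \<open>
  \<open>\<gamma>\<close> embraces once the singular set of \<open>x0\<close>, as witnessed by the circle given by \<open>\<rho>\<close>, \<open>a\<close>, \<open>b\<close>.
\<close>

definition embraces_once_via ::
  "(complex \<Rightarrow> 'a::real_vector \<Rightarrow> 'a) \<Rightarrow> nat \<Rightarrow> nat \<Rightarrow> (nat \<Rightarrow> 'a) \<Rightarrow> ('k::finite \<Rightarrow> 'a) \<Rightarrow>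
   (real^'k) set \<Rightarrow> real^'k \<Rightarrow> real \<Rightarrow> real^'k \<Rightarrow> real^'k \<Rightarrow> (real \<Rightarrow> real^'k) \<Rightarrow> bool" where
  "embraces_once_via scaleC n m I e \<Omega> x0 \<rho> a b \<gamma> \<longleftrightarrow>
     circle_embraces scaleC n m I e \<Omega> x0 \<rho> a b \<and>
     homotopic_loops (\<Omega> - singular_set scaleC n m I e x0) \<gamma> (circle x0 \<rho> a b)"

definition closed_jordan_rectifiable :: "(real \<Rightarrow> 'b::real_normed_vector) \<Rightarrow> bool" where
  "closed_jordan_rectifiable \<gamma> \<longleftrightarrow> simple_path \<gamma> \<and> pathfinish \<gamma> = pathstart \<gamma> \<and> rectifiable \<gamma>"

end

theory Submission
  imports Defs
begin

text \<open>
  Let \<open>S\<close> be the set of points \<open>\<zeta>\<close> at which \<open>\<zeta> - \<zeta>0\<close> is not invertible, and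
  \<open>\<Psi> \<zeta> = \<Phi> \<zeta> * (\<zeta> - \<zeta>0)\<inverse>\<close>. The formula follows from two facts: the integral of \<open>\<Psi>\<close> over a closed
  rectifiable curve in \<open>\<Omega> - S\<close> depends only on the homotopy class of the curve
  (\<open>alg_integral_homotopic\<close>), and the circle can be shrunk to radius \<open>r\<close> about \<open>\<zeta>0\<close> inside
  \<open>\<Omega> - S\<close>, where the substitution \<open>\<zeta> = \<zeta>0 + r w\<close> turns the integral into that of
  \<open>\<Phi> (\<zeta>0 + r w) * w\<inverse>\<close>, which tends to \<open>\<lambda> * \<Phi> \<zeta>0\<close> by the continuity of \<open>\<Phi>\<close>
  (\<open>alg_integral_small_circle\<close>).

  Homotopy invariance means that the one-form \<open>\<Psi> d\<zeta>\<close> is closed, that is, that its integrals over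
  small triangles vanish. The derivative of \<open>\<Psi>\<close> in the direction \<open>h\<close> is \<open>h * \<Psi>'\<close>, so the derivative
  of the form, evaluated at \<open>h\<close> and \<open>k\<close>, is \<open>k * (h * \<Psi>')\<close>, and this is symmetric because the algebra
  is commutative. The difficulty is that monogenic functions only have derivatives along rays:
  neither is the limit uniform in the direction, nor is the derivative known to be bounded. Goursat's
  bisection argument breaks down for such functions, and the proof follows the method of Looman
  and Menchoff instead, in the plane spanned by two directions.

  Call a point of the plane good if the integral over every rectangle near it vanishes. By Baire's
  theorem the set \<open>F\<close> of the other points, if nonempty, has a portion on which the function satisfies a
  uniform Lipschitz estimate in the directions of the axes and of a fixed open cone
  (\<open>lipschitz_portion\<close>). Shrinking a rectangle to the hull of its part of \<open>F\<close> then bounds its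
  integral by a multiple of the square of its diameter
  (\<open>rect_integral_crude_bound\<close>). Better, if the points of \<open>F\<close> at which finitely many directional
  derivatives are attained at a given scale are dense enough in the rectangle, then any two nearby points
  lie in the cones of one of them, so that the function is nearly affine on the whole rectangle and the integral
  is a small multiple of the area (\<open>rect_integral_good_cell\<close>). In a fine subdivision the
  rectangles without this property have small total area, because each of them contains a fixed proportion of points
  that are close to \<open>F\<close> and not in the dense part (\<open>rect_integral_zero_near\<close>). Hence every integral near the
  portion vanishes, and \<open>F\<close> is empty.
\<close>

section \<open>Integrals of one-forms over segments\<close>

definition seg_integral :: "('e::real_normed_vector \<Rightarrow> 'e \<Rightarrow> 'v::euclidean_space) \<Rightarrow> 'e \<Rightarrow> 'e \<Rightarrow> 'v" where
  "seg_integral \<omega> p q = integral {0..1} (\<lambda>u. \<omega> (p + u *\<^sub>R (q - p)) (q - p))"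

definition continuous_form :: "'e::real_normed_vector set \<Rightarrow> ('e \<Rightarrow> 'e \<Rightarrow> 'v::euclidean_space) \<Rightarrow> bool" where
  "continuous_form U \<omega> \<longleftrightarrow> (\<forall>x. linear (\<omega> x)) \<and> continuous_on (U \<times> UNIV) (\<lambda>z. \<omega> (fst z) (snd z))"

lemma segment_point:
  assumes "closed_segment p q \<subseteq> U" "0 \<le> u" "u \<le> 1"
  shows "p + u *\<^sub>R (q - p) \<in> U"
proof -
  have "p + u *\<^sub>R (q - p) = (1 - u) *\<^sub>R p + u *\<^sub>R q" by (simp add: algebra_simps)
  then show ?thesis using assms unfolding closed_segment_def by blast
qed

lemma continuous_form_comp:
  assumes "continuous_form U \<omega>" "continuous_on T f" "f ` T \<subseteq> U" "continuous_on T h"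
  shows "continuous_on T (\<lambda>t. \<omega> (f t) (h t))"
proof -
  have c: "continuous_on (U \<times> UNIV) (\<lambda>z. \<omega> (fst z) (snd z))"
    using assms(1) by (simp add: continuous_form_def)
  have "continuous_on T (\<lambda>t. (f t, h t))" using assms by (intro continuous_intros)
  moreover have "(\<lambda>t. (f t, h t)) ` T \<subseteq> U \<times> UNIV" using assms(3) by auto
  ultimately show ?thesis using continuous_on_compose2[OF c] by fastforce
qed

lemma continuous_form_segment:
  assumes "continuous_form U \<omega>" "closed_segment p q \<subseteq> U"
  shows "continuous_on {0..1} (\<lambda>u. \<omega> (p + u *\<^sub>R (q - p)) (q - p))"
proof (rule continuous_form_comp[OF assms(1)])
  show "continuous_on {0..1} (\<lambda>u. p + u *\<^sub>R (q - p))" by (intro continuous_intros)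
  show "(\<lambda>u. p + u *\<^sub>R (q - p)) ` {0..1} \<subseteq> U" using segment_point[OF assms(2)] by auto
qed simp

lemma seg_integral_diff_le:
  assumes "continuous_form U \<omega>" "continuous_form U \<eta>" "closed_segment p q \<subseteq> U"
    and "\<And>x. x \<in> closed_segment p q \<Longrightarrow> norm (\<omega> x (q - p) - \<eta> x (q - p)) \<le> M"
  shows "norm (seg_integral \<omega> p q - seg_integral \<eta> p q) \<le> M"
proof -
  let ?f = "\<lambda>u. \<omega> (p + u *\<^sub>R (q - p)) (q - p)" and ?h = "\<lambda>u. \<eta> (p + u *\<^sub>R (q - p)) (q - p)"
  have i: "?f integrable_on {0..1}" "?h integrable_on {0..1}"
    using continuous_form_segment[OF assms(1,3)] continuous_form_segment[OF assms(2,3)]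
    by (auto intro: integrable_continuous_real)
  have "seg_integral \<omega> p q - seg_integral \<eta> p q = integral {0..1} (\<lambda>u. ?f u - ?h u)"
    unfolding seg_integral_def by (rule integral_diff[symmetric, OF i])
  also have "norm \<dots> \<le> integral {0..1::real} (\<lambda>u. M)"
    using segment_point[of p q "closed_segment p q"]
    by (intro integral_norm_bound_integral integrable_diff i assms(4)) auto
  finally show ?thesis by simp
qed

text \<open>
  Used with a value \<open>v\<close> of the form on \<open>q - p\<close>: the integral differs from it by no more than the
  oscillation of the form.
\<close>

lemma seg_integral_near_value:
  assumes \<omega>: "continuous_form W \<omega>" and sub: "closed_segment p q \<subseteq> W"
    and e: "\<And>z. z \<in> closed_segment p q \<Longrightarrow> norm (\<omega> z (q - p) - v) \<le> e"
  shows "norm (seg_integral \<omega> p q - v) \<le> e"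
proof -
  let ?f = "\<lambda>u. \<omega> (p + u *\<^sub>R (q - p)) (q - p)"
  have i: "?f integrable_on {0..1}"
    by (rule integrable_continuous_real[OF continuous_form_segment[OF \<omega> sub]])
  have "seg_integral \<omega> p q - v = integral {0..1} ?f - integral {0..1::real} (\<lambda>u. v)"
    by (simp add: seg_integral_def)
  also have "\<dots> = integral {0..1} (\<lambda>u. ?f u - v)"
    by (rule integral_diff[symmetric, OF i integrable_continuous_real[OF continuous_on_const]])
  also have "norm \<dots> \<le> integral {0..1::real} (\<lambda>u. e)"
    using segment_point[of p q "closed_segment p q"]
    by (intro integral_norm_bound_integral integrable_diff i e integrable_continuous_real[OF continuous_on_const]) auto
  finally show ?thesis by simp
qed

lemma seg_integral_self: "linear (\<omega> p) \<Longrightarrow> seg_integral \<omega> p p = 0"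
  by (simp add: seg_integral_def linear_0)

lemma seg_integral_potential:
  assumes "\<And>u. u \<in> {0..1} \<Longrightarrow>
    ((\<lambda>u. V (p + u *\<^sub>R (q - p))) has_vector_derivative \<omega> (p + u *\<^sub>R (q - p)) (q - p)) (at u within {0..1})"
  shows "seg_integral \<omega> p q = V q - V p"
  using fundamental_theorem_of_calculus[OF zero_le_one assms]
  unfolding seg_integral_def by (metis (no_types, lifting) add.right_neutral add_diff_cancel_left' add_diff_eq
      integral_unique scale_zero_left scaleR_one)

text \<open>A primitive along a line serves all of its subsegments, in either direction; splitting and
  reversing segments both follow.\<close>

lemma seg_integral_line_primitive:
  assumes "continuous_form U \<omega>" "closed_segment p q \<subseteq> U"
  obtains F where "\<And>\<alpha> \<beta>. \<alpha> \<in> {0..1} \<Longrightarrow> \<beta> \<in> {0..1} \<Longrightarrow>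
    seg_integral \<omega> (p + \<alpha> *\<^sub>R (q - p)) (p + \<beta> *\<^sub>R (q - p)) = F \<beta> - F \<alpha>"
proof -
  define f where "f u = \<omega> (p + u *\<^sub>R (q - p)) (q - p)" for u
  define F where "F v = integral {0..v} f" for v
  have cf: "continuous_on {0..1} f"
    unfolding f_def by (rule continuous_form_segment[OF assms])
  have F: "(F has_vector_derivative f v) (at v within {0..1})" if "v \<in> {0..1}" for v
    unfolding F_def by (rule integral_has_vector_derivative[OF cf that])
  have lin: "linear (\<omega> x)" for x using assms(1) by (simp add: continuous_form_def)
  show thesis
  proof (rule that)
    fix \<alpha> \<beta> :: real assume ab: "\<alpha> \<in> {0..1}" "\<beta> \<in> {0..1}"
    let ?x = "p + \<alpha> *\<^sub>R (q - p)" and ?y = "p + \<beta> *\<^sub>R (q - p)"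
    have yx: "?y - ?x = (\<beta> - \<alpha>) *\<^sub>R (q - p)" by (simp add: algebra_simps)
    have pt: "?x + u *\<^sub>R (?y - ?x) = p + (\<alpha> + u * (\<beta> - \<alpha>)) *\<^sub>R (q - p)" for u
      unfolding yx by (simp add: algebra_simps)
    have w: "\<omega> (?x + u *\<^sub>R (?y - ?x)) (?y - ?x) = (\<beta> - \<alpha>) *\<^sub>R f (\<alpha> + u * (\<beta> - \<alpha>))" for u
      unfolding pt unfolding yx f_def by (simp add: linear_scale[OF lin])
    have r: "\<alpha> + u * (\<beta> - \<alpha>) \<in> {0..1}" if "u \<in> {0..1}" for u
    proof -
      have "\<alpha> + u * (\<beta> - \<alpha>) = (1 - u) * \<alpha> + u * \<beta>" by (simp add: algebra_simps)
      moreover have "0 \<le> (1 - u) * \<alpha> + u * \<beta>" using ab that by (intro add_nonneg_nonneg mult_nonneg_nonneg) auto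
      moreover have "(1 - u) * \<alpha> + u * \<beta> \<le> (1 - u) * 1 + u * 1"
        using ab that by (intro add_mono mult_left_mono) auto
      ultimately show ?thesis by auto
    qed
    have "((\<lambda>u. F (\<alpha> + u * (\<beta> - \<alpha>))) has_vector_derivative (\<beta> - \<alpha>) *\<^sub>R f (\<alpha> + u * (\<beta> - \<alpha>))) (at u within {0..1})"
      if u: "u \<in> {0..1}" for u
    proof -
      have 1: "((\<lambda>u. \<alpha> + u * (\<beta> - \<alpha>)) has_vector_derivative (\<beta> - \<alpha>)) (at u within {0..1})"
        by (auto intro!: derivative_eq_intros simp: has_real_derivative_iff_has_vector_derivative[symmetric])
      have 2: "(F has_vector_derivative f (\<alpha> + u * (\<beta> - \<alpha>))) (at (\<alpha> + u * (\<beta> - \<alpha>)) within (\<lambda>u. \<alpha> + u * (\<beta> - \<alpha>)) ` {0..1})"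
        using F[OF r[OF u]] by (rule has_vector_derivative_within_subset) (use r in auto)
      show ?thesis using vector_diff_chain_within[OF 1 2] by (simp add: o_def)
    qed
    then have "((\<lambda>u. (\<beta> - \<alpha>) *\<^sub>R f (\<alpha> + u * (\<beta> - \<alpha>))) has_integral
        F (\<alpha> + 1 * (\<beta> - \<alpha>)) - F (\<alpha> + 0 * (\<beta> - \<alpha>))) {0..1}"
      by (rule fundamental_theorem_of_calculus[OF zero_le_one])
    then have "integral {0..1} (\<lambda>u. (\<beta> - \<alpha>) *\<^sub>R f (\<alpha> + u * (\<beta> - \<alpha>))) = F \<beta> - F \<alpha>"
      by (metis (no_types, lifting) integral_unique add.right_neutral diff_add_cancel add.commute mult_1 mult_zero_left)
    then show "seg_integral \<omega> ?x ?y = F \<beta> - F \<alpha>"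
      unfolding seg_integral_def w .
  qed
qed

lemma seg_integral_split:
  assumes "continuous_form U \<omega>" "closed_segment p q \<subseteq> U" "x \<in> closed_segment p q"
  shows "seg_integral \<omega> p q = seg_integral \<omega> p x + seg_integral \<omega> x q"
proof -
  obtain F where F: "\<And>\<alpha> \<beta>. \<alpha> \<in> {0..1} \<Longrightarrow> \<beta> \<in> {0..1} \<Longrightarrow>
    seg_integral \<omega> (p + \<alpha> *\<^sub>R (q - p)) (p + \<beta> *\<^sub>R (q - p)) = F \<beta> - F \<alpha>"
    by (rule seg_integral_line_primitive[OF assms(1,2)]) blast
  obtain v where v: "v \<in> {0..1}" "x = p + v *\<^sub>R (q - p)"
    using assms(3) by (auto simp: closed_segment_def algebra_simps)
  show ?thesis using F[of 0 1] F[of 0 v] F[of v 1] v by simp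
qed

lemma seg_integral_reverse:
  assumes "continuous_form U \<omega>" "closed_segment p q \<subseteq> U"
  shows "seg_integral \<omega> q p = - seg_integral \<omega> p q"
proof -
  obtain F where F: "\<And>\<alpha> \<beta>. \<alpha> \<in> {0..1} \<Longrightarrow> \<beta> \<in> {0..1} \<Longrightarrow>
    seg_integral \<omega> (p + \<alpha> *\<^sub>R (q - p)) (p + \<beta> *\<^sub>R (q - p)) = F \<beta> - F \<alpha>"
    by (rule seg_integral_line_primitive[OF assms]) blast
  show ?thesis using F[of 0 1] F[of 1 0] by simp
qed

lemma continuous_on_seg_integral:
  fixes \<omega> :: "'e::real_normed_vector \<Rightarrow> 'e \<Rightarrow> 'v::euclidean_space"
    and f h :: "'x::topological_space \<Rightarrow> 'e"
  assumes "continuous_form U \<omega>" "continuous_on T f" "continuous_on T h"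
    and "\<And>t. t \<in> T \<Longrightarrow> closed_segment (f t) (h t) \<subseteq> U"
  shows "continuous_on T (\<lambda>t. seg_integral \<omega> (f t) (h t))"
proof -
  have "continuous_on (T \<times> cbox 0 1) (\<lambda>(t, u::real). \<omega> (f t + u *\<^sub>R (h t - f t)) (h t - f t))"
    unfolding case_prod_beta
  proof (rule continuous_form_comp[OF assms(1)])
    have 1: "continuous_on (T \<times> cbox 0 1) (\<lambda>z. f (fst z))" "continuous_on (T \<times> cbox 0 1) (\<lambda>z. h (fst z))"
      by (auto intro!: continuous_on_compose2[OF assms(2)] continuous_on_compose2[OF assms(3)] continuous_intros)
    show "continuous_on (T \<times> cbox 0 1) (\<lambda>z. f (fst z) + snd z *\<^sub>R (h (fst z) - f (fst z)))"
      "continuous_on (T \<times> cbox 0 1) (\<lambda>z. h (fst z) - f (fst z))"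
      by (intro continuous_intros 1)+
    show "(\<lambda>z. f (fst z) + snd z *\<^sub>R (h (fst z) - f (fst z))) ` (T \<times> cbox 0 1) \<subseteq> U"
      using segment_point[OF assms(4)] by auto
  qed
  from integral_continuous_on_param[OF this] show ?thesis
    by (simp add: seg_integral_def)
qed

section \<open>Forms in the plane\<close>

text \<open>The pair \<open>g = (A, B)\<close> stands for the form \<open>A ds + B dt\<close>.\<close>

definition plane_form :: "(real \<times> real \<Rightarrow> 'v \<times> 'v) \<Rightarrow> real \<times> real \<Rightarrow> real \<times> real \<Rightarrow> 'v::euclidean_space" where
  "plane_form g x h = fst h *\<^sub>R fst (g x) + snd h *\<^sub>R snd (g x)"

definition rect_integral :: "(real \<times> real \<Rightarrow> 'v \<times> 'v) \<Rightarrow> real \<Rightarrow> real \<Rightarrow> real \<Rightarrow> real \<Rightarrow> 'v::euclidean_space" where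
  "rect_integral g a b c d =
     seg_integral (plane_form g) (a, c) (b, c) + seg_integral (plane_form g) (b, c) (b, d) +
     seg_integral (plane_form g) (b, d) (a, d) + seg_integral (plane_form g) (a, d) (a, c)"

definition affine_map :: "'v \<Rightarrow> 'v \<Rightarrow> 'v \<Rightarrow> real \<times> real \<Rightarrow> real \<times> real \<Rightarrow> 'v::real_vector" where
  "affine_map g0 D1 D2 p x = g0 + (fst x - fst p) *\<^sub>R D1 + (snd x - snd p) *\<^sub>R D2"

lemma linear_plane_form: "linear (plane_form g x)"
  by (rule linearI) (simp_all add: plane_form_def algebra_simps)

lemma continuous_plane_form: "continuous_on U g \<Longrightarrow> continuous_form U (plane_form g)"
  unfolding continuous_form_def plane_form_def using linear_plane_form[of g, unfolded plane_form_def]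
  by (auto intro!: continuous_intros continuous_on_compose2[of U g])

lemma continuous_affine_map: "continuous_on T (affine_map (g0 :: 'v::real_normed_vector) D1 D2 p)"
  unfolding affine_map_def by (intro continuous_intros)

lemma in_rect_iff: "x \<in> cbox (a, c) (b, d) \<longleftrightarrow> a \<le> fst x \<and> fst x \<le> b \<and> c \<le> snd x \<and> snd x \<le> (d::real)"
  for a b :: real
  by (cases x) (auto simp: cbox_Pair_eq)

lemma closed_segment_rect:
  fixes a b c d :: real
  assumes "(s, t) \<in> cbox (a, c) (b, d)" "(s', t') \<in> cbox (a, c) (b, d)"
  shows "closed_segment (s, t) (s', t') \<subseteq> cbox (a, c) (b, d)"
  using assms by (intro closed_segment_subset convex_box) auto

lemma horizontal_segment: "x \<in> closed_segment (s, t) (s', t) \<Longrightarrow> snd x = (t::real)" for s :: real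
  by (cases x) (auto simp: closed_segment_def algebra_simps)

lemma vertical_segment: "x \<in> closed_segment (s, t) (s, t') \<Longrightarrow> fst x = (s::real)" for t :: real
  by (cases x) (auto simp: closed_segment_def algebra_simps)

lemma mid_horizontal: "a \<le> m \<Longrightarrow> m \<le> b \<Longrightarrow> (m, c) \<in> closed_segment (a, c) (b, c :: real)" for a :: real
proof -
  assume "a \<le> m" "m \<le> b"
  then have "m \<in> closed_segment a b" by (simp add: closed_segment_eq_real_ivl)
  then obtain u where "0 \<le> u" "u \<le> 1" "m = (1 - u) * a + u * b" by (auto simp: closed_segment_def)
  then show ?thesis unfolding closed_segment_def by (auto intro!: exI[of _ u] simp: algebra_simps)
qed

lemma mid_vertical: "c \<le> m \<Longrightarrow> m \<le> d \<Longrightarrow> (a, m) \<in> closed_segment (a, c) (a, d :: real)" for a :: real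
proof -
  assume "c \<le> m" "m \<le> d"
  then have "m \<in> closed_segment c d" by (simp add: closed_segment_eq_real_ivl)
  then obtain u where "0 \<le> u" "u \<le> 1" "m = (1 - u) * c + u * d" by (auto simp: closed_segment_def)
  then show ?thesis unfolding closed_segment_def by (auto intro!: exI[of _ u] simp: algebra_simps)
qed

lemma rect_integral_split_horizontal:
  assumes g: "continuous_on (cbox (a, c) (b, d)) g" and "a \<le> m" "m \<le> b" "c \<le> d"
  shows "rect_integral g a b c d = rect_integral g a m c d + rect_integral g m b c d"
proof -
  let ?S = "seg_integral (plane_form g)"
  note cf = continuous_plane_form[OF g]
  have "?S (a, c) (b, c) = ?S (a, c) (m, c) + ?S (m, c) (b, c)"
    using assms by (intro seg_integral_split[OF cf] mid_horizontal closed_segment_rect) (auto simp: in_rect_iff)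
  moreover have "?S (a, d) (b, d) = ?S (a, d) (m, d) + ?S (m, d) (b, d)"
    using assms by (intro seg_integral_split[OF cf] mid_horizontal closed_segment_rect) (auto simp: in_rect_iff)
  moreover have "?S (b, d) (a, d) = - ?S (a, d) (b, d)" "?S (m, d) (a, d) = - ?S (a, d) (m, d)"
    "?S (b, d) (m, d) = - ?S (m, d) (b, d)" "?S (m, d) (m, c) = - ?S (m, c) (m, d)"
    using assms by (intro seg_integral_reverse[OF cf] closed_segment_rect; auto simp: in_rect_iff)+
  ultimately show ?thesis unfolding rect_integral_def by simp
qed

lemma rect_integral_split_vertical:
  assumes g: "continuous_on (cbox (a, c) (b, d)) g" and "c \<le> m" "m \<le> d" "a \<le> b"
  shows "rect_integral g a b c d = rect_integral g a b c m + rect_integral g a b m d"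
proof -
  let ?S = "seg_integral (plane_form g)"
  note cf = continuous_plane_form[OF g]
  have "?S (a, c) (a, d) = ?S (a, c) (a, m) + ?S (a, m) (a, d)"
    using assms by (intro seg_integral_split[OF cf] mid_vertical closed_segment_rect) (auto simp: in_rect_iff)
  moreover have "?S (b, c) (b, d) = ?S (b, c) (b, m) + ?S (b, m) (b, d)"
    using assms by (intro seg_integral_split[OF cf] mid_vertical closed_segment_rect) (auto simp: in_rect_iff)
  moreover have "?S (a, d) (a, c) = - ?S (a, c) (a, d)" "?S (a, m) (a, c) = - ?S (a, c) (a, m)"
    "?S (a, d) (a, m) = - ?S (a, m) (a, d)" "?S (b, m) (a, m) = - ?S (a, m) (b, m)"
    using assms by (intro seg_integral_reverse[OF cf] closed_segment_rect; auto simp: in_rect_iff)+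
  ultimately show ?thesis unfolding rect_integral_def by simp
qed

text \<open>The integrals over the common sides cancel.\<close>

lemma rect_integral_quarters:
  assumes g: "continuous_on (cbox (a, c) (b, d)) g" and "a \<le> m" "m \<le> b" "c \<le> l" "l \<le> d"
  shows "rect_integral g a b c d = rect_integral g a m c l + rect_integral g a m l d +
           rect_integral g m b c l + rect_integral g m b l d"
proof -
  have 1: "continuous_on (cbox (a, c) (m, d)) g" "continuous_on (cbox (m, c) (b, d)) g"
    using assms by (auto intro!: continuous_on_subset[OF g] simp: subset_iff in_rect_iff)
  have "rect_integral g a b c d = rect_integral g a m c d + rect_integral g m b c d"
    using assms by (intro rect_integral_split_horizontal) auto
  moreover have "rect_integral g a m c d = rect_integral g a m c l + rect_integral g a m l d"
    "rect_integral g m b c d = rect_integral g m b c l + rect_integral g m b l d"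
    using assms 1 by (intro rect_integral_split_vertical; simp)+
  ultimately show ?thesis by simp
qed

text \<open>
  Repeated quartering. The cells of the last generation keep the proportions of the rectangle, so that
  the square of their diameter is comparable to their area.
\<close>

lemma quadtree_induct [consumes 2, case_names quarter cell]:
  fixes a b c d :: real and l :: nat
  assumes "a \<le> b" "c \<le> d"
    and step: "\<And>a b c d. a \<le> b \<Longrightarrow> c \<le> d \<Longrightarrow> cbox (a, c) (b, d) \<subseteq> Q \<Longrightarrow>
      P a ((a+b)/2) c ((c+d)/2) \<Longrightarrow> P a ((a+b)/2) ((c+d)/2) d \<Longrightarrow>
      P ((a+b)/2) b c ((c+d)/2) \<Longrightarrow> P ((a+b)/2) b ((c+d)/2) d \<Longrightarrow> P a b c d"
    and cell: "\<And>a' b' c' d'. a' \<le> b' \<Longrightarrow> c' \<le> d' \<Longrightarrow> cbox (a', c') (b', d') \<subseteq> Q \<Longrightarrow>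
      b' - a' = (b - a) / 2 ^ l \<Longrightarrow> d' - c' = (d - c) / 2 ^ l \<Longrightarrow> P a' b' c' d'"
    and Q: "cbox (a, c) (b, d) \<subseteq> Q"
  shows "P a b c d"
proof -
  have "P a' b' c' d'" if "a' \<le> b'" "c' \<le> d'" "cbox (a', c') (b', d') \<subseteq> Q"
    "b' - a' = (b - a) / 2 ^ l * 2 ^ k" "d' - c' = (d - c) / 2 ^ l * 2 ^ k" for k a' b' c' d'
    using that
  proof (induction k arbitrary: a' b' c' d')
    case 0
    then show ?case by (intro cell) auto
  next
    case (Suc k)
    define m where "m = (a' + b') / 2"
    define n where "n = (c' + d') / 2"
    have m: "a' \<le> m" "m \<le> b'" "c' \<le> n" "n \<le> d'" using Suc.prems by (auto simp: m_def n_def)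
    have e: "m - a' = (b' - a') / 2" "b' - m = (b' - a') / 2" "n - c' = (d' - c') / 2" "d' - n = (d' - c') / 2"
      by (simp_all add: m_def n_def field_simps)
    have s: "cbox (a', c') (m, n) \<subseteq> Q" "cbox (a', n) (m, d') \<subseteq> Q" "cbox (m, c') (b', n) \<subseteq> Q" "cbox (m, n) (b', d') \<subseteq> Q"
      using m by (auto intro!: subset_trans[OF _ Suc.prems(3)] simp: in_rect_iff)
    have q: "P a' m c' n" "P a' m n d'" "P m b' c' n" "P m b' n d'"
      by (intro Suc.IH m s; simp add: e Suc.prems)+
    show ?case
      by (rule step[OF Suc.prems(1-3)]) (use q in \<open>auto simp: m_def n_def\<close>)
  qed
  from this[of a b c d l] assms show ?thesis by simp
qed

text \<open>An affine form with symmetric derivative has a quadratic potential.\<close>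

lemma seg_integral_affine_map:
  assumes "fst D2 = snd D1"
  obtains V where "\<And>x y. seg_integral (plane_form (affine_map g0 D1 D2 p)) x y = V y - V x"
proof -
  define V where "V x = (fst x - fst p) *\<^sub>R fst g0 + (snd x - snd p) *\<^sub>R snd g0
     + ((fst x - fst p)^2 / 2) *\<^sub>R fst D1 + ((fst x - fst p) * (snd x - snd p)) *\<^sub>R fst D2
     + ((snd x - snd p)^2 / 2) *\<^sub>R snd D2" for x
  have sc: "((\<lambda>u. f u *\<^sub>R v) has_vector_derivative f' *\<^sub>R v) (at u within {0..1})"
    if "(f has_real_derivative f') (at u within {0..1})" for f f' and u :: real and v :: 'a
    using has_vector_derivative_scaleR[OF that has_vector_derivative_const[of v]] by simp
  have gen: "h1 *\<^sub>R A + h2 *\<^sub>R B + (s * h1) *\<^sub>R P + (s * h2 + h1 * t) *\<^sub>R Q + (t * h2) *\<^sub>R R =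
      h1 *\<^sub>R (A + s *\<^sub>R P + t *\<^sub>R Q) + h2 *\<^sub>R (B + s *\<^sub>R Q + t *\<^sub>R R)"
    for h1 h2 s t :: real and A B P Q R :: 'a
    by (simp add: algebra_simps)
  show thesis
  proof (rule that, rule seg_integral_potential)
    fix x y :: "real \<times> real" and u :: real
    obtain x1 x2 y1 y2 p1 p2 where [simp]: "x = (x1, x2)" "y = (y1, y2)" "p = (p1, p2)" by (metis surj_pair)
    have "((\<lambda>u. V (x + u *\<^sub>R (y - x))) has_vector_derivative
       ((y1 - x1) *\<^sub>R fst g0 + (y2 - x2) *\<^sub>R snd g0
       + ((x1 + u * (y1 - x1) - p1) * (y1 - x1)) *\<^sub>R fst D1
       + ((x1 + u * (y1 - x1) - p1) * (y2 - x2) + (y1 - x1) * (x2 + u * (y2 - x2) - p2)) *\<^sub>R fst D2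
       + ((x2 + u * (y2 - x2) - p2) * (y2 - x2)) *\<^sub>R snd D2)) (at u within {0..1})"
      unfolding V_def
      by (simp, intro has_vector_derivative_add sc; (auto intro!: derivative_eq_intros simp: algebra_simps power2_eq_square; fail)?)
        (auto intro!: derivative_eq_intros simp: field_simps power2_eq_square)
    also have "((y1 - x1) *\<^sub>R fst g0 + (y2 - x2) *\<^sub>R snd g0
       + ((x1 + u * (y1 - x1) - p1) * (y1 - x1)) *\<^sub>R fst D1
       + ((x1 + u * (y1 - x1) - p1) * (y2 - x2) + (y1 - x1) * (x2 + u * (y2 - x2) - p2)) *\<^sub>R fst D2
       + ((x2 + u * (y2 - x2) - p2) * (y2 - x2)) *\<^sub>R snd D2) =
       plane_form (affine_map g0 D1 D2 p) (x + u *\<^sub>R (y - x)) (y - x)"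
      unfolding gen by (simp add: plane_form_def affine_map_def assms[symmetric])
    finally show "((\<lambda>u. V (x + u *\<^sub>R (y - x))) has_vector_derivative
      plane_form (affine_map g0 D1 D2 p) (x + u *\<^sub>R (y - x)) (y - x)) (at u within {0..1})" .
  qed
qed

text \<open>
  Only the difference to the affine form contributes, since that form integrates to zero over the
  boundary. The values on the boundary matter alone, which is essential for the hull argument below.
\<close>

lemma rect_integral_affine_bound:
  assumes g: "continuous_on (cbox (a, c) (b, d)) g" and le: "a \<le> b" "c \<le> d"
    and sym: "fst D2 = snd D1"
    and M: "\<And>x. x \<in> cbox (a, c) (b, d) \<Longrightarrow> fst x = a \<or> fst x = b \<or> snd x = c \<or> snd x = d \<Longrightarrow>
      norm (g x - affine_map g0 D1 D2 p x) \<le> M"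
  shows "norm (rect_integral g a b c d) \<le> 2 * M * ((b - a) + (d - c))"
proof -
  let ?h = "affine_map g0 D1 D2 p"
  obtain V where V: "\<And>x y. seg_integral (plane_form ?h) x y = V y - V x"
    by (rule seg_integral_affine_map[OF sym]) blast
  note cf = continuous_plane_form[OF g]
  have pf: "norm (plane_form g x w - plane_form ?h x w) \<le> (\<bar>fst w\<bar> + \<bar>snd w\<bar>) * norm (g x - ?h x)" for x w
  proof -
    have "plane_form g x w - plane_form ?h x w = fst w *\<^sub>R fst (g x - ?h x) + snd w *\<^sub>R snd (g x - ?h x)"
      by (simp add: plane_form_def algebra_simps)
    also have "norm \<dots> \<le> \<bar>fst w\<bar> * norm (fst (g x - ?h x)) + \<bar>snd w\<bar> * norm (snd (g x - ?h x))"
      by (rule order_trans[OF norm_triangle_ineq]) simp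
    also have "\<dots> \<le> \<bar>fst w\<bar> * norm (g x - ?h x) + \<bar>snd w\<bar> * norm (g x - ?h x)"
      using norm_fst_le[of "fst (g x - ?h x)" "snd (g x - ?h x)"] norm_snd_le[of "snd (g x - ?h x)" "fst (g x - ?h x)"]
      by (intro add_mono mult_left_mono) (simp_all only: prod.collapse abs_ge_zero)
    finally show ?thesis by (simp add: algebra_simps)
  qed
  have seg: "norm (seg_integral (plane_form g) x y - (V y - V x)) \<le> (\<bar>fst y - fst x\<bar> + \<bar>snd y - snd x\<bar>) * M"
    if "closed_segment x y \<subseteq> cbox (a, c) (b, d)"
      "\<And>z. z \<in> closed_segment x y \<Longrightarrow> fst z = a \<or> fst z = b \<or> snd z = c \<or> snd z = d" for x y
    unfolding V[symmetric]
  proof (rule seg_integral_diff_le[OF cf continuous_plane_form[OF continuous_affine_map] that(1)])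
    fix z assume z: "z \<in> closed_segment x y"
    show "norm (plane_form g z (y - x) - plane_form ?h z (y - x)) \<le> (\<bar>fst y - fst x\<bar> + \<bar>snd y - snd x\<bar>) * M"
      using pf[of z "y - x"] M[of z] z that
      by (intro order_trans[OF pf] ) (auto intro!: mult_left_mono)
  qed
  have "norm (seg_integral (plane_form g) (a, c) (b, c) - (V (b, c) - V (a, c))) \<le> (b - a) * M"
    using seg[of "(a, c)" "(b, c)"] closed_segment_rect[of a c a c b d b c] le
    by (auto simp: in_rect_iff dest: horizontal_segment)
  moreover have "norm (seg_integral (plane_form g) (b, c) (b, d) - (V (b, d) - V (b, c))) \<le> (d - c) * M"
    using seg[of "(b, c)" "(b, d)"] closed_segment_rect[of b c a c b d b d] le
    by (auto simp: in_rect_iff dest: vertical_segment)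
  moreover have "norm (seg_integral (plane_form g) (b, d) (a, d) - (V (a, d) - V (b, d))) \<le> (b - a) * M"
    using seg[of "(b, d)" "(a, d)"] closed_segment_rect[of b d a c b d a d] le
    by (auto simp: in_rect_iff dest: horizontal_segment)
  moreover have "norm (seg_integral (plane_form g) (a, d) (a, c) - (V (a, c) - V (a, d))) \<le> (d - c) * M"
    using seg[of "(a, d)" "(a, c)"] closed_segment_rect[of a d a c b d a c] le
    by (auto simp: in_rect_iff dest: vertical_segment)
  moreover have "rect_integral g a b c d =
      (seg_integral (plane_form g) (a, c) (b, c) - (V (b, c) - V (a, c)))
    + (seg_integral (plane_form g) (b, c) (b, d) - (V (b, d) - V (b, c)))
    + (seg_integral (plane_form g) (b, d) (a, d) - (V (a, d) - V (b, d)))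
    + (seg_integral (plane_form g) (a, d) (a, c) - (V (a, c) - V (a, d)))"
    by (simp add: rect_integral_def)
  ultimately have "norm (rect_integral g a b c d) \<le> (b - a) * M + (d - c) * M + (b - a) * M + (d - c) * M"
    by (metis (no_types, lifting) norm_triangle_mono)
  then show ?thesis by (simp add: algebra_simps)
qed

lemma rect_integral_bound:
  assumes g: "continuous_on (cbox (a, c) (b, d)) g" and le: "a \<le> b" "c \<le> d"
    and M: "\<And>x. x \<in> cbox (a, c) (b, d) \<Longrightarrow> fst x = a \<or> fst x = b \<or> snd x = c \<or> snd x = d \<Longrightarrow>
      norm (g x - g0) \<le> M"
  shows "norm (rect_integral g a b c d) \<le> 2 * M * ((b - a) + (d - c))"
  by (rule rect_integral_affine_bound[OF g le, where ?D1.0 = 0 and ?D2.0 = 0 and ?g0.0 = g0 and p = 0]) (use M in \<open>auto simp: affine_map_def\<close>)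

lemma rect_integral_degenerate:
  assumes g: "continuous_on (cbox (a, c) (b, d)) g" and le: "a \<le> b" "c \<le> d" "a = b \<or> c = d"
  shows "rect_integral g a b c d = 0"
proof -
  note cf = continuous_plane_form[OF g]
  have s: "seg_integral (plane_form g) x x = 0" for x by (rule seg_integral_self[OF linear_plane_form])
  have "seg_integral (plane_form g) (b, d) (a, d) = - seg_integral (plane_form g) (a, d) (b, d)"
    "seg_integral (plane_form g) (a, d) (a, c) = - seg_integral (plane_form g) (a, c) (a, d)"
    using le by (intro seg_integral_reverse[OF cf] closed_segment_rect; auto simp: in_rect_iff)+
  with le s show ?thesis by (auto simp: rect_integral_def)
qed

text \<open>
  The integral depends continuously on the vertices, so it is the limit of the integrals over the
  rectangles shrunk by \<open>\<eta>\<close> on all sides.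
\<close>

lemma rect_integral_zero_if_interior_zero:
  assumes g: "continuous_on (cbox (a, c) (b, d)) g" and le: "a \<le> b" "c \<le> d"
    and inner: "\<And>a' b' c' d'. a < a' \<Longrightarrow> a' \<le> b' \<Longrightarrow> b' < b \<Longrightarrow> c < c' \<Longrightarrow> c' \<le> d' \<Longrightarrow> d' < d \<Longrightarrow>
      rect_integral g a' b' c' d' = 0"
  shows "rect_integral g a b c d = 0"
proof (cases "a = b \<or> c = d")
  case True
  then show ?thesis by (rule rect_integral_degenerate[OF g le])
next
  case False
  define r where "r = min (b - a) (d - c) / 2"
  have r: "r > 0" "2 * r \<le> b - a" "2 * r \<le> d - c" using False le by (auto simp: r_def min_def)
  let ?R = "\<lambda>\<eta>. rect_integral g (a + \<eta>) (b - \<eta>) (c + \<eta>) (d - \<eta>)"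
  have "continuous_on {0..r} ?R"
    unfolding rect_integral_def
    by (intro continuous_intros continuous_on_seg_integral[OF continuous_plane_form[OF g]] closed_segment_rect)
      (use r in \<open>auto simp: in_rect_iff\<close>)
  then have "(?R \<longlongrightarrow> ?R 0) (at 0 within {0..r})"
    using r unfolding continuous_on_def by (metis atLeastAtMost_iff less_eq_real_def)
  moreover have "(?R \<longlongrightarrow> 0) (at 0 within {0..r})"
  proof (rule tendsto_eventually)
    have "?R \<eta> = 0" if "\<eta> \<in> {0..r}" "\<eta> \<noteq> 0" for \<eta>
      using that r by (intro inner) auto
    then show "\<forall>\<^sub>F \<eta> in at 0 within {0..r}. ?R \<eta> = 0"
      by (simp add: eventually_at_filter)
  qed
  moreover have "at 0 within {0..r} \<noteq> bot"
    using r by (simp add: at_within_Icc_at_right)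
  ultimately show ?thesis
    using tendsto_unique by fastforce
qed

section \<open>Closed forms with directional derivatives\<close>

text \<open>
  The four reflections of a direction in the axes, and the four axis directions. The reflections make
  it possible to choose, for every point of a rectangle, a cone that points into the rectangle; the
  axis directions control the function along the sides of a rectangle.
\<close>

definition flips :: "(real \<times> real \<Rightarrow> real \<times> real) set" where
  "flips = (\<lambda>(\<sigma>, \<tau>) w. (\<sigma> * fst w, \<tau> * snd w)) ` ({-1, 1} \<times> {-1, 1}) \<union>
           (\<lambda>v w. v) ` {(1, 0), (-1, 0), (0, 1), (0, -1)}"

lemma finite_flips: "finite flips"
  by (simp add: flips_def)

lemma continuous_flips: "f \<in> flips \<Longrightarrow> continuous_on T f"
  by (auto simp: flips_def intro!: continuous_intros)

lemma norm_flips_le: "f \<in> flips \<Longrightarrow> norm w \<le> 1 \<Longrightarrow> norm (f w) \<le> 1"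
  by (cases w) (auto simp: flips_def norm_Pair)

lemma norm_le_abs: "norm x \<le> \<bar>fst x\<bar> + \<bar>snd x\<bar>" for x :: "real \<times> real"
  by (cases x) (simp add: norm_Pair sqrt_sum_squares_le_sum_abs)

lemma dist_le_abs: "dist x y \<le> \<bar>fst x - fst y\<bar> + \<bar>snd x - snd y\<bar>" for x :: "real \<times> real"
  using norm_le_abs[of "x - y"] by (simp add: dist_norm)

text \<open>
  Directional derivatives that are linear in the direction but not uniform in it. The condition on
  \<open>D1\<close> and \<open>D2\<close> is the symmetry \<open>\<partial>A/\<partial>t = \<partial>B/\<partial>s\<close> of the form \<open>A ds + B dt\<close>.
\<close>

locale closed_plane_form =
  fixes U :: "(real \<times> real) set" and g :: "real \<times> real \<Rightarrow> 'v::euclidean_space \<times> 'v"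
  assumes open_U: "open U" and continuous_g: "continuous_on U g"
    and derivative_g: "p \<in> U \<Longrightarrow> \<exists>D1 D2. fst D2 = snd D1 \<and>
      (\<forall>w. ((\<lambda>r. (g (p + r *\<^sub>R w) - g p) /\<^sub>R r) \<longlongrightarrow> fst w *\<^sub>R D1 + snd w *\<^sub>R D2) (at_right 0))"
begin

definition vanishing :: "(real \<times> real) set" where
  "vanishing = {p. \<exists>e>0. ball p e \<subseteq> U \<and>
     (\<forall>a b c d. a \<le> b \<longrightarrow> c \<le> d \<longrightarrow> cbox (a, c) (b, d) \<subseteq> ball p e \<longrightarrow> rect_integral g a b c d = 0)}"

lemma vanishing_subset: "vanishing \<subseteq> U"
  by (auto simp: vanishing_def dest: centre_in_ball[THEN iffD2] subsetD)

lemma open_vanishing: "open vanishing"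
  unfolding open_contains_ball
proof
  fix p assume "p \<in> vanishing"
  then obtain e where e: "e > 0" "ball p e \<subseteq> U"
    "\<And>a b c d. a \<le> b \<Longrightarrow> c \<le> d \<Longrightarrow> cbox (a, c) (b, d) \<subseteq> ball p e \<Longrightarrow> rect_integral g a b c d = 0"
    by (auto simp: vanishing_def)
  have "ball p (e/2) \<subseteq> vanishing"
  proof
    fix q assume q: "q \<in> ball p (e/2)"
    have "ball q (e/2) \<subseteq> ball p e"
    proof
      fix x assume "x \<in> ball q (e/2)"
      then show "x \<in> ball p e" using q dist_triangle[of p x q] by (simp add: dist_commute)
    qed
    then show "q \<in> vanishing" using e unfolding vanishing_def
      by (auto intro!: exI[of _ "e/2"] dest: subset_trans)
  qed
  then show "\<exists>e>0. ball p e \<subseteq> vanishing" using e(1) by (intro exI[of _ "e/2"]) auto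
qed

lemma continuous_g_rect: "cbox (a, c) (b, d) \<subseteq> U \<Longrightarrow> continuous_on (cbox (a, c) (b, d)) g"
  using continuous_g continuous_on_subset by blast

lemma small_cells: "e > 0 \<Longrightarrow> \<exists>l. x / 2 ^ l < e" for x e :: real
proof -
  assume e: "e > 0"
  obtain l where "(1/2 :: real) ^ l < e / (\<bar>x\<bar> + 1)"
    using real_arch_pow_inv[of "e / (\<bar>x\<bar> + 1)" "1/2"] e by auto
  then have "(\<bar>x\<bar> + 1) * (1/2) ^ l < e" by (simp add: field_simps)
  moreover have "x / 2 ^ l \<le> (\<bar>x\<bar> + 1) * (1/2) ^ l"
    by (simp add: power_one_over field_simps)
  ultimately show ?thesis by (meson order_le_less_trans)
qed

text \<open>
  By compactness there is a size below which every cell lies in one of the balls that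
  define \<open>vanishing\<close>; the cells then add up.
\<close>

lemma rect_integral_vanishing:
  assumes "a \<le> b" "c \<le> d" "cbox (a, c) (b, d) \<subseteq> vanishing"
  shows "rect_integral g a b c d = 0"
proof -
  define \<G> where "\<G> = {ball p e | p e. ball p e \<subseteq> U \<and>
     (\<forall>a b c d. a \<le> b \<longrightarrow> c \<le> d \<longrightarrow> cbox (a, c) (b, d) \<subseteq> ball p e \<longrightarrow> rect_integral g a b c d = 0)}"
  have "cbox (a, c) (b, d) \<subseteq> \<Union>\<G>"
  proof
    fix x assume "x \<in> cbox (a, c) (b, d)"
    then have "x \<in> vanishing" using assms by blast
    then obtain e where "e > 0" "ball x e \<in> \<G>" unfolding vanishing_def \<G>_def by blast
    then show "x \<in> \<Union>\<G>" by (meson UnionI centre_in_ball)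
  qed
  moreover have "open G" if "G \<in> \<G>" for G using that by (auto simp: \<G>_def)
  ultimately obtain e where e: "e > 0" "\<And>x. x \<in> cbox (a, c) (b, d) \<Longrightarrow> \<exists>G\<in>\<G>. ball x e \<subseteq> G"
    using Heine_Borel_lemma[OF compact_cbox] by metis
  obtain l where l: "((b - a) + (d - c)) / 2 ^ l < e" using small_cells[OF e(1)] by blast
  show ?thesis
    using assms(1,2)
  proof (induction a b c d rule: quadtree_induct[where l = l and Q = "cbox (a, c) (b, d)"])
    case (quarter a' b' c' d')
    have "cbox (a', c') (b', d') \<subseteq> U" using quarter(3) assms(3) vanishing_subset by blast
    from rect_integral_quarters[OF continuous_g_rect[OF this], of "(a'+b')/2" "(c'+d')/2"] quarter
    show ?case by simp
  next
    case (cell a' b' c' d')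
    have "(a', c') \<in> cbox (a, c) (b, d)" using cell by (auto simp: in_rect_iff subset_iff)
    then obtain G where G: "G \<in> \<G>" "ball (a', c') e \<subseteq> G" using e(2) by blast
    have "cbox (a', c') (b', d') \<subseteq> ball (a', c') e"
    proof
      fix x assume "x \<in> cbox (a', c') (b', d')"
      then have "dist (a', c') x \<le> (b' - a') + (d' - c')"
        using dist_le_abs[of "(a', c')" x] by (auto simp: in_rect_iff)
      also have "\<dots> < e" using l by (simp add: cell add_divide_distrib)
      finally show "x \<in> ball (a', c') e" by simp
    qed
    then show ?case using G cell unfolding \<G>_def by (auto dest: subset_trans)
  qed simp
qed

lemma compact_nonvanishing: "compact (cbox p q - vanishing)"
  by (rule compact_diff[OF compact_cbox open_vanishing])

text \<open>Cutting off strips that do not meet the exceptional set leaves a rectangle each of whose sides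
  contains an exceptional point.\<close>

lemma rect_integral_hull:
  assumes R: "cbox (a, c) (b, d) \<subseteq> U" and le: "a \<le> b" "c \<le> d"
    and ne: "cbox (a, c) (b, d) - vanishing \<noteq> {}"
  obtains p1 p2 p3 p4 where "{p1, p2, p3, p4} \<subseteq> cbox (a, c) (b, d) - vanishing"
    "{p1, p2, p3, p4} \<subseteq> cbox (fst p1, snd p3) (fst p2, snd p4)"
    "rect_integral g a b c d = rect_integral g (fst p1) (fst p2) (snd p3) (snd p4)"
proof -
  let ?X = "cbox (a, c) (b, d) - vanishing"
  obtain p1 where p1: "p1 \<in> ?X" "\<And>x. x \<in> ?X \<Longrightarrow> fst p1 \<le> fst x"
    using continuous_attains_inf[OF compact_nonvanishing ne continuous_on_fst[OF continuous_on_id]] by blast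
  obtain p2 where p2: "p2 \<in> ?X" "\<And>x. x \<in> ?X \<Longrightarrow> fst x \<le> fst p2"
    using continuous_attains_sup[OF compact_nonvanishing ne continuous_on_fst[OF continuous_on_id]] by blast
  obtain p3 where p3: "p3 \<in> ?X" "\<And>x. x \<in> ?X \<Longrightarrow> snd p3 \<le> snd x"
    using continuous_attains_inf[OF compact_nonvanishing ne continuous_on_snd[OF continuous_on_id]] by blast
  obtain p4 where p4: "p4 \<in> ?X" "\<And>x. x \<in> ?X \<Longrightarrow> snd x \<le> snd p4"
    using continuous_attains_sup[OF compact_nonvanishing ne continuous_on_snd[OF continuous_on_id]] by blast
  define a' b' c' d' where "a' = fst p1" "b' = fst p2" "c' = snd p3" "d' = snd p4"
  note defs = this
  have ord: "a \<le> a'" "a' \<le> b'" "b' \<le> b" "c \<le> c'" "c' \<le> d'" "d' \<le> d"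
    using p1 p2 p3 p4 by (auto simp: defs in_rect_iff)
  have strip: "rect_integral g s s' t t' = 0"
    if "cbox (s, t) (s', t') \<subseteq> cbox (a, c) (b, d)" "s \<le> s'" "t \<le> t'"
      "s' \<le> a' \<or> b' \<le> s \<or> t' \<le> c' \<or> d' \<le> t" for s s' t t'
  proof (rule rect_integral_zero_if_interior_zero[OF continuous_g_rect that(2,3)])
    show "cbox (s, t) (s', t') \<subseteq> U" using that R by blast
    fix s1 s2 t1 t2 assume *: "s < s1" "s1 \<le> s2" "s2 < s'" "t < t1" "t1 \<le> t2" "t2 < t'"
    show "rect_integral g s1 s2 t1 t2 = 0"
    proof (rule rect_integral_vanishing)
      show "cbox (s1, t1) (s2, t2) \<subseteq> vanishing"
      proof (rule ccontr)
        assume "\<not> ?thesis"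
        then obtain x where x: "x \<in> cbox (s1, t1) (s2, t2)" "x \<notin> vanishing" by blast
        have "x \<in> cbox (s, t) (s', t')" using x(1) * by (auto simp: in_rect_iff)
        then have X: "x \<in> ?X" using that(1) x(2) by blast
        show False using p1(2)[OF X] p2(2)[OF X] p3(2)[OF X] p4(2)[OF X] x(1) * that(4)
          by (auto simp: in_rect_iff defs)
      qed
    qed (use * in auto)
  qed
  have cont: "continuous_on (cbox (s, t) (s', t')) g" if "cbox (s, t) (s', t') \<subseteq> cbox (a, c) (b, d)" for s s' t t'
    using that R by (intro continuous_g_rect) auto
  have sub: "cbox (s, t) (s', t') \<subseteq> cbox (a, c) (b, d)" if "a \<le> s" "s' \<le> b" "c \<le> t" "t' \<le> d" for s s' t t'
    using that by (auto simp: in_rect_iff)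
  have "rect_integral g a b c d = rect_integral g a a' c d + rect_integral g a' b c d"
    using ord le by (intro rect_integral_split_horizontal cont sub) auto
  also have "rect_integral g a a' c d = 0" using ord le by (intro strip sub) auto
  also have "rect_integral g a' b c d = rect_integral g a' b' c d + rect_integral g b' b c d"
    using ord le by (intro rect_integral_split_horizontal cont sub) auto
  also have "rect_integral g b' b c d = 0" using ord le by (intro strip sub) auto
  also have "rect_integral g a' b' c d = rect_integral g a' b' c c' + rect_integral g a' b' c' d"
    using ord le by (intro rect_integral_split_vertical cont sub) auto
  also have "rect_integral g a' b' c c' = 0" using ord le by (intro strip sub) auto
  also have "rect_integral g a' b' c' d = rect_integral g a' b' c' d' + rect_integral g a' b' d' d"
    using ord le by (intro rect_integral_split_vertical cont sub) auto
  also have "rect_integral g a' b' d' d = 0" using ord le by (intro strip sub) auto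
  finally have "rect_integral g a b c d = rect_integral g a' b' c' d'" by simp
  then show thesis
    using p1 p2 p3 p4 by (intro that[of p1 p2 p3 p4]) (auto simp: defs in_rect_iff)
qed

text \<open>
  Each side of the hull contains an exceptional point, so the cross estimate bounds \<open>g\<close> along the side
  relative to that point, and two exceptional points are compared through a corner. Hence \<open>g\<close> oscillates on
  the boundary of the hull by at most a multiple of its diameter.
\<close>

lemma rect_integral_crude_bound:
  assumes R: "cbox (a, c) (b, d) \<subseteq> U" and le: "a \<le> b" "c \<le> d" and "n \<ge> 0"
    and cross: "\<And>p x. p \<in> cbox (a, c) (b, d) - vanishing \<Longrightarrow> x \<in> cbox (a, c) (b, d) \<Longrightarrow>
      fst x = fst p \<or> snd x = snd p \<Longrightarrow> norm (g x - g p) \<le> n * dist x p"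
  shows "norm (rect_integral g a b c d) \<le> 4 * n * ((b - a) + (d - c))\<^sup>2"
proof (cases "cbox (a, c) (b, d) - vanishing = {}")
  case True
  then have "rect_integral g a b c d = 0" by (intro rect_integral_vanishing le) auto
  then show ?thesis using \<open>n \<ge> 0\<close> by simp
next
  case False
  obtain p1 p2 p3 p4 where p: "{p1, p2, p3, p4} \<subseteq> cbox (a, c) (b, d) - vanishing"
    "{p1, p2, p3, p4} \<subseteq> cbox (fst p1, snd p3) (fst p2, snd p4)"
    "rect_integral g a b c d = rect_integral g (fst p1) (fst p2) (snd p3) (snd p4)"
    using rect_integral_hull[OF R le False] by metis
  let ?R = "cbox (a, c) (b, d)" and ?\<delta> = "(b - a) + (d - c)"
  have diam: "dist x y \<le> ?\<delta>" if "x \<in> ?R" "y \<in> ?R" for x y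
    using dist_le_abs[of x y] that by (auto simp: in_rect_iff)
  have sub: "cbox (fst p1, snd p3) (fst p2, snd p4) \<subseteq> ?R"
    using p(1) by (auto simp: in_rect_iff)
  have pair: "norm (g q - g p1) \<le> n * ?\<delta>" if q: "q \<in> ?R - vanishing" for q
  proof -
    let ?y = "(fst q, snd p1)"
    have y: "?y \<in> ?R" using p(1) q by (auto simp: in_rect_iff)
    have "norm (g ?y - g q) \<le> n * dist ?y q" by (rule cross[OF q y]) simp
    moreover have "norm (g ?y - g p1) \<le> n * dist ?y p1" by (rule cross[OF _ y]) (use p(1) in auto)
    moreover have "dist ?y q + dist ?y p1 \<le> ?\<delta>"
      using dist_le_abs[of ?y q] dist_le_abs[of ?y p1] p(1) q by (auto simp: in_rect_iff)
    then have "n * dist ?y q + n * dist ?y p1 \<le> n * ?\<delta>"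
      using \<open>n \<ge> 0\<close> by (metis distrib_left mult_left_mono)
    ultimately show ?thesis
      using norm_triangle_ineq4[of "g ?y - g p1" "g ?y - g q"] by (simp add: norm_minus_commute)
  qed
  have "norm (rect_integral g (fst p1) (fst p2) (snd p3) (snd p4)) \<le>
      2 * (2 * n * ?\<delta>) * ((fst p2 - fst p1) + (snd p4 - snd p3))"
  proof (rule rect_integral_bound[where ?g0.0 = "g p1"])
    show "continuous_on (cbox (fst p1, snd p3) (fst p2, snd p4)) g"
      using sub R by (intro continuous_g_rect) auto
    show "fst p1 \<le> fst p2" "snd p3 \<le> snd p4" using p(2) by (auto simp: in_rect_iff)
    fix x assume x: "x \<in> cbox (fst p1, snd p3) (fst p2, snd p4)"
      "fst x = fst p1 \<or> fst x = fst p2 \<or> snd x = snd p3 \<or> snd x = snd p4"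
    then have "\<exists>q\<in>{p1, p2, p3, p4}. fst x = fst q \<or> snd x = snd q" by blast
    then obtain q where q: "q \<in> {p1, p2, p3, p4}" "fst x = fst q \<or> snd x = snd q" by metis
    have qX: "q \<in> ?R - vanishing" and xR: "x \<in> ?R" using q(1) p(1) x(1) sub by auto
    have "norm (g x - g q) \<le> n * dist x q" by (rule cross[OF qX xR q(2)])
    also have "\<dots> \<le> n * ?\<delta>" using diam[of x q] xR qX \<open>n \<ge> 0\<close> by (intro mult_left_mono) auto
    finally show "norm (g x - g p1) \<le> 2 * n * ?\<delta>"
      using pair[OF qX] norm_triangle_ineq[of "g x - g q" "g q - g p1"] by simp
  qed
  also have "\<dots> \<le> 2 * (2 * n * ?\<delta>) * ?\<delta>"
    using p(1) \<open>n \<ge> 0\<close> le by (intro mult_left_mono) (auto simp: in_rect_iff)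
  finally show ?thesis using p(3) by (simp add: power2_eq_square algebra_simps)
qed

end

section \<open>A portion with uniform Lipschitz estimates\<close>

definition lipschitz_along ::
  "(real \<times> real) set \<Rightarrow> (real \<times> real \<Rightarrow> 'b::real_normed_vector) \<Rightarrow> real \<Rightarrow> (real \<times> real) set \<Rightarrow> real \<Rightarrow> real \<times> real \<Rightarrow> bool" where
  "lipschitz_along U g n B s p \<longleftrightarrow>
     cball p s \<subseteq> U \<and> (\<forall>w\<in>B. \<forall>r\<in>{0..s}. \<forall>f\<in>flips. norm (g (p + r *\<^sub>R f w) - g p) \<le> n * r)"

context closed_plane_form
begin

text \<open>
  The sets to which Baire's theorem is applied cover everything: a single \<open>n\<close> serves all eight
  directions, and it occurs both as Lipschitz constant and, through \<open>r0 / Suc n\<close>, as scale.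
\<close>

lemma eventually_lipschitz_along:
  assumes p: "p \<in> U" and "r0 > 0"
  shows "\<exists>n::nat. \<forall>f\<in>flips. \<forall>r\<in>{0..r0 / real (Suc n)}. norm (g (p + r *\<^sub>R f w) - g p) \<le> n * r"
proof -
  obtain D1 D2 where D: "\<And>v. ((\<lambda>r. (g (p + r *\<^sub>R v) - g p) /\<^sub>R r) \<longlongrightarrow> fst v *\<^sub>R D1 + snd v *\<^sub>R D2) (at_right 0)"
    using derivative_g[OF p] by blast
  have "\<forall>f\<in>flips. \<forall>\<^sub>F n in sequentially. \<forall>r\<in>{0..r0 / real (Suc n)}. norm (g (p + r *\<^sub>R f w) - g p) \<le> real n * r"
  proof
    fix f assume "f \<in> flips"
    define L where "L = fst (f w) *\<^sub>R D1 + snd (f w) *\<^sub>R D2"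
    have "\<forall>\<^sub>F r in at_right 0. dist ((g (p + r *\<^sub>R f w) - g p) /\<^sub>R r) L < 1"
      using tendstoD[OF D[of "f w"], of 1] by (simp add: L_def)
    then obtain \<delta> where \<delta>: "\<delta> > 0"
      "\<And>r. 0 < r \<Longrightarrow> r < \<delta> \<Longrightarrow> dist ((g (p + r *\<^sub>R f w) - g p) /\<^sub>R r) L < 1"
      unfolding eventually_at_right_field by auto
    have le: "norm (g (p + r *\<^sub>R f w) - g p) \<le> (norm L + 1) * r" if "0 \<le> r" "r < \<delta>" for r
    proof (cases "r = 0")
      case False
      then have "r > 0" using that by simp
      then have "norm ((g (p + r *\<^sub>R f w) - g p) /\<^sub>R r) \<le> norm L + 1"
        using \<delta>(2)[of r] that norm_triangle_ineq2[of "(g (p + r *\<^sub>R f w) - g p) /\<^sub>R r" L] by (simp add: dist_norm)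
      then have "norm (g (p + r *\<^sub>R f w) - g p) / r \<le> norm L + 1"
        using \<open>r > 0\<close> by (simp add: divide_inverse mult.commute)
      then show ?thesis using \<open>r > 0\<close> by (simp only: pos_divide_le_eq)
    qed simp
    have "\<forall>\<^sub>F n in sequentially. norm L + 1 \<le> real n"
      using eventually_ge_at_top[of "nat \<lceil>norm L + 1\<rceil>"] by eventually_elim linarith
    moreover have "\<forall>\<^sub>F n in sequentially. r0 / real (Suc n) < \<delta>"
      using LIMSEQ_Suc[OF lim_const_over_n[of r0]] \<delta>(1) by (intro order_tendstoD(2)) auto
    ultimately show "\<forall>\<^sub>F n in sequentially. \<forall>r\<in>{0..r0 / real (Suc n)}. norm (g (p + r *\<^sub>R f w) - g p) \<le> real n * r"
    proof eventually_elim
      case (elim n)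
      show ?case
      proof
        fix r assume r: "r \<in> {0..r0 / real (Suc n)}"
        then have "norm (g (p + r *\<^sub>R f w) - g p) \<le> (norm L + 1) * r" using elim by (intro le) auto
        also have "\<dots> \<le> real n * r" using elim r by (intro mult_right_mono) auto
        finally show "norm (g (p + r *\<^sub>R f w) - g p) \<le> real n * r" .
      qed
    qed
  qed
  then have "\<forall>\<^sub>F n in sequentially. \<forall>f\<in>flips. \<forall>r\<in>{0..r0 / real (Suc n)}. norm (g (p + r *\<^sub>R f w) - g p) \<le> real n * r"
    by (rule eventually_ball_finite[OF finite_flips])
  then show ?thesis by (auto dest: eventually_happens)
qed

text \<open>
  Baire's theorem is applied to pairs of a point and a direction. This yields at once a portion of the exceptional
  set and an open set of directions, a cone, in which the Lipschitz estimate is uniform.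
\<close>

lemma lipschitz_portion:
  assumes p0: "p0 \<in> U - vanishing"
  obtains p1 r1 w0 \<rho>0 n s where "p1 \<in> U - vanishing" "r1 > 0" "ball p1 r1 \<subseteq> U" "norm w0 < 1" "\<rho>0 > 0" "n \<ge> 0" "s > 0"
    "\<And>p. p \<in> ball p1 r1 - vanishing \<Longrightarrow> lipschitz_along U g n (ball w0 \<rho>0) s p"
proof -
  obtain R where R: "R > 0" "ball p0 R \<subseteq> U" using open_U p0 unfolding open_contains_ball by blast
  define r0 where "r0 = R / 4"
  have r0: "r0 > 0" "cball p0 (2 * r0) \<subseteq> U"
    using R by (auto simp: r0_def intro!: subset_trans[OF _ R(2)])
  \<comment> \<open>The closure of the part in an open ball, so that every open set meeting it meets the exceptional set.\<close>
  define K where "K = closure (ball p0 r0 - vanishing)"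
  have K: "K \<subseteq> cball p0 r0" unfolding K_def using closure_mono[of "ball p0 r0 - vanishing" "ball p0 r0"] r0 by auto
  define S where "S = K \<times> cball (0 :: real \<times> real) 1"
  define B where "B n = {z \<in> S. \<forall>r\<in>{0..r0 / real (Suc n)}. \<forall>f\<in>flips.
      norm (g (fst z + r *\<^sub>R f (snd z)) - g (fst z)) \<le> real n * r}" for n :: nat
  have Scl: "closed S" unfolding S_def K_def by (intro closed_Times) auto
  have inU: "p + r *\<^sub>R v \<in> U" if "p \<in> cball p0 r0" "norm v \<le> 1" "r \<in> {0..r0}" for p r v
  proof -
    have "dist p0 (p + r *\<^sub>R v) \<le> dist p0 p + dist p (p + r *\<^sub>R v)" by (rule dist_triangle)
    also have "dist p (p + r *\<^sub>R v) = \<bar>r\<bar> * norm v" by (simp add: dist_norm)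
    also have "\<dots> \<le> r0 * 1" using that by (intro mult_mono) auto
    finally show ?thesis using that r0(2) by auto
  qed
  have r0n: "r0 / real (Suc n) \<le> r0" for n using r0 by (simp add: field_simps)
  have Bcl: "closedin (top_of_set S) (B n)" for n
  proof -
    have cl: "closed {z \<in> S. norm (g (fst z + r *\<^sub>R f (snd z)) - g (fst z)) \<le> real n * r}"
      if r: "r \<in> {0..r0 / real (Suc n)}" and f: "f \<in> flips" for r f
    proof -
      have 1: "continuous_on S (\<lambda>z. fst z + r *\<^sub>R f (snd z))"
        by (intro continuous_intros continuous_on_compose2[OF continuous_flips[OF f, of UNIV] continuous_on_snd[OF continuous_on_id]]) auto
      have 2: "fst z + r *\<^sub>R f (snd z) \<in> U" if "z \<in> S" for z
        using that K r r0n[of n] norm_flips_le[OF f, of "snd z"] by (intro inU) (auto simp: S_def)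
      have 3: "fst z \<in> U" if "z \<in> S" for z
        using that K inU[of "fst z" 0 0] r0 by (auto simp: S_def)
      have 4: "continuous_on S (\<lambda>z. g (fst z + r *\<^sub>R f (snd z)))"
        by (rule continuous_on_compose2[OF continuous_g 1]) (rule image_subsetI, rule 2)
      have 5: "continuous_on S (\<lambda>z. g (fst z))"
        by (rule continuous_on_compose2[OF continuous_g continuous_on_fst[OF continuous_on_id]]) (rule image_subsetI, rule 3)
      from continuous_closed_preimage[OF continuous_on_norm[OF continuous_on_diff[OF 4 5]] Scl closed_atMost, of "real n * r"]
      show ?thesis unfolding vimage_def Int_def by simp
    qed
    have "closed (\<Inter>r\<in>{0..r0 / real (Suc n)}. \<Inter>f\<in>flips.
        {z \<in> S. norm (g (fst z + r *\<^sub>R f (snd z)) - g (fst z)) \<le> real n * r})"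
      by (rule closed_INT[OF ballI], rule closed_INT[OF ballI], rule cl)
    moreover have "B n = S \<inter> (\<Inter>r\<in>{0..r0 / real (Suc n)}. \<Inter>f\<in>flips.
        {z \<in> S. norm (g (fst z + r *\<^sub>R f (snd z)) - g (fst z)) \<le> real n * r})"
      by (auto simp: B_def)
    ultimately show ?thesis by (simp only: closedin_closed_Int)
  qed
  have cover: "\<Union>(range B) = S"
  proof
    show "S \<subseteq> \<Union>(range B)"
    proof
      fix z assume z: "z \<in> S"
      then have "fst z \<in> U" using K inU[of "fst z" 0 0] r0 by (auto simp: S_def)
      from eventually_lipschitz_along[OF this r0(1), of "snd z"] z show "z \<in> \<Union>(range B)"
        by (auto simp: B_def)
    qed
  qed (auto simp: B_def)
  have "p0 \<in> K" unfolding K_def using p0 r0(1) closure_subset by fastforce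
  then have "S \<noteq> {}" by (auto simp: S_def)
  have "\<exists>n. top_of_set S interior_of (B n) \<noteq> {}"
  proof (rule ccontr)
    assume "\<not> ?thesis"
    then have "top_of_set S interior_of (\<Union>(range B)) = {}"
      using Bcl Scl by (intro Baire_category_alt disjI1 completely_metrizable_space_closedin[OF completely_metrizable_space_euclidean]) auto
    then show False using \<open>S \<noteq> {}\<close> unfolding cover by (metis interior_of_topspace topspace_euclidean_subtopology)
  qed
  then obtain n z where "z \<in> top_of_set S interior_of (B n)" by blast
  then obtain T where T: "openin (top_of_set S) T" "z \<in> T" "T \<subseteq> B n" by (auto simp: interior_of_def)
  then obtain e where e: "e > 0" "ball z e \<inter> S \<subseteq> T"  and zS: "z \<in> S" by (metis openin_contains_ball subsetD)
  have e4: "e / 4 > 0" using e(1) by simp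
  have "fst z \<in> closure (ball p0 r0 - vanishing)" using zS by (auto simp: S_def K_def mem_Times_iff)
  then have "\<exists>y\<in>ball p0 r0 - vanishing. dist y (fst z) < e / 4"
    using e4 unfolding closure_approachable by blast
  then obtain p1 where p1: "p1 \<in> ball p0 r0 - vanishing" "dist p1 (fst z) < e / 4" by blast
  have "snd z \<in> closure (ball 0 1)" using zS by (auto simp: S_def mem_Times_iff)
  then have "\<exists>y\<in>ball 0 1. dist y (snd z) < e / 4"
    using e4 unfolding closure_approachable by blast
  then obtain w0 where w0: "w0 \<in> ball 0 1" "dist w0 (snd z) < e / 4" by blast
  define r1 where "r1 = min (r0 - dist p0 p1) (e / 4)"
  define \<rho>0 where "\<rho>0 = min (1 - norm w0) (e / 4)"
  show thesis
  proof (rule that[of p1 r1 w0 \<rho>0 "real n" "r0 / real (Suc n)"])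
    show "r1 > 0" "\<rho>0 > 0" "norm w0 < 1" using p1 w0 e by (auto simp: r1_def \<rho>0_def)
    have b1: "ball p1 r1 \<subseteq> ball p0 r0"
    proof
      fix x assume "x \<in> ball p1 r1"
      then show "x \<in> ball p0 r0" using dist_triangle[of p0 x p1] by (auto simp: r1_def)
    qed
    then show "ball p1 r1 \<subseteq> U" using r0 by fastforce
    then show "p1 \<in> U - vanishing" using p1 \<open>r1 > 0\<close> by auto
    fix p assume p: "p \<in> ball p1 r1 - vanishing"
    have "p \<in> ball p0 r0 - vanishing" using p b1 by auto
    then have pK: "p \<in> K" unfolding K_def by (rule subsetD[OF closure_subset])
    show "lipschitz_along U g (real n) (ball w0 \<rho>0) (r0 / real (Suc n)) p"
      unfolding lipschitz_along_def
    proof (intro conjI ballI)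
      show "cball p (r0 / real (Suc n)) \<subseteq> U"
      proof
        fix x assume "x \<in> cball p (r0 / real (Suc n))"
        then have "dist p x \<le> r0" using r0n[of n] by auto
        then have "dist p0 x \<le> 2 * r0" using pK K dist_triangle[of p0 x p] by auto
        then show "x \<in> U" using r0 by auto
      qed
      fix w r f assume *: "w \<in> ball w0 \<rho>0" "r \<in> {0..r0 / real (Suc n)}" "f \<in> flips"
      have "norm w < 1" using *(1) norm_triangle_ineq2[of w w0] by (auto simp: \<rho>0_def dist_norm norm_minus_commute)
      then have "(p, w) \<in> S" using pK by (auto simp: S_def)
      moreover have "dist (p, w) z < e"
      proof -
        have "dist (p, w) z \<le> dist p (fst z) + dist w (snd z)"
          by (metis dist_Pair_Pair prod.collapse sqrt_sum_squares_le_sum zero_le_dist)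
        moreover have "dist p (fst z) < e / 2" using p p1 dist_triangle[of p "fst z" p1] by (auto simp: r1_def dist_commute)
        moreover have "dist w (snd z) < e / 2" using * w0 dist_triangle[of w "snd z" w0] by (auto simp: \<rho>0_def dist_commute)
        ultimately show ?thesis by simp
      qed
      ultimately have "(p, w) \<in> B n" using e T by (auto simp: dist_commute)
      then show "norm (g (p + r *\<^sub>R f w) - g p) \<le> real n * r" using * by (auto simp: B_def)
    qed
  qed (use r0 in auto)
qed

end

section \<open>Rectangles on which the form is nearly affine\<close>

lemma measure_rect_box: "s \<le> s' \<Longrightarrow> t \<le> t' \<Longrightarrow> measure lborel (box (s, t) (s', t' :: real)) = (s' - s) * (t' - t)" for s :: real
  by (subst measure_lborel_box_eq) (auto simp: Basis_prod_def)

lemma in_box_iff: "x \<in> box (a, c) (b, d) \<longleftrightarrow> a < fst x \<and> fst x < b \<and> c < snd x \<and> snd x < (d::real)" for a b :: real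
  by (cases x) (auto simp: mem_box Basis_prod_def)

text \<open>Open boxes make the four quarters disjoint.\<close>

lemma measure_box_quarters:
  fixes a b c d m l :: real
  assumes "a \<le> m" "m \<le> b" "c \<le> l" "l \<le> d" and W: "W \<in> sets borel"
  shows "measure lborel (box (a, c) (m, l) \<inter> W) + measure lborel (box (a, l) (m, d) \<inter> W) +
    measure lborel (box (m, c) (b, l) \<inter> W) + measure lborel (box (m, l) (b, d) \<inter> W)
    \<le> measure lborel (box (a, c) (b, d) \<inter> W)"
proof -
  let ?B = "\<lambda>a b c d. box (a, c) (b, d :: real) \<inter> W"
  have fm: "?B a b c d \<in> fmeasurable lborel" for a b c d
    using W by (intro fmeasurable_Int_fmeasurable) (auto intro: fmeasurableI simp: emeasure_lborel_box_finite)
  have u: "measure lborel (A \<union> B) = measure lborel A + measure lborel B"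
    if "A \<in> fmeasurable lborel" "B \<in> fmeasurable lborel" "A \<inter> B = {}" for A B :: "(real \<times> real) set"
    using that by (intro measure_Un_AE[OF _ that(1,2)]) auto
  have eq: "measure lborel (?B a m c l \<union> ?B a m l d \<union> ?B m b c l \<union> ?B m b l d) =
    measure lborel (?B a m c l) + measure lborel (?B a m l d) + measure lborel (?B m b c l) + measure lborel (?B m b l d)"
    by (subst u; (intro fmeasurable.Un fm)?; (auto simp: in_box_iff)?)+
  have "measure lborel (?B a m c l \<union> ?B a m l d \<union> ?B m b c l \<union> ?B m b l d) \<le> measure lborel (?B a b c d)"
    using assms fm by (intro measure_mono_fmeasurable) (auto simp: in_box_iff)
  with eq show ?thesis by linarith
qed

lemma finite_net_unit_sphere:
  assumes "\<kappa> > 0"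
  obtains \<Theta> :: "(real \<times> real) set" where "finite \<Theta>" "\<Theta> \<subseteq> sphere 0 1"
    "\<And>v. norm v = 1 \<Longrightarrow> \<exists>\<theta>\<in>\<Theta>. dist \<theta> v < \<kappa>"
proof -
  obtain \<Theta> where "\<Theta> \<subseteq> sphere (0 :: real \<times> real) 1" "finite \<Theta>" "sphere (0 :: real \<times> real) 1 \<subseteq> (\<Union>c\<in>\<Theta>. ball c \<kappa>)"
    by (rule compactE_image[OF compact_sphere, of "sphere 0 1" "\<lambda>c. ball c \<kappa>" 0 1]) (use assms in auto)
  then show thesis by (intro that[of \<Theta>]) (auto simp: subset_iff)
qed

text \<open>
  The choice of sign replaces a case distinction according to the half of the interval that contains
  the point; it keeps the points through which two values are compared inside the cell.
\<close>

lemma step_inside: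
  fixes a b q y :: real
  assumes "a \<le> q" "q \<le> b" "\<bar>y\<bar> \<le> (b - a) / 2"
  obtains \<sigma> where "\<sigma> \<in> {-1, 1}" "a \<le> q - \<sigma> * y" "q - \<sigma> * y \<le> b"
proof (cases "a \<le> q - y \<and> q - y \<le> b")
  case True
  then show thesis by (intro that[of 1]) auto
next
  case False
  then show thesis using assms by (intro that[of "-1"]) (auto simp: abs_if field_simps split: if_splits)
qed

lemma subinterval_near:
  fixes a b c e :: real
  assumes "a \<le> c" "c \<le> b" "0 \<le> e" "e \<le> b - a"
  obtains s where "a \<le> s" "s + e \<le> b" "\<And>x. s \<le> x \<Longrightarrow> x \<le> s + e \<Longrightarrow> \<bar>x - c\<bar> \<le> e"
proof (cases "a \<le> c - e")
  case True
  show thesis by (rule that[of "c - e"]) (use assms True in auto)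
next
  case False
  show thesis by (rule that[of a]) (use assms False in auto)
qed

lemma lipschitz_alongD:
  "lipschitz_along U g n B s p \<Longrightarrow> w \<in> B \<Longrightarrow> 0 \<le> r \<Longrightarrow> r \<le> s \<Longrightarrow> f \<in> flips \<Longrightarrow>
    norm (g (p + r *\<^sub>R f w) - g p) \<le> n * r"
  by (auto simp: lipschitz_along_def)

context closed_plane_form
begin

text \<open>
  The bound on the candidate derivative makes these sets compact. Finitely many directions
  are enough, because the cones allow to pass to nearby points.
\<close>

definition approx_set :: "(real \<times> real) set \<Rightarrow> (real \<times> real) set \<Rightarrow> real \<Rightarrow> real \<Rightarrow> real \<Rightarrow> (real \<times> real) set" where
  "approx_set X \<Theta> n \<kappa> t = {p \<in> X. \<exists>D1 D2. norm D1 \<le> n \<and> norm D2 \<le> n \<and> fst D2 = snd D1 \<and>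
     (\<forall>r\<in>{0..t}. \<forall>\<theta>\<in>\<Theta>. norm (g (p + r *\<^sub>R \<theta>) - g p - r *\<^sub>R (fst \<theta> *\<^sub>R D1 + snd \<theta> *\<^sub>R D2)) \<le> \<kappa> * r)}"

text \<open>
  The set is the projection of a compact set of triples of a point and two partial derivatives.
\<close>

lemma compact_approx_set:
  assumes X: "compact X" and \<Theta>: "\<Theta> \<subseteq> sphere 0 1" and U: "\<And>p. p \<in> X \<Longrightarrow> cball p t \<subseteq> U" and "t \<ge> 0"
  shows "compact (approx_set X \<Theta> n \<kappa> t)"
proof -
  let ?Y = "X \<times> (cball (0 :: 'v \<times> 'v) n \<times> cball (0 :: 'v \<times> 'v) n)"
  let ?e = "\<lambda>r \<theta> z. norm (g (fst z + r *\<^sub>R \<theta>) - g (fst z) - r *\<^sub>R (fst \<theta> *\<^sub>R fst (snd z) + snd \<theta> *\<^sub>R snd (snd z)))"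
  have Y: "compact ?Y" using X by (intro compact_Times) auto
  have cl: "closed ({z \<in> ?Y. ?e r \<theta> z \<le> \<kappa> * r})" if r: "r \<in> {0..t}" and \<theta>: "\<theta> \<in> \<Theta>" for r \<theta>
  proof -
    have "fst z + r *\<^sub>R \<theta> \<in> U" "fst z \<in> U" if "z \<in> ?Y" for z
    proof -
      have z: "cball (fst z) t \<subseteq> U" using that U[of "fst z"] by (simp add: mem_Times_iff)
      have "dist (fst z) (fst z + r *\<^sub>R \<theta>) = r" using r \<theta> \<Theta> by (auto simp: dist_norm)
      then show "fst z + r *\<^sub>R \<theta> \<in> U" using r by (intro subsetD[OF z]) (simp only: mem_cball atLeastAtMost_iff)
      show "fst z \<in> U" using \<open>t \<ge> 0\<close> by (intro subsetD[OF z]) simp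
    qed
    note sub0 = this
    have sub: "(\<lambda>z. fst z + r *\<^sub>R \<theta>) ` ?Y \<subseteq> U" "fst ` ?Y \<subseteq> U"
      by (rule image_subsetI, erule sub0)+
    have 1: "continuous_on ?Y (\<lambda>z. fst z + r *\<^sub>R \<theta>)" by (intro continuous_intros)
    note c = continuous_on_compose2[OF continuous_g 1 sub(1)]
      continuous_on_compose2[OF continuous_g continuous_on_fst[OF continuous_on_id] sub(2)]
    have "continuous_on ?Y (?e r \<theta>)"
      by (rule continuous_on_norm, rule continuous_on_diff[OF continuous_on_diff[OF c]]) (intro continuous_intros)
    from continuous_closed_preimage[OF this compact_imp_closed[OF Y], of "{..\<kappa> * r}"]
    show ?thesis by (simp add: vimage_def Int_def)
  qed
  define Z where "Z = ?Y \<inter> {z. fst (snd (snd z)) = snd (fst (snd z))} \<inter>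
      (\<Inter>r\<in>{0..t}. \<Inter>\<theta>\<in>\<Theta>. {z \<in> ?Y. ?e r \<theta> z \<le> \<kappa> * r})"
  have "closed {z :: (real \<times> real) \<times> ('v \<times> 'v) \<times> ('v \<times> 'v). fst (snd (snd z)) = snd (fst (snd z))}"
    by (intro closed_Collect_eq continuous_intros)
  then have "compact Z" unfolding Z_def
    using cl by (intro compact_Int_closed[OF compact_Int_closed[OF Y]] closed_INT ballI) auto
  moreover have "approx_set X \<Theta> n \<kappa> t = fst ` Z"
  proof
    show "approx_set X \<Theta> n \<kappa> t \<subseteq> fst ` Z"
    proof
      fix p assume "p \<in> approx_set X \<Theta> n \<kappa> t"
      then obtain D1 D2 where "p \<in> X" "norm D1 \<le> n" "norm D2 \<le> n" "fst D2 = snd D1"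
        "\<forall>r\<in>{0..t}. \<forall>\<theta>\<in>\<Theta>. norm (g (p + r *\<^sub>R \<theta>) - g p - r *\<^sub>R (fst \<theta> *\<^sub>R D1 + snd \<theta> *\<^sub>R D2)) \<le> \<kappa> * r"
        by (auto simp: approx_set_def)
      then have "(p, D1, D2) \<in> Z" by (simp add: Z_def)
      then show "p \<in> fst ` Z" by force
    qed
    show "fst ` Z \<subseteq> approx_set X \<Theta> n \<kappa> t"
      unfolding Z_def approx_set_def by fastforce
  qed
  ultimately show ?thesis
    by (simp only: compact_continuous_image[OF continuous_on_fst[OF continuous_on_id]])
qed

lemma approx_set_mono: "t \<le> t' \<Longrightarrow> approx_set X \<Theta> n \<kappa> t' \<subseteq> approx_set X \<Theta> n \<kappa> t"
  unfolding approx_set_def by fastforce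

text \<open>
  The Lipschitz estimate along the axes bounds the partial derivatives by \<open>n\<close>.
\<close>

lemma approx_set_exhausts:
  assumes p: "p \<in> X" "p \<in> U" and \<Theta>: "finite \<Theta>" "\<Theta> \<subseteq> sphere 0 1" and "\<kappa> > 0"
    and lip: "lipschitz_along U g n B s p" "B \<noteq> {}" "s > 0"
  shows "\<exists>t>0. p \<in> approx_set X \<Theta> n \<kappa> t"
proof -
  obtain D1 D2 where sym: "fst D2 = snd D1"
    and D: "\<And>v. ((\<lambda>r. (g (p + r *\<^sub>R v) - g p) /\<^sub>R r) \<longlongrightarrow> fst v *\<^sub>R D1 + snd v *\<^sub>R D2) (at_right 0)"
    using derivative_g[OF p(2)] by blast
  have axis: "norm (fst v *\<^sub>R D1 + snd v *\<^sub>R D2) \<le> n" if v: "(\<lambda>w. v) \<in> flips" for v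
  proof (rule tendsto_upperbound[OF tendsto_norm[OF D[of v]]])
    obtain w where w: "w \<in> B" using lip(2) by blast
    have "norm ((g (p + r *\<^sub>R v) - g p) /\<^sub>R r) \<le> n" if "0 < r" "r < s" for r
    proof -
      have "norm (g (p + r *\<^sub>R v) - g p) \<le> n * r"
        using lipschitz_alongD[OF lip(1) w _ _ v, of r] that by simp
      then have "norm (g (p + r *\<^sub>R v) - g p) / r \<le> n" using that by (simp only: pos_divide_le_eq)
      then show ?thesis using that by (simp add: divide_inverse mult.commute)
    qed
    then show "\<forall>\<^sub>F r in at_right 0. norm ((g (p + r *\<^sub>R v) - g p) /\<^sub>R r) \<le> n"
      unfolding eventually_at_right_field using lip(3) by auto
  qed simp
  have "norm D1 \<le> n" "norm D2 \<le> n"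
    using axis[of "(1, 0)"] axis[of "(0, 1)"] by (simp_all add: flips_def)
  moreover have "\<forall>\<theta>\<in>\<Theta>. \<forall>\<^sub>F t in at_right 0. \<forall>r\<in>{0..t}.
      norm (g (p + r *\<^sub>R \<theta>) - g p - r *\<^sub>R (fst \<theta> *\<^sub>R D1 + snd \<theta> *\<^sub>R D2)) \<le> \<kappa> * r"
  proof
    fix \<theta> assume "\<theta> \<in> \<Theta>"
    let ?L = "fst \<theta> *\<^sub>R D1 + snd \<theta> *\<^sub>R D2"
    obtain \<delta> where \<delta>: "\<delta> > 0" "\<And>r. 0 < r \<Longrightarrow> r < \<delta> \<Longrightarrow> dist ((g (p + r *\<^sub>R \<theta>) - g p) /\<^sub>R r) ?L < \<kappa>"
      using tendstoD[OF D[of \<theta>] \<open>\<kappa> > 0\<close>] unfolding eventually_at_right_field by auto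
    have le: "norm (g (p + r *\<^sub>R \<theta>) - g p - r *\<^sub>R ?L) \<le> \<kappa> * r" if "0 \<le> r" "r < \<delta>" for r
    proof (cases "r = 0")
      case False
      then have r: "r > 0" using that by simp
      have "g (p + r *\<^sub>R \<theta>) - g p - r *\<^sub>R ?L = r *\<^sub>R ((g (p + r *\<^sub>R \<theta>) - g p) /\<^sub>R r - ?L)"
        using r by (simp add: scaleR_diff_right)
      then have "norm (g (p + r *\<^sub>R \<theta>) - g p - r *\<^sub>R ?L) = r * dist ((g (p + r *\<^sub>R \<theta>) - g p) /\<^sub>R r) ?L"
        using r by (simp only: norm_scaleR dist_norm abs_of_pos)
      also have "\<dots> \<le> r * \<kappa>" using \<delta>(2)[of r] r that by (intro mult_left_mono) auto
      finally show ?thesis by (simp add: mult.commute)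
    qed simp
    show "\<forall>\<^sub>F t in at_right 0. \<forall>r\<in>{0..t}. norm (g (p + r *\<^sub>R \<theta>) - g p - r *\<^sub>R ?L) \<le> \<kappa> * r"
      unfolding eventually_at_right_field using \<delta>(1) le by (intro exI[of _ \<delta>]) auto
  qed
  then have "\<forall>\<^sub>F t in at_right 0. \<forall>\<theta>\<in>\<Theta>. \<forall>r\<in>{0..t}.
      norm (g (p + r *\<^sub>R \<theta>) - g p - r *\<^sub>R (fst \<theta> *\<^sub>R D1 + snd \<theta> *\<^sub>R D2)) \<le> \<kappa> * r"
    by (rule eventually_ball_finite[OF \<Theta>(1)])
  then obtain \<delta> where "\<delta> > 0" "\<And>t. 0 < t \<Longrightarrow> t < \<delta> \<Longrightarrow> \<forall>\<theta>\<in>\<Theta>. \<forall>r\<in>{0..t}.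
      norm (g (p + r *\<^sub>R \<theta>) - g p - r *\<^sub>R (fst \<theta> *\<^sub>R D1 + snd \<theta> *\<^sub>R D2)) \<le> \<kappa> * r"
    unfolding eventually_at_right_field by auto
  then have "\<forall>r\<in>{0..\<delta>/2}. \<forall>\<theta>\<in>\<Theta>.
      norm (g (p + r *\<^sub>R \<theta>) - g p - r *\<^sub>R (fst \<theta> *\<^sub>R D1 + snd \<theta> *\<^sub>R D2)) \<le> \<kappa> * r"
    by (metis half_gt_zero field_sum_of_halves less_add_same_cancel1)
  ultimately have "p \<in> approx_set X \<Theta> n \<kappa> (\<delta>/2)"
    using p(1) sym unfolding approx_set_def by blast
  then show ?thesis using half_gt_zero[OF \<open>\<delta> > 0\<close>] by blast
qed

text \<open>
  Two nearby points are compared through a point of \<open>E\<close> in whose cone both lie. This extends the affine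
  approximation at one point of \<open>E\<close> from the finitely many rays to the whole cell. The constant \<open>3 / \<rho>0\<close> makes
  the distance \<open>S\<close> to the linking point so large that displacements of total size \<open>2 \<kappa> \<delta>\<close> change the direction by less
  than \<open>\<rho>0\<close>.
\<close>

lemma rect_integral_good_cell:
  assumes R: "cbox (a, c) (b, d) \<subseteq> U" and lt: "a < b" "c < d"
    and E: "E \<subseteq> approx_set X \<Theta> n \<kappa> t" and net: "\<And>v. norm v = 1 \<Longrightarrow> \<exists>\<theta>\<in>\<Theta>. dist \<theta> v < \<kappa>"
    and \<Theta>: "\<Theta> \<subseteq> sphere 0 1"
    and lip: "\<And>p. p \<in> E \<Longrightarrow> lipschitz_along U g n (ball w0 \<rho>0) s p" and "norm w0 < 1" "\<rho>0 > 0" "n \<ge> 0"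
    and \<kappa>: "0 < \<kappa>" "\<kappa> \<le> 1"
    and dense: "\<And>s t. a \<le> s \<Longrightarrow> s + \<kappa> * (b - a) \<le> b \<Longrightarrow> c \<le> t \<Longrightarrow> t + \<kappa> * (d - c) \<le> d \<Longrightarrow>
      E \<inter> cbox (s, t) (s + \<kappa> * (b - a), t + \<kappa> * (d - c)) \<noteq> {}"
    and \<delta>: "\<delta> = (b - a) + (d - c)" "\<delta> \<le> t" "3 / \<rho>0 * \<kappa> * \<delta> \<le> s"
    and ratio: "3 / \<rho>0 * \<kappa> * \<delta> \<le> (b - a) / 2" "3 / \<rho>0 * \<kappa> * \<delta> \<le> (d - c) / 2"
  shows "norm (rect_integral g a b c d) \<le> 2 * (6 * n / \<rho>0 + 1 + 2 * n) * \<kappa> * \<delta>\<^sup>2"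
proof -
  let ?R = "cbox (a, c) (b, d)"
  define S where "S = 3 / \<rho>0 * \<kappa> * \<delta>"
  have \<delta>0: "\<delta> > 0" using lt \<delta> by simp
  have S: "S > 0" "S \<le> s" "S \<le> (b - a) / 2" "S \<le> (d - c) / 2" "\<kappa> * \<delta> = \<rho>0 / 3 * S"
    using \<delta> ratio \<kappa> \<open>\<rho>0 > 0\<close> \<delta>0 by (auto simp: S_def)
  have w0c: "\<bar>fst w0\<bar> \<le> 1" "\<bar>snd w0\<bar> \<le> 1"
    using norm_fst_le[of "fst w0" "snd w0"] norm_snd_le[of "snd w0" "fst w0"] \<open>norm w0 < 1\<close> by auto
  have ke: "\<kappa> * (b - a) \<le> b - a" "\<kappa> * (d - c) \<le> d - c" "0 \<le> \<kappa> * (b - a)" "0 \<le> \<kappa> * (d - c)"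
    using \<kappa> lt by (auto intro: mult_left_le_one_le)
  obtain p where p: "p \<in> E" "p \<in> ?R"
  proof -
    have "E \<inter> cbox (a, c) (a + \<kappa> * (b - a), c + \<kappa> * (d - c)) \<noteq> {}"
      using ke by (intro dense) auto
    then obtain x where x: "x \<in> E" "x \<in> cbox (a, c) (a + \<kappa> * (b - a), c + \<kappa> * (d - c))" by blast
    then have "x \<in> ?R" unfolding in_rect_iff using ke by linarith
    then show thesis using x(1) that by blast
  qed
  obtain D1 D2 where D: "norm D1 \<le> n" "norm D2 \<le> n" "fst D2 = snd D1"
    "\<And>r \<theta>. r \<in> {0..t} \<Longrightarrow> \<theta> \<in> \<Theta> \<Longrightarrow> norm (g (p + r *\<^sub>R \<theta>) - g p - r *\<^sub>R (fst \<theta> *\<^sub>R D1 + snd \<theta> *\<^sub>R D2)) \<le> \<kappa> * r"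
    using p(1) E unfolding approx_set_def by blast
  have near: "norm (g q1 - g q) \<le> 2 * n * S" if q: "q \<in> ?R" and q1: "dist q q1 \<le> \<kappa> * \<delta>" for q q1
  proof -
    have y: "\<bar>S * fst w0\<bar> \<le> (b - a) / 2" "\<bar>S * snd w0\<bar> \<le> (d - c) / 2"
    proof -
      have "S * \<bar>fst w0\<bar> \<le> S * 1" "S * \<bar>snd w0\<bar> \<le> S * 1" using S(1) w0c by (intro mult_left_mono; simp)+
      moreover have "\<bar>S * fst w0\<bar> = S * \<bar>fst w0\<bar>" "\<bar>S * snd w0\<bar> = S * \<bar>snd w0\<bar>" using S(1) by (simp_all add: abs_mult)
      ultimately show "\<bar>S * fst w0\<bar> \<le> (b - a) / 2" "\<bar>S * snd w0\<bar> \<le> (d - c) / 2" using S(3,4) by linarith+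
    qed
    have qR: "a \<le> fst q" "fst q \<le> b" "c \<le> snd q" "snd q \<le> d" using q by (auto simp: in_rect_iff)
    obtain \<sigma> where \<sigma>: "\<sigma> \<in> {-1, 1}" "a \<le> fst q - \<sigma> * (S * fst w0)" "fst q - \<sigma> * (S * fst w0) \<le> b"
      by (rule step_inside[OF qR(1,2) y(1)]) blast
    obtain \<tau> where \<tau>: "\<tau> \<in> {-1, 1}" "c \<le> snd q - \<tau> * (S * snd w0)" "snd q - \<tau> * (S * snd w0) \<le> d"
      by (rule step_inside[OF qR(3,4) y(2)]) blast
    define f where "f w = (\<sigma> * fst w, \<tau> * snd w)" for w :: "real \<times> real"
    have f: "f \<in> flips" "linear f" "\<And>w. f (f w) = w" "\<And>w. norm (f w) = norm w"
    proof -
      show "f \<in> flips" using \<sigma>(1) \<tau>(1) unfolding flips_def f_def by force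
      show "linear f" by (rule linearI) (auto simp: f_def algebra_simps)
      show "f (f w) = w" "norm (f w) = norm w" for w
        using \<sigma>(1) \<tau>(1) by (auto simp: f_def norm_Pair prod_eq_iff norm_prod_def)
    qed
    \<comment> \<open>The ideal linking point; the density of \<open>E\<close> supplies an actual one nearby.\<close>
    define c0 where "c0 = q - S *\<^sub>R f w0"
    have c0: "a \<le> fst c0" "fst c0 \<le> b" "c \<le> snd c0" "snd c0 \<le> d"
      using \<sigma> \<tau> by (auto simp: c0_def f_def algebra_simps)
    obtain s' where s': "a \<le> s'" "s' + \<kappa> * (b - a) \<le> b" "\<And>x. s' \<le> x \<Longrightarrow> x \<le> s' + \<kappa> * (b - a) \<Longrightarrow> \<bar>x - fst c0\<bar> \<le> \<kappa> * (b - a)"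
      by (rule subinterval_near[OF c0(1,2) ke(3,1)]) blast
    obtain t' where t': "c \<le> t'" "t' + \<kappa> * (d - c) \<le> d" "\<And>x. t' \<le> x \<Longrightarrow> x \<le> t' + \<kappa> * (d - c) \<Longrightarrow> \<bar>x - snd c0\<bar> \<le> \<kappa> * (d - c)"
      by (rule subinterval_near[OF c0(3,4) ke(4,2)]) blast
    obtain p' where p': "p' \<in> E" "p' \<in> cbox (s', t') (s' + \<kappa> * (b - a), t' + \<kappa> * (d - c))"
      using dense[OF s'(1,2) t'(1,2)] by blast
    have "dist p' c0 \<le> \<kappa> * (b - a) + \<kappa> * (d - c)"
      using dist_le_abs[of p' c0] s'(3)[of "fst p'"] t'(3)[of "snd p'"] p'(2) by (auto simp: in_rect_iff)
    then have pc: "dist p' c0 \<le> \<kappa> * \<delta>" by (simp add: \<delta> algebra_simps)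
    have cone: "norm (g x - g p') \<le> n * S" if x: "dist q x \<le> \<kappa> * \<delta>" for x
    proof -
      define w where "w = f ((x - p') /\<^sub>R S)"
      have x_eq: "x = p' + S *\<^sub>R f w" using S(1) by (simp add: w_def f(3))
      have "w - w0 = f ((x - p') /\<^sub>R S - f w0)"
        unfolding w_def by (simp add: linear_diff[OF f(2)] f(3))
      also have "(x - p') /\<^sub>R S - f w0 = ((x - q) + (c0 - p')) /\<^sub>R S"
        using S(1) by (simp add: c0_def scaleR_add_right scaleR_diff_right)
      finally have "norm (w - w0) = norm ((x - q) + (c0 - p')) / S"
        using S(1) by (simp add: f(4) divide_inverse mult.commute)
      also have "\<dots> \<le> (\<kappa> * \<delta> + \<kappa> * \<delta>) / S"
        using x pc S(1) by (intro divide_right_mono order_trans[OF norm_triangle_ineq] add_mono) (auto simp: dist_norm norm_minus_commute)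
      also have "\<dots> = 2 / 3 * \<rho>0" unfolding S(5) using S(1) by (simp add: field_simps)
      also have "\<dots> < \<rho>0" using \<open>\<rho>0 > 0\<close> by simp
      finally have "w \<in> ball w0 \<rho>0" by (simp add: dist_norm norm_minus_commute)
      then have "norm (g (p' + S *\<^sub>R f w) - g p') \<le> n * S"
        using S(1,2) f(1) by (intro lipschitz_alongD[OF lip[OF p'(1)]]) auto
      then show ?thesis using x_eq by simp
    qed
    have "norm (g q1 - g p') \<le> n * S" by (rule cone[OF q1])
    moreover have "norm (g q - g p') \<le> n * S" using \<kappa> \<delta>0 by (intro cone) auto
    ultimately show ?thesis
      using norm_triangle_ineq4[of "g q1 - g p'" "g q - g p'"] by simp
  qed
  have lin: "norm (g q - affine_map (g p) D1 D2 p q) \<le> (6 * n / \<rho>0 + 1 + 2 * n) * \<kappa> * \<delta>" if q: "q \<in> ?R" for q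
  proof (cases "q = p")
    case True
    then show ?thesis using \<open>n \<ge> 0\<close> \<kappa> \<delta>0 \<open>\<rho>0 > 0\<close> by (simp add: affine_map_def)
  next
    case False
    define v where "v = q - p"
    have v: "norm v > 0" "norm v \<le> \<delta>"
      using False dist_le_abs[of q p] p(2) q \<delta> by (auto simp: v_def in_rect_iff dist_norm)
    then obtain \<theta> where \<theta>: "\<theta> \<in> \<Theta>" "dist \<theta> (v /\<^sub>R norm v) < \<kappa>"
      using net[of "v /\<^sub>R norm v"] by auto
    \<comment> \<open>The point at the distance of q on a ray of the net.\<close>
    define q1 where "q1 = p + norm v *\<^sub>R \<theta>"
    have qq1: "q1 - q = norm v *\<^sub>R (\<theta> - v /\<^sub>R norm v)"
      using v by (simp add: q1_def v_def scaleR_diff_right)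
    have d: "norm (q1 - q) \<le> \<kappa> * \<delta>"
    proof -
      have "norm (q1 - q) = norm v * dist \<theta> (v /\<^sub>R norm v)" unfolding qq1 by (simp add: dist_norm)
      also have "\<dots> \<le> \<delta> * \<kappa>" using v \<theta> \<delta>0 by (intro mult_mono) auto
      finally show ?thesis by (simp add: mult.commute)
    qed
    have 1: "norm (g q1 - g q) \<le> 2 * n * S"
      using d by (intro near q) (simp add: dist_norm norm_minus_commute)
    have "norm (g q1 - g p - norm v *\<^sub>R (fst \<theta> *\<^sub>R D1 + snd \<theta> *\<^sub>R D2)) \<le> \<kappa> * norm v"
      unfolding q1_def using v \<delta> \<theta> by (intro D) auto
    also have "norm v *\<^sub>R (fst \<theta> *\<^sub>R D1 + snd \<theta> *\<^sub>R D2) = affine_map 0 D1 D2 p q1"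
      by (simp add: affine_map_def q1_def scaleR_add_right)
    also have "\<kappa> * norm v \<le> \<kappa> * \<delta>" using v \<kappa> by simp
    finally have 2: "norm (g q1 - g p - affine_map 0 D1 D2 p q1) \<le> \<kappa> * \<delta>" .
    have "affine_map 0 D1 D2 p q1 - affine_map 0 D1 D2 p q = fst (q1 - q) *\<^sub>R D1 + snd (q1 - q) *\<^sub>R D2"
      by (simp add: affine_map_def algebra_simps)
    also have "norm \<dots> \<le> \<bar>fst (q1 - q)\<bar> * norm D1 + \<bar>snd (q1 - q)\<bar> * norm D2"
      by (rule order_trans[OF norm_triangle_ineq]) simp
    also have "\<dots> \<le> (\<kappa> * \<delta>) * n + (\<kappa> * \<delta>) * n"
    proof -
      have "\<bar>fst (q1 - q)\<bar> \<le> \<kappa> * \<delta>" "\<bar>snd (q1 - q)\<bar> \<le> \<kappa> * \<delta>"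
        using d norm_fst_le[of "fst (q1 - q)" "snd (q1 - q)"] norm_snd_le[of "snd (q1 - q)" "fst (q1 - q)"]
        unfolding prod.collapse real_norm_def by linarith+
      then show ?thesis using D(1,2) \<kappa>(1) \<delta>0 by (intro add_mono mult_mono) auto
    qed
    finally have 3: "norm (affine_map 0 D1 D2 p q1 - affine_map 0 D1 D2 p q) \<le> 2 * n * (\<kappa> * \<delta>)"
      by (simp add: algebra_simps)
    have "g q - affine_map (g p) D1 D2 p q = - (g q1 - g q) + (g q1 - g p - affine_map 0 D1 D2 p q1)
        + (affine_map 0 D1 D2 p q1 - affine_map 0 D1 D2 p q)"
      by (simp add: affine_map_def)
    also have "norm \<dots> \<le> 2 * n * S + \<kappa> * \<delta> + 2 * n * (\<kappa> * \<delta>)"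
      by (intro norm_triangle_mono 2 3) (use 1 in \<open>simp add: norm_minus_commute\<close>)
    also have "\<dots> = (6 * n / \<rho>0 + 1 + 2 * n) * \<kappa> * \<delta>"
      using \<open>\<rho>0 > 0\<close> by (simp add: S_def field_simps)
    finally show ?thesis .
  qed
  have "norm (rect_integral g a b c d) \<le> 2 * ((6 * n / \<rho>0 + 1 + 2 * n) * \<kappa> * \<delta>) * ((b - a) + (d - c))"
    using lt by (intro rect_integral_affine_bound[OF continuous_g_rect[OF R] _ _ D(3) lin]) simp_all
  then show ?thesis unfolding \<delta>(1)[symmetric] by (simp only: power2_eq_square mult.assoc)
qed

end

section \<open>Integrals over rectangles vanish\<close>

context closed_plane_form
begin

lemma lipschitz_along_axes:
  assumes "lipschitz_along U g n B s p" "B \<noteq> {}" "fst x = fst p \<or> snd x = snd p" "dist x p \<le> s"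
  shows "norm (g x - g p) \<le> n * dist x p"
proof -
  obtain w where w: "w \<in> B" using assms(2) by blast
  obtain v where v: "v \<in> {(1, 0), (-1, 0), (0, 1), (0, -1)}" "x = p + dist x p *\<^sub>R v"
  proof (cases "fst x = fst p")
    case True
    then have "dist x p = \<bar>snd x - snd p\<bar>" by (cases x; cases p) (simp add: dist_Pair_Pair dist_real_def)
    with True show thesis by (intro that[of "(0, if snd x \<ge> snd p then 1 else -1)"]) (auto simp: prod_eq_iff)
  next
    case False
    then have e: "snd x = snd p" using assms(3) by simp
    then have "dist x p = \<bar>fst x - fst p\<bar>" by (cases x; cases p) (simp add: dist_Pair_Pair dist_real_def)
    with e show thesis by (intro that[of "(if fst x \<ge> fst p then 1 else -1, 0)"]) (auto simp: prod_eq_iff)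
  qed
  have f: "(\<lambda>w. v) \<in> flips" using v(1) by (auto simp: flips_def)
  have "norm (g (p + dist x p *\<^sub>R v) - g p) \<le> n * dist x p"
    by (rule lipschitz_alongD[OF assms(1) w _ assms(4) f]) simp
  then show ?thesis using v(2) by simp
qed

text \<open>
  For fixed \<open>\<kappa>\<close> the sets \<open>W j\<close> of points that are close to \<open>X\<close> but not approximated at scale \<open>t j\<close> decrease to
  the empty set, so their measures tend to zero. In a subdivision finer than \<open>t j\<close> a cell is harmless, or nearly affine, or
  contains a box of proportion \<open>\<kappa>\<close> inside \<open>W j\<close>; in the last case the crude bound is at most a multiple of the measure
  of the part of \<open>W j\<close> in the cell. Summing up, letting \<open>j\<close> tend to infinity and then \<open>\<kappa>\<close> to zero
  gives the claim.
\<close>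

lemma rect_integral_zero_near:
  assumes Q: "cbox (a, c) (b, d) \<subseteq> U" and le: "a \<le> b" "c \<le> d"
    and lip: "\<And>p. p \<in> cbox (a, c) (b, d) - vanishing \<Longrightarrow> lipschitz_along U g n (ball w0 \<rho>0) s p"
    and "norm w0 < 1" "\<rho>0 > 0" "n \<ge> 0" "s > 0"
  shows "rect_integral g a b c d = 0"
proof -
  let ?Q = "cbox (a, c) (b, d)"
  define X where "X = ?Q - vanishing"
  consider "a = b \<or> c = d" | "X = {}" | "a < b" "c < d" "X \<noteq> {}" using le by fastforce
  then show ?thesis
  proof cases
    case 1
    then show ?thesis by (rule rect_integral_degenerate[OF continuous_g_rect[OF Q] le])
  next
    case 2
    then show ?thesis by (intro rect_integral_vanishing le) (auto simp: X_def)
  next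
    case 3
    note lt = 3(1,2)
    have X: "compact X" unfolding X_def by (rule compact_nonvanishing)
    define \<Delta> where "\<Delta> = (b - a) + (d - c)"
    define \<mu> where "\<mu> = min (b - a) (d - c)"
    define A where "A = (b - a) * (d - c)"
    \<comment> \<open>The proportion of squared diameter and area, shared by all cells of the quadtree.\<close>
    define \<Lambda> where "\<Lambda> = \<Delta>\<^sup>2 / A"
    define C where "C = 2 * (6 * n / \<rho>0 + 1 + 2 * n)"
    have pos: "\<Delta> > 0" "\<mu> > 0" "A > 0" using lt by (auto simp: \<Delta>_def \<mu>_def A_def)
    then have pos2: "\<Lambda> > 0" by (simp add: \<Lambda>_def)
    have "6 * n / \<rho>0 \<ge> 0" using \<open>n \<ge> 0\<close> \<open>\<rho>0 > 0\<close> by simp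
    then have "6 * n / \<rho>0 + 1 + 2 * n > 0" using \<open>n \<ge> 0\<close> by linarith
    then have "C > 0" unfolding C_def by simp
    note pos = pos pos2 this
    have main: "norm (rect_integral g a b c d) \<le> C * \<kappa> * \<Delta>\<^sup>2" if \<kappa>: "0 < \<kappa>" "\<kappa> \<le> 1" "3 / \<rho>0 * \<kappa> * \<Delta> \<le> \<mu> / 2" for \<kappa>
    proof -
      obtain \<Theta> :: "(real \<times> real) set" where \<Theta>: "finite \<Theta>" "\<Theta> \<subseteq> sphere 0 1"
        and net: "\<And>v. norm v = 1 \<Longrightarrow> \<exists>\<theta>\<in>\<Theta>. dist \<theta> v < \<kappa>"
        using finite_net_unit_sphere[OF \<kappa>(1)] by metis
      define t where "t j = s / real (Suc j)" for j
      have t: "t j > 0" "t j \<le> s" for j using \<open>s > 0\<close> by (auto simp: t_def field_simps)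
      define E where "E j = approx_set X \<Theta> n \<kappa> (t j)" for j
      define W where "W j = (?Q \<inter> {x. infdist x X \<le> t j}) - E j" for j
      have EX: "E j \<subseteq> X" for j by (auto simp: E_def approx_set_def)
      have lipX: "lipschitz_along U g n (ball w0 \<rho>0) s p" if "p \<in> X" for p
        using lip that by (simp add: X_def)
      have "compact (E j)" for j
        unfolding E_def
      proof (rule compact_approx_set[OF X \<Theta>(2)])
        fix p assume "p \<in> X"
        then have "cball p s \<subseteq> U" using lipX by (simp add: lipschitz_along_def)
        then show "cball p (t j) \<subseteq> U" using t(2)[of j] by auto
      qed (use t less_imp_le in auto)
      then have Wm: "W j \<in> sets borel" for j
      proof -
        have "closed {x. infdist x X \<le> t j}"
          by (intro closed_Collect_le continuous_intros)
        then show ?thesis unfolding W_def using \<open>compact (E j)\<close>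
          by (intro sets.Diff sets.Int) (auto intro: borel_closed compact_imp_closed)
      qed
      \<comment> \<open>The first summand collects the nearly affine cells, the second one the others.\<close>
      have bound: "norm (rect_integral g a b c d) \<le> C * \<kappa> * \<Delta>\<^sup>2 + 4 * n / \<kappa>\<^sup>2 * \<Lambda> * measure lborel (W j)" for j
      proof -
        define \<phi> where "\<phi> a b c d = C * \<kappa> * \<Lambda> * ((b - a) * (d - c)) + 4 * n / \<kappa>\<^sup>2 * \<Lambda> * measure lborel (box (a, c) (b, d) \<inter> W j)" for a b c d
        have K0: "4 * n / \<kappa>\<^sup>2 * \<Lambda> \<ge> 0" "C * \<kappa> * \<Lambda> \<ge> 0" using \<open>n \<ge> 0\<close> pos \<kappa> by auto
        have "min (t j) (s * \<rho>0 / 3) > 0" using t \<open>s > 0\<close> \<open>\<rho>0 > 0\<close> by auto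
        then obtain l where l: "\<Delta> / 2 ^ l < min (t j) (s * \<rho>0 / 3)" using small_cells by blast
        have "norm (rect_integral g a b c d) \<le> \<phi> a b c d"
          using le
        proof (induction a b c d rule: quadtree_induct[where l = l and Q = ?Q])
          case (quarter a' b' c' d')
          let ?m = "(a' + b') / 2" and ?l = "(c' + d') / 2"
          have "norm (rect_integral g a' b' c' d') \<le> \<phi> a' ?m c' ?l + \<phi> a' ?m ?l d' + \<phi> ?m b' c' ?l + \<phi> ?m b' ?l d'"
          proof -
            have "cbox (a', c') (b', d') \<subseteq> U" using quarter(3) Q by blast
            then have "rect_integral g a' b' c' d' = rect_integral g a' ?m c' ?l + rect_integral g a' ?m ?l d' +
                rect_integral g ?m b' c' ?l + rect_integral g ?m b' ?l d'"
              using quarter(1,2) by (intro rect_integral_quarters continuous_g_rect) auto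
            then show ?thesis using quarter(4-7) by (simp only:) (intro norm_triangle_mono)
          qed
          also have "\<dots> = C * \<kappa> * \<Lambda> * ((b' - a') * (d' - c')) + 4 * n / \<kappa>\<^sup>2 * \<Lambda> *
             (measure lborel (box (a', c') (?m, ?l) \<inter> W j) + measure lborel (box (a', ?l) (?m, d') \<inter> W j) +
              measure lborel (box (?m, c') (b', ?l) \<inter> W j) + measure lborel (box (?m, ?l) (b', d') \<inter> W j))"
          proof -
            have area: "(b' - a') * (d' - c') = (?m - a') * (?l - c') + (?m - a') * (d' - ?l) + (b' - ?m) * (?l - c') + (b' - ?m) * (d' - ?l)"
              by (simp add: field_simps)
            show ?thesis unfolding \<phi>_def area by (simp only: distrib_left)
          qed
          also have "\<dots> \<le> \<phi> a' b' c' d'"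
            unfolding \<phi>_def using quarter(1,2)
            by (intro add_left_mono mult_left_mono[OF _ K0(1)] measure_box_quarters Wm) auto
          finally show ?case .
        next
          case (cell a' b' c' d')
          define \<delta> where "\<delta> = (b' - a') + (d' - c')"
          have \<delta>: "\<delta> = \<Delta> / 2 ^ l" by (simp add: \<delta>_def \<Delta>_def cell add_divide_distrib)
          have lt': "a' < b'" "c' < d'"
            using cell(4,5) lt by (smt (verit) zero_less_divide_iff zero_less_power)+
          have area: "\<delta>\<^sup>2 = \<Lambda> * ((b' - a') * (d' - c'))"
          proof -
            have "(b' - a') * (d' - c') = A / (2 ^ l)\<^sup>2"
              unfolding cell(4,5) A_def by (simp add: power2_eq_square)
            then show ?thesis unfolding \<delta> \<Lambda>_def using pos(3) by (simp add: power_divide)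
          qed
          have \<delta>t: "\<delta> \<le> t j" "\<delta> \<le> s" "0 < \<delta>" "3 / \<rho>0 * \<kappa> * \<delta> \<le> s"
          proof -
            show "\<delta> \<le> t j" "\<delta> \<le> s" using l t(2)[of j] unfolding \<delta> by linarith+
            show "0 < \<delta>" using lt' by (simp add: \<delta>_def)
            then have "\<kappa> * \<delta> \<le> 1 * \<delta>" using \<kappa> by (intro mult_right_mono) auto
            also have "\<dots> \<le> s * \<rho>0 / 3" using l unfolding \<delta> by simp
            finally show "3 / \<rho>0 * \<kappa> * \<delta> \<le> s" using \<open>\<rho>0 > 0\<close> by (simp add: field_simps)
          qed
          have ratio: "3 / \<rho>0 * \<kappa> * \<delta> \<le> (b' - a') / 2" "3 / \<rho>0 * \<kappa> * \<delta> \<le> (d' - c') / 2"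
          proof -
            have "3 / \<rho>0 * \<kappa> * \<delta> = (3 / \<rho>0 * \<kappa> * \<Delta>) / 2 ^ l" by (simp add: \<delta>)
            also have "\<dots> \<le> (\<mu> / 2) / 2 ^ l" using \<kappa>(3) by (intro divide_right_mono) auto
            also have "\<dots> = \<mu> / 2 ^ l / 2" by simp
            finally have *: "3 / \<rho>0 * \<kappa> * \<delta> \<le> \<mu> / 2 ^ l / 2" .
            have "\<mu> / 2 ^ l \<le> b' - a'" "\<mu> / 2 ^ l \<le> d' - c'"
              unfolding cell \<mu>_def by (intro divide_right_mono; simp)+
            then have "\<mu> / 2 ^ l / 2 \<le> (b' - a') / 2" "\<mu> / 2 ^ l / 2 \<le> (d' - c') / 2" by simp_all
            note half = this
            show "3 / \<rho>0 * \<kappa> * \<delta> \<le> (b' - a') / 2" by (rule order_trans[OF * half(1)])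
            show "3 / \<rho>0 * \<kappa> * \<delta> \<le> (d' - c') / 2" by (rule order_trans[OF * half(2)])
          qed
          have RU: "cbox (a', c') (b', d') \<subseteq> U" using cell(3) Q by blast
          have mnn: "0 \<le> 4 * n / \<kappa>\<^sup>2 * \<Lambda> * measure lborel (box (a', c') (b', d') \<inter> W j)"
            by (rule mult_nonneg_nonneg[OF K0(1)]) simp
          have ann: "0 \<le> C * \<kappa> * \<Lambda> * ((b' - a') * (d' - c'))"
            using lt' by (intro mult_nonneg_nonneg[OF K0(2)]) simp
          consider "cbox (a', c') (b', d') \<inter> X = {}"
            | "\<And>s t. a' \<le> s \<Longrightarrow> s + \<kappa> * (b' - a') \<le> b' \<Longrightarrow> c' \<le> t \<Longrightarrow> t + \<kappa> * (d' - c') \<le> d' \<Longrightarrow>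
                E j \<inter> cbox (s, t) (s + \<kappa> * (b' - a'), t + \<kappa> * (d' - c')) \<noteq> {}"
            | x0 s' t' where "x0 \<in> cbox (a', c') (b', d')" "x0 \<in> X" "a' \<le> s'" "s' + \<kappa> * (b' - a') \<le> b'"
                "c' \<le> t'" "t' + \<kappa> * (d' - c') \<le> d'" "E j \<inter> cbox (s', t') (s' + \<kappa> * (b' - a'), t' + \<kappa> * (d' - c')) = {}"
            by blast
          then show ?case
          proof cases
            case 1
            then have "cbox (a', c') (b', d') \<subseteq> vanishing" using cell(3) by (auto simp: X_def)
            then have "rect_integral g a' b' c' d' = 0" by (intro rect_integral_vanishing cell)
            then show ?thesis unfolding \<phi>_def using mnn ann by simp
          next
            case 2
            have "norm (rect_integral g a' b' c' d') \<le> 2 * (6 * n / \<rho>0 + 1 + 2 * n) * \<kappa> * \<delta>\<^sup>2"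
            proof (rule rect_integral_good_cell[OF RU lt' _ net \<Theta>(2) _ assms(5-7) \<kappa>(1,2) 2 \<delta>_def \<delta>t(1,4) ratio])
              show "E j \<subseteq> approx_set X \<Theta> n \<kappa> (t j)" by (simp add: E_def)
              show "lipschitz_along U g n (ball w0 \<rho>0) s p" if "p \<in> E j" for p
                using lipX EX that by blast
            qed
            also have "\<dots> = C * \<kappa> * \<Lambda> * ((b' - a') * (d' - c'))" unfolding area C_def by (simp add: algebra_simps)
            finally show ?thesis unfolding \<phi>_def using mnn by linarith
          next
            case 3
            let ?B = "box (s', t') (s' + \<kappa> * (b' - a'), t' + \<kappa> * (d' - c'))"
            have kk: "0 \<le> \<kappa> * (b' - a')" "0 \<le> \<kappa> * (d' - c')" using \<kappa>(1) lt' by auto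
            have "?B \<subseteq> box (a', c') (b', d') \<inter> W j"
            proof
              fix x assume x: "x \<in> ?B"
              then have xb: "x \<in> box (a', c') (b', d')" using 3 by (auto simp: in_box_iff)
              then have xc: "x \<in> cbox (a', c') (b', d')" by (auto simp: in_box_iff in_rect_iff)
              then have "dist x x0 \<le> \<delta>" using dist_le_abs[of x x0] 3(1) by (auto simp: in_rect_iff \<delta>_def)
              then have "infdist x X \<le> t j" using 3(2) \<delta>t(1) by (intro infdist_le2[of x0]) auto
              moreover have "x \<notin> E j" using 3(7) x by (auto simp: in_box_iff in_rect_iff)
              ultimately show "x \<in> box (a', c') (b', d') \<inter> W j" using xb xc cell(3) by (auto simp: W_def)
            qed
            moreover have "box (a', c') (b', d') \<inter> W j \<in> fmeasurable lborel"
              using Wm by (intro fmeasurable_Int_fmeasurable) (auto intro: fmeasurableI simp: emeasure_lborel_box_finite)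
            ultimately have "measure lborel ?B \<le> measure lborel (box (a', c') (b', d') \<inter> W j)"
              by (intro measure_mono_fmeasurable) auto
            then have "\<kappa>\<^sup>2 * ((b' - a') * (d' - c')) \<le> measure lborel (box (a', c') (b', d') \<inter> W j)"
              using kk by (simp add: measure_rect_box power2_eq_square mult_ac)
            then have m: "(b' - a') * (d' - c') \<le> measure lborel (box (a', c') (b', d') \<inter> W j) / \<kappa>\<^sup>2"
              using \<kappa>(1) by (simp add: pos_le_divide_eq mult.commute)
            have "norm (rect_integral g a' b' c' d') \<le> 4 * n * ((b' - a') + (d' - c'))\<^sup>2"
            proof (rule rect_integral_crude_bound[OF RU cell(1,2) \<open>n \<ge> 0\<close>])
              fix p x assume *: "p \<in> cbox (a', c') (b', d') - vanishing" "x \<in> cbox (a', c') (b', d')"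
                "fst x = fst p \<or> snd x = snd p"
              have "p \<in> X" using *(1) cell(3) by (auto simp: X_def)
              moreover have "dist x p \<le> \<delta>" using dist_le_abs[of x p] *(1,2) by (auto simp: in_rect_iff \<delta>_def)
              ultimately show "norm (g x - g p) \<le> n * dist x p"
                using \<delta>t(2) \<open>\<rho>0 > 0\<close> by (intro lipschitz_along_axes[OF lipX _ *(3)]) auto
            qed
            also have "\<dots> = 4 * n * \<Lambda> * ((b' - a') * (d' - c'))" using area by (simp add: \<delta>_def)
            also have "\<dots> \<le> 4 * n * \<Lambda> * (measure lborel (box (a', c') (b', d') \<inter> W j) / \<kappa>\<^sup>2)"
              using m \<open>n \<ge> 0\<close> pos by (intro mult_left_mono) auto
            finally show ?thesis unfolding \<phi>_def using ann by (simp add: algebra_simps)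
          qed
        qed simp
        also have "\<phi> a b c d \<le> C * \<kappa> * \<Delta>\<^sup>2 + 4 * n / \<kappa>\<^sup>2 * \<Lambda> * measure lborel (W j)"
        proof -
          have sub: "W j \<subseteq> ?Q" unfolding W_def by blast
          have Wl: "W j \<in> sets lborel" using Wm[of j] by simp
          have "W j \<in> fmeasurable lborel"
            by (rule fmeasurableI2[OF fmeasurable_cbox sub Wl])
          moreover have "box (a, c) (b, d) \<inter> W j \<in> sets lborel"
            using Wl by (intro sets.Int) simp_all
          ultimately have "measure lborel (box (a, c) (b, d) \<inter> W j) \<le> measure lborel (W j)"
            by (intro measure_mono_fmeasurable Int_lower2)
          then have "4 * n / \<kappa>\<^sup>2 * \<Lambda> * measure lborel (box (a, c) (b, d) \<inter> W j) \<le> 4 * n / \<kappa>\<^sup>2 * \<Lambda> * measure lborel (W j)"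
            by (rule mult_left_mono[OF _ K0(1)])
          moreover have "C * \<kappa> * \<Lambda> * ((b - a) * (d - c)) = C * \<kappa> * \<Delta>\<^sup>2"
            unfolding \<Lambda>_def A_def[symmetric] using pos(3) by simp
          ultimately show ?thesis unfolding \<phi>_def by linarith
        qed
        finally show ?thesis .
      qed
      have "(\<lambda>j. measure lborel (W j)) \<longlonglongrightarrow> measure lborel (\<Inter>j. W j)"
      proof (rule Lim_measure_decseq)
        show "range W \<subseteq> sets lborel" using Wm by auto
        have tS: "t (Suc j) \<le> t j" for j using \<open>s > 0\<close> by (simp add: t_def field_simps)
        have "W (Suc j) \<subseteq> W j" for j
        proof
          fix x assume x: "x \<in> W (Suc j)"
          then have "infdist x X \<le> t j" using tS[of j] by (simp add: W_def)
          moreover have "x \<notin> E j"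
            using x subsetD[OF approx_set_mono[OF tS[of j]], of x X \<Theta> n \<kappa>] by (auto simp: W_def E_def)
          ultimately show "x \<in> W j" using x by (simp add: W_def)
        qed
        then show "decseq W" by (simp add: decseq_Suc_iff)
        show "emeasure lborel (W j) \<noteq> \<infinity>" for j
        proof -
          have "emeasure lborel (W j) \<le> emeasure lborel ?Q"
            by (intro emeasure_mono) (auto simp: W_def)
          then show ?thesis using emeasure_lborel_cbox_finite[of "(a, c)" "(b, d)"] by (auto simp: top_unique)
        qed
      qed
      moreover have "(\<Inter>j. W j) = {}"
      proof (rule ccontr)
        assume "\<not> ?thesis"
        then obtain x where x: "\<And>j. x \<in> W j" by blast
        have lim: "t \<longlonglongrightarrow> 0" unfolding t_def by (rule LIMSEQ_Suc[OF lim_const_over_n])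
        have "infdist x X \<le> 0"
          by (rule LIMSEQ_le_const[OF lim]) (use x in \<open>auto simp: W_def\<close>)
        then have xX: "x \<in> X"
          using in_closed_iff_infdist_zero[OF compact_imp_closed[OF X] 3(3)] infdist_nonneg[of x X] by simp
        have xU: "x \<in> U" using x[of 0] Q by (auto simp: W_def)
        have "\<exists>t>0. x \<in> approx_set X \<Theta> n \<kappa> t"
          by (rule approx_set_exhausts[OF xX xU \<Theta> \<kappa>(1) lipX[OF xX] _ \<open>s > 0\<close>]) (use \<open>\<rho>0 > 0\<close> in simp)
        then obtain t' where t': "t' > 0" "x \<in> approx_set X \<Theta> n \<kappa> t'" by blast
        have "\<forall>\<^sub>F j in sequentially. t j < t'" using lim t'(1) by (rule order_tendstoD(2))
        then obtain j where "t j \<le> t'" by (auto simp: eventually_sequentially intro: less_imp_le)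
        then have "x \<in> E j" using t'(2) approx_set_mono unfolding E_def by blast
        then show False using x[of j] by (simp add: W_def)
      qed
      ultimately have "(\<lambda>j. measure lborel (W j)) \<longlonglongrightarrow> 0" by simp
      then have "(\<lambda>j. C * \<kappa> * \<Delta>\<^sup>2 + 4 * n / \<kappa>\<^sup>2 * \<Lambda> * measure lborel (W j)) \<longlonglongrightarrow> C * \<kappa> * \<Delta>\<^sup>2 + 4 * n / \<kappa>\<^sup>2 * \<Lambda> * 0"
        by (intro tendsto_intros)
      then have "norm (rect_integral g a b c d) \<le> C * \<kappa> * \<Delta>\<^sup>2 + 4 * n / \<kappa>\<^sup>2 * \<Lambda> * 0"
        by (rule LIMSEQ_le_const) (use bound in blast)
      then show ?thesis by simp
    qed
    define \<kappa>0 where "\<kappa>0 = min 1 (\<mu> * \<rho>0 / (6 * \<Delta>))"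
    have \<kappa>0: "\<kappa>0 > 0" using pos \<open>\<rho>0 > 0\<close> by (simp add: \<kappa>0_def)
    have ev: "norm (rect_integral g a b c d) \<le> C * (\<kappa>0 / real (Suc i)) * \<Delta>\<^sup>2" for i
    proof (rule main)
      have le: "\<kappa>0 / real (Suc i) \<le> \<kappa>0" using \<kappa>0 by (simp add: field_simps)
      show "0 < \<kappa>0 / real (Suc i)" using \<kappa>0 by simp
      show "\<kappa>0 / real (Suc i) \<le> 1" using le by (simp add: \<kappa>0_def)
      have "\<kappa>0 / real (Suc i) \<le> \<mu> * \<rho>0 / (6 * \<Delta>)" using le by (simp add: \<kappa>0_def)
      then have "3 / \<rho>0 * (\<kappa>0 / real (Suc i)) * \<Delta> \<le> 3 / \<rho>0 * (\<mu> * \<rho>0 / (6 * \<Delta>)) * \<Delta>"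
        using pos \<open>\<rho>0 > 0\<close> by (intro mult_right_mono mult_left_mono) auto
      also have "\<dots> = \<mu> / 2" using pos \<open>\<rho>0 > 0\<close> by simp
      finally show "3 / \<rho>0 * (\<kappa>0 / real (Suc i)) * \<Delta> \<le> \<mu> / 2" .
    qed
    have "(\<lambda>i. C * (\<kappa>0 / real (Suc i)) * \<Delta>\<^sup>2) \<longlonglongrightarrow> C * 0 * \<Delta>\<^sup>2"
      by (intro tendsto_intros LIMSEQ_Suc[OF lim_const_over_n])
    then have "norm (rect_integral g a b c d) \<le> C * 0 * \<Delta>\<^sup>2"
      by (rule LIMSEQ_le_const) (use ev in auto)
    then show ?thesis by simp
  qed
qed

text \<open>
  If there were exceptional points, the portion supplied by Baire's theorem would contain one near
  which all integrals vanish.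
\<close>

theorem rect_integral_zero:
  assumes "a \<le> b" "c \<le> d" "cbox (a, c) (b, d) \<subseteq> U"
  shows "rect_integral g a b c d = 0"
proof -
  have "U \<subseteq> vanishing"
  proof (rule ccontr)
    assume "\<not> ?thesis"
    then obtain p0 where "p0 \<in> U - vanishing" by blast
    from lipschitz_portion[OF this] obtain p1 r1 w0 \<rho>0 n s where
      *: "p1 \<in> U - vanishing" "r1 > 0" "ball p1 r1 \<subseteq> U" "norm w0 < 1" "\<rho>0 > 0" "n \<ge> 0" "s > 0"
      "\<And>p. p \<in> ball p1 r1 - vanishing \<Longrightarrow> lipschitz_along U g n (ball w0 \<rho>0) s p" by metis
    have "rect_integral g a b c d = 0" if "a \<le> b" "c \<le> d" "cbox (a, c) (b, d) \<subseteq> ball p1 r1" for a b c d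
      by (rule rect_integral_zero_near[OF _ that(1,2) _ *(4-7)]) (use that(3) * in blast)+
    then have "p1 \<in> vanishing" using * unfolding vanishing_def by blast
    then show False using * by blast
  qed
  then show ?thesis using assms by (intro rect_integral_vanishing) auto
qed

end

section \<open>Closed forms in higher dimension\<close>

text \<open>
  The symmetry is required of derivatives along rays, since at the outset nothing more is known of a
  monogenic function.
\<close>

locale closed_form =
  fixes W :: "'e::euclidean_space set" and \<omega> :: "'e \<Rightarrow> 'e \<Rightarrow> 'v::euclidean_space"
  assumes open_W: "open W" and form: "continuous_form W \<omega>"
    and symmetric_derivative: "x \<in> W \<Longrightarrow> \<exists>D. bilinear D \<and> (\<forall>h k. D h k = D k h) \<and>
      (\<forall>h k. ((\<lambda>r. (\<omega> (x + r *\<^sub>R h) k - \<omega> x k) /\<^sub>R r) \<longlongrightarrow> D h k) (at_right 0))"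
begin

lemma linear_form: "linear (\<omega> x)"
  using form by (simp add: continuous_form_def)

text \<open>
  The pull-back of the form under \<open>(s, t) \<mapsto> x + s h + t k\<close> is a plane form with symmetric derivative,
  so its integral over the unit square vanishes.
\<close>

lemma parallelogram:
  assumes sub: "\<And>s t. s \<in> {0..1} \<Longrightarrow> t \<in> {0..1} \<Longrightarrow> x + s *\<^sub>R h + t *\<^sub>R k \<in> W"
  shows "seg_integral \<omega> x (x + h) + seg_integral \<omega> (x + h) (x + h + k) +
    seg_integral \<omega> (x + h + k) (x + k) + seg_integral \<omega> (x + k) x = 0"
proof -
  define \<alpha> where "\<alpha> p = x + fst p *\<^sub>R h + snd p *\<^sub>R k" for p :: "real \<times> real"
  define g where "g p = (\<omega> (\<alpha> p) h, \<omega> (\<alpha> p) k)" for p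
  define U where "U = \<alpha> -` W"
  have ca: "continuous_on T \<alpha>" for T unfolding \<alpha>_def by (intro continuous_intros)
  interpret P: closed_plane_form U g
  proof
    show "open U" unfolding U_def by (rule open_vimage[OF open_W ca])
    have "\<alpha> ` U \<subseteq> W" by (auto simp: U_def)
    then show "continuous_on U g" unfolding g_def
      by (intro continuous_on_Pair continuous_form_comp[OF form ca] continuous_on_const)
    fix p assume "p \<in> U"
    then have "\<alpha> p \<in> W" by (simp add: U_def)
    then obtain D where D: "bilinear D" "\<And>h k. D h k = D k h"
      "\<And>h k. ((\<lambda>r. (\<omega> (\<alpha> p + r *\<^sub>R h) k - \<omega> (\<alpha> p) k) /\<^sub>R r) \<longlongrightarrow> D h k) (at_right 0)"
      using symmetric_derivative by blast
    show "\<exists>D1 D2. fst D2 = snd D1 \<and>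
      (\<forall>w. ((\<lambda>r. (g (p + r *\<^sub>R w) - g p) /\<^sub>R r) \<longlongrightarrow> fst w *\<^sub>R D1 + snd w *\<^sub>R D2) (at_right 0))"
    proof (rule exI[of _ "(D h h, D h k)"], rule exI[of _ "(D k h, D k k)"], intro conjI allI)
      show "fst (D k h, D k k) = snd (D h h, D h k)" using D(2) by simp
      fix w :: "real \<times> real"
      let ?v = "fst w *\<^sub>R h + snd w *\<^sub>R k"
      have a: "\<alpha> (p + r *\<^sub>R w) = \<alpha> p + r *\<^sub>R ?v" for r
        by (simp add: \<alpha>_def algebra_simps)
      have "((\<lambda>r. ((\<omega> (\<alpha> p + r *\<^sub>R ?v) h - \<omega> (\<alpha> p) h) /\<^sub>R r, (\<omega> (\<alpha> p + r *\<^sub>R ?v) k - \<omega> (\<alpha> p) k) /\<^sub>R r))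
        \<longlongrightarrow> (D ?v h, D ?v k)) (at_right 0)"
        by (intro tendsto_Pair D(3))
      also have "(D ?v h, D ?v k) = fst w *\<^sub>R (D h h, D h k) + snd w *\<^sub>R (D k h, D k k)"
        using D(1) by (simp add: bilinear_ladd bilinear_lmul)
      finally show "((\<lambda>r. (g (p + r *\<^sub>R w) - g p) /\<^sub>R r) \<longlongrightarrow> fst w *\<^sub>R (D h h, D h k) + snd w *\<^sub>R (D k h, D k k)) (at_right 0)"
        by (simp add: g_def a)
    qed
  qed
  have pull: "seg_integral (plane_form g) p q = seg_integral \<omega> (\<alpha> p) (\<alpha> q)" for p q
  proof -
    have "\<alpha> q - \<alpha> p = fst (q - p) *\<^sub>R h + snd (q - p) *\<^sub>R k"
      by (simp add: \<alpha>_def algebra_simps)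
    moreover have "\<alpha> (p + u *\<^sub>R (q - p)) = \<alpha> p + u *\<^sub>R (\<alpha> q - \<alpha> p)" for u
      by (simp add: \<alpha>_def algebra_simps)
    ultimately show ?thesis unfolding seg_integral_def plane_form_def g_def
      by (simp add: linear_add[OF linear_form] linear_scale[OF linear_form])
  qed
  have "cbox (0, 0) (1, 1) \<subseteq> U"
    using sub by (auto simp: U_def \<alpha>_def in_rect_iff)
  then have "rect_integral g 0 1 0 1 = 0" by (intro P.rect_integral_zero) auto
  then show ?thesis unfolding rect_integral_def pull by (simp add: \<alpha>_def)
qed

definition triangle_integral :: "'e \<Rightarrow> 'e \<Rightarrow> 'e \<Rightarrow> 'v" where
  "triangle_integral x h k = seg_integral \<omega> x (x + h) + seg_integral \<omega> (x + h) (x + k) + seg_integral \<omega> (x + k) x"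

text \<open>Cutting a parallelogram out of a triangle leaves two triangles of half the size.\<close>

lemma triangle_integral_halve:
  assumes sub: "\<And>s t. 0 \<le> s \<Longrightarrow> 0 \<le> t \<Longrightarrow> s + t \<le> 1 \<Longrightarrow> x + s *\<^sub>R h + t *\<^sub>R k \<in> W"
  shows "triangle_integral x h k =
    triangle_integral (x + (1/2) *\<^sub>R h) ((1/2) *\<^sub>R h) ((1/2) *\<^sub>R k) +
    triangle_integral (x + (1/2) *\<^sub>R k) ((1/2) *\<^sub>R h) ((1/2) *\<^sub>R k)"
proof -
  define h' k' where "h' = (1/2) *\<^sub>R h" "k' = (1/2) *\<^sub>R k"
  then have hk: "h = h' + h'" "k = k' + k'" by (simp_all flip: scaleR_2)
  have pt: "x + (2 * s) *\<^sub>R h' + (2 * t) *\<^sub>R k' \<in> W" if "0 \<le> s" "0 \<le> t" "s + t \<le> 1" for s t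
    using sub[OF that] by (simp add: h'_k'_def)
  have W: "x + s *\<^sub>R h' + t *\<^sub>R k' \<in> W" if "0 \<le> s" "0 \<le> t" "s + t \<le> 2" for s t
    using pt[of "s/2" "t/2"] that by simp
  have par: "seg_integral \<omega> x (x + h') + seg_integral \<omega> (x + h') (x + h' + k') +
    seg_integral \<omega> (x + h' + k') (x + k') + seg_integral \<omega> (x + k') x = 0"
    by (rule parallelogram) (auto intro: W)
  have seg: "closed_segment (x + s *\<^sub>R h' + t *\<^sub>R k') (x + s' *\<^sub>R h' + t' *\<^sub>R k') \<subseteq> W"
    if "0 \<le> s" "0 \<le> t" "s + t \<le> 2" "0 \<le> s'" "0 \<le> t'" "s' + t' \<le> 2" for s t s' t'
  proof
    fix y assume "y \<in> closed_segment (x + s *\<^sub>R h' + t *\<^sub>R k') (x + s' *\<^sub>R h' + t' *\<^sub>R k')"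
    then obtain u where u: "0 \<le> u" "u \<le> 1"
      "y = (1 - u) *\<^sub>R (x + s *\<^sub>R h' + t *\<^sub>R k') + u *\<^sub>R (x + s' *\<^sub>R h' + t' *\<^sub>R k')"
      by (auto simp: closed_segment_def)
    have "y = x + ((1 - u) * s + u * s') *\<^sub>R h' + ((1 - u) * t + u * t') *\<^sub>R k'"
      unfolding u(3) by (simp add: algebra_simps)
    moreover have "((1 - u) * s + u * s') + ((1 - u) * t + u * t') \<le> 2"
      using convex_bound_le[OF that(3,6), of "1 - u" u] u by (simp add: algebra_simps)
    ultimately show "y \<in> W" using u that by (auto intro!: W add_nonneg_nonneg mult_nonneg_nonneg)
  qed
  have mid: "y \<in> closed_segment (y - v) (y + v)" for y v :: 'e
    unfolding closed_segment_def by (auto intro!: exI[of _ "1/2"] simp: algebra_simps simp flip: scaleR_2)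
  have m1: "x + h' \<in> closed_segment x (x + h)" using mid[of "x + h'" h'] by (simp add: hk add.assoc)
  have m2: "x + k' \<in> closed_segment (x + k) x" using mid[of "x + k'" "- k'"] by (simp add: hk add.assoc)
  have m3: "x + h' + k' \<in> closed_segment (x + h) (x + k)"
    using mid[of "x + h' + k'" "k' - h'"] by (simp add: hk algebra_simps)
  have s1: "seg_integral \<omega> x (x + h) = seg_integral \<omega> x (x + h') + seg_integral \<omega> (x + h') (x + h)"
    using seg[of 0 0 2 0] by (intro seg_integral_split[OF form _ m1]) (simp add: hk scaleR_2)
  have s2: "seg_integral \<omega> (x + k) x = seg_integral \<omega> (x + k) (x + k') + seg_integral \<omega> (x + k') x"
    using seg[of 0 2 0 0] by (intro seg_integral_split[OF form _ m2]) (simp add: hk scaleR_2)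
  have s3: "seg_integral \<omega> (x + h) (x + k) = seg_integral \<omega> (x + h) (x + h' + k') + seg_integral \<omega> (x + h' + k') (x + k)"
    using seg[of 2 0 0 2] by (intro seg_integral_split[OF form _ m3]) (simp add: hk scaleR_2)
  have r1: "seg_integral \<omega> (x + h' + k') (x + h') = - seg_integral \<omega> (x + h') (x + h' + k')"
    using seg[of 1 0 1 1] by (intro seg_integral_reverse[OF form]) auto
  have r2: "seg_integral \<omega> (x + h' + k') (x + k') = - seg_integral \<omega> (x + k') (x + h' + k')"
    using seg[of 0 1 1 1] by (intro seg_integral_reverse[OF form]) auto
  have e: "x + h' + h' = x + h" "x + k' + k' = x + k" "x + k' + h' = x + h' + k'" by (simp_all add: hk algebra_simps)
  show ?thesis
    unfolding triangle_integral_def h'_k'_def[symmetric] e s1 s2 s3 using par r1 r2 by (simp add: algebra_simps)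
qed

lemma triangle_integral_small:
  assumes sub: "\<And>s t. 0 \<le> s \<Longrightarrow> 0 \<le> t \<Longrightarrow> s + t \<le> 1 \<Longrightarrow> x + s *\<^sub>R h + t *\<^sub>R k \<in> W"
    and h: "\<And>s t. 0 \<le> s \<Longrightarrow> 0 \<le> t \<Longrightarrow> s + t \<le> 1 \<Longrightarrow> norm (\<omega> (x + s *\<^sub>R h + t *\<^sub>R k) h - \<omega> x h) \<le> e"
    and k: "\<And>s t. 0 \<le> s \<Longrightarrow> 0 \<le> t \<Longrightarrow> s + t \<le> 1 \<Longrightarrow> norm (\<omega> (x + s *\<^sub>R h + t *\<^sub>R k) k - \<omega> x k) \<le> e"
  shows "norm (triangle_integral x h k) \<le> 4 * e"
proof -
  have pts: "\<exists>s t. 0 \<le> s \<and> 0 \<le> t \<and> s + t \<le> 1 \<and> y = x + s *\<^sub>R h + t *\<^sub>R k"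
    if y: "y \<in> closed_segment x (x + h) \<union> closed_segment (x + h) (x + k) \<union> closed_segment (x + k) x" for y
  proof -
    consider "y \<in> closed_segment x (x + h)" | "y \<in> closed_segment (x + h) (x + k)" | "y \<in> closed_segment (x + k) x"
      using y by blast
    then show ?thesis
    proof cases
      case 1
      then obtain u where u: "0 \<le> u" "u \<le> 1" "y = (1 - u) *\<^sub>R x + u *\<^sub>R (x + h)" by (auto simp: in_segment)
      have "y = x + u *\<^sub>R h + 0 *\<^sub>R k" unfolding u(3) by (simp add: algebra_simps)
      moreover have "u + 0 \<le> 1" using u by simp
      ultimately show ?thesis using u(1) by blast
    next
      case 2
      then obtain u where u: "0 \<le> u" "u \<le> 1" "y = (1 - u) *\<^sub>R (x + h) + u *\<^sub>R (x + k)" by (auto simp: in_segment)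
      have "y = x + (1 - u) *\<^sub>R h + u *\<^sub>R k" unfolding u(3) by (simp add: algebra_simps)
      moreover have "0 \<le> 1 - u" "(1 - u) + u \<le> 1" using u by simp_all
      ultimately show ?thesis using u(1) by blast
    next
      case 3
      then obtain u where u: "0 \<le> u" "u \<le> 1" "y = (1 - u) *\<^sub>R (x + k) + u *\<^sub>R x" by (auto simp: in_segment)
      have "y = x + 0 *\<^sub>R h + (1 - u) *\<^sub>R k" unfolding u(3) by (simp add: algebra_simps)
      moreover have "0 \<le> 1 - u" "0 + (1 - u) \<le> 1" using u by simp_all
      ultimately show ?thesis by blast
    qed
  qed
  let ?T = "closed_segment x (x + h) \<union> closed_segment (x + h) (x + k) \<union> closed_segment (x + k) x"
  have on: "y \<in> W" "norm (\<omega> y h - \<omega> x h) \<le> e" "norm (\<omega> y k - \<omega> x k) \<le> e" if yT: "y \<in> ?T" for y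
  proof -
    obtain s t where st: "0 \<le> s" "0 \<le> t" "s + t \<le> 1" "y = x + s *\<^sub>R h + t *\<^sub>R k" using pts[OF yT] by blast
    show "y \<in> W" "norm (\<omega> y h - \<omega> x h) \<le> e" "norm (\<omega> y k - \<omega> x k) \<le> e"
      unfolding st(4) by (rule sub h k, rule st(1), rule st(2), rule st(3))+
  qed
  have inW: "closed_segment x (x + h) \<subseteq> W" "closed_segment (x + h) (x + k) \<subseteq> W" "closed_segment (x + k) x \<subseteq> W"
    by (rule subsetI, rule on(1), simp)+
  have 1: "norm (seg_integral \<omega> x (x + h) - \<omega> x h) \<le> e"
    by (rule seg_integral_near_value[OF form inW(1)]) (simp add: on(2))
  have 2: "norm (seg_integral \<omega> (x + k) x - - \<omega> x k) \<le> e"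
  proof (rule seg_integral_near_value[OF form inW(3)])
    fix y assume "y \<in> closed_segment (x + k) x"
    then have "norm (\<omega> y k - \<omega> x k) \<le> e" by (intro on(3)) simp
    then show "norm (\<omega> y (x - (x + k)) - - \<omega> x k) \<le> e"
      by (simp add: linear_neg[OF linear_form] norm_minus_commute)
  qed
  have 3: "norm (seg_integral \<omega> (x + h) (x + k) - (\<omega> x k - \<omega> x h)) \<le> e + e"
  proof (rule seg_integral_near_value[OF form inW(2)])
    fix y assume "y \<in> closed_segment (x + h) (x + k)"
    then have "norm (\<omega> y k - \<omega> x k) \<le> e" "norm (\<omega> y h - \<omega> x h) \<le> e"
      by (intro on(3) on(2); simp)+
    moreover have eq: "\<omega> y (x + k - (x + h)) - (\<omega> x k - \<omega> x h) = (\<omega> y k - \<omega> x k) - (\<omega> y h - \<omega> x h)"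
      by (simp add: linear_diff[OF linear_form])
    ultimately show "norm (\<omega> y (x + k - (x + h)) - (\<omega> x k - \<omega> x h)) \<le> e + e"
      unfolding eq using norm_triangle_ineq4[of "\<omega> y k - \<omega> x k" "\<omega> y h - \<omega> x h"] by linarith
  qed
  have "triangle_integral x h k = (seg_integral \<omega> x (x + h) - \<omega> x h) +
    (seg_integral \<omega> (x + h) (x + k) - (\<omega> x k - \<omega> x h)) + (seg_integral \<omega> (x + k) x - - \<omega> x k)"
    by (simp add: triangle_integral_def)
  also have "norm \<dots> \<le> e + (e + e) + e" by (intro norm_triangle_mono 1 2 3)
  finally show ?thesis by simp
qed

text \<open>
  Passing to the two halves doubles the number of triangles and halves their sizes, while the bound for a single triangle
  is its size times the oscillation of the form. So the total stays of the order of the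
  oscillation, which is arbitrarily small on small triangles.
\<close>

lemma triangle_integral_zero:
  assumes sub: "\<And>s t. 0 \<le> s \<Longrightarrow> 0 \<le> t \<Longrightarrow> s + t \<le> 1 \<Longrightarrow> x + s *\<^sub>R h + t *\<^sub>R k \<in> W"
  shows "triangle_integral x h k = 0"
proof -
  define K where "K = (\<lambda>(s, t). x + s *\<^sub>R h + t *\<^sub>R k) ` {(s, t). 0 \<le> s \<and> 0 \<le> t \<and> s + t \<le> (1 :: real)}"
  have "compact {(s, t). 0 \<le> s \<and> 0 \<le> t \<and> s + t \<le> (1 :: real)}"
  proof -
    have "{(s, t). 0 \<le> s \<and> 0 \<le> t \<and> s + t \<le> (1 :: real)} = cbox (0, 0) (1, 1) \<inter> {p. fst p + snd p \<le> 1}"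
      by (auto simp: in_rect_iff)
    moreover have "closed {p :: real \<times> real. fst p + snd p \<le> 1}"
      by (intro closed_Collect_le continuous_intros)
    ultimately show ?thesis by (simp add: compact_Int_closed)
  qed
  then have K: "compact K" unfolding K_def
    by (intro compact_continuous_image) (auto intro!: continuous_intros simp: case_prod_beta)
  have KW: "K \<subseteq> W" using sub by (auto simp: K_def)
  have "norm (triangle_integral x h k) \<le> 4 * e" if "e > 0" for e
  proof -
    have u: "\<exists>d>0. \<forall>y\<in>K. \<forall>z\<in>K. dist y z < d \<longrightarrow> norm (\<omega> y v - \<omega> z v) < e" for v
    proof -
      have "continuous_on K (\<lambda>y. \<omega> y v)"
        using KW by (intro continuous_form_comp[OF form]) auto
      then have "uniformly_continuous_on K (\<lambda>y. \<omega> y v)" using K by (rule compact_uniformly_continuous)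
      then show ?thesis using \<open>e > 0\<close> unfolding uniformly_continuous_on_def dist_norm by (metis norm_minus_commute)
    qed
    obtain dh where dh: "dh > 0" "\<And>y z. y \<in> K \<Longrightarrow> z \<in> K \<Longrightarrow> dist y z < dh \<Longrightarrow> norm (\<omega> y h - \<omega> z h) < e" using u[of h] by blast
    obtain dk where dk: "dk > 0" "\<And>y z. y \<in> K \<Longrightarrow> z \<in> K \<Longrightarrow> dist y z < dk \<Longrightarrow> norm (\<omega> y k - \<omega> z k) < e" using u[of k] by blast
    define c0 where "c0 = min dh dk / (norm h + norm k + 1)"
    have nn: "norm h + norm k + 1 > 0" by (simp add: add_nonneg_pos)
    have c0: "c0 > 0" using dh(1) dk(1) nn by (simp add: c0_def)
    have ind: "norm (triangle_integral y (c *\<^sub>R h) (c *\<^sub>R k)) \<le> 4 * (c * e)"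
      if "0 \<le> c" "c \<le> c0 * 2 ^ i" "\<And>s t. 0 \<le> s \<Longrightarrow> 0 \<le> t \<Longrightarrow> s + t \<le> 1 \<Longrightarrow> y + s *\<^sub>R (c *\<^sub>R h) + t *\<^sub>R (c *\<^sub>R k) \<in> K" for i y c
      using that
    proof (induction i arbitrary: y c)
      case 0
      have y: "y \<in> K" using 0(3)[of 0 0] by simp
      have d: "dist (y + s *\<^sub>R (c *\<^sub>R h) + t *\<^sub>R (c *\<^sub>R k)) y < min dh dk" if "0 \<le> s" "0 \<le> t" "s + t \<le> 1" for s t
      proof -
        have "dist (y + s *\<^sub>R (c *\<^sub>R h) + t *\<^sub>R (c *\<^sub>R k)) y = norm (s *\<^sub>R (c *\<^sub>R h) + t *\<^sub>R (c *\<^sub>R k))"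
          by (simp add: dist_norm)
        also have "\<dots> \<le> s * c * norm h + t * c * norm k"
          using that 0(1) by (intro order_trans[OF norm_triangle_ineq]) simp
        also have "\<dots> \<le> 1 * c * norm h + 1 * c * norm k"
          using that 0(1) by (intro add_mono mult_right_mono) auto
        also have "\<dots> = c * (norm h + norm k)" by (simp add: algebra_simps)
        also have "\<dots> \<le> c0 * (norm h + norm k)" using 0(2) by (intro mult_right_mono) auto
        also have "\<dots> < c0 * (norm h + norm k + 1)" using c0 by simp
        also have "\<dots> = min dh dk" using nn by (simp add: c0_def)
        finally show ?thesis .
      qed
      show ?case
      proof (rule triangle_integral_small)
        fix s t :: real assume st: "0 \<le> s" "0 \<le> t" "s + t \<le> 1"
        let ?z = "y + s *\<^sub>R (c *\<^sub>R h) + t *\<^sub>R (c *\<^sub>R k)"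
        have z: "?z \<in> K" by (rule 0(3)[OF st])
        then show "?z \<in> W" using KW by blast
        have "norm (\<omega> ?z h - \<omega> y h) \<le> e" using dh(2)[OF z y] d[OF st] by simp
        then show "norm (\<omega> ?z (c *\<^sub>R h) - \<omega> y (c *\<^sub>R h)) \<le> c * e"
          using 0(1) by (simp add: linear_scale[OF linear_form] mult_left_mono flip: scaleR_diff_right)
        have "norm (\<omega> ?z k - \<omega> y k) \<le> e" using dk(2)[OF z y] d[OF st] by simp
        then show "norm (\<omega> ?z (c *\<^sub>R k) - \<omega> y (c *\<^sub>R k)) \<le> c * e"
          using 0(1) by (simp add: linear_scale[OF linear_form] mult_left_mono flip: scaleR_diff_right)
      qed
    next
      case (Suc i)
      let ?c = "c / 2"
      have half: "(1/2) *\<^sub>R (c *\<^sub>R v) = ?c *\<^sub>R v" for v :: 'e by simp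
      have q: "norm (triangle_integral (y + ?c *\<^sub>R h) (?c *\<^sub>R h) (?c *\<^sub>R k)) \<le> 4 * (?c * e)"
      proof (rule Suc.IH)
        fix s t :: real assume st: "0 \<le> s" "0 \<le> t" "s + t \<le> 1"
        have "y + ?c *\<^sub>R h + s *\<^sub>R (?c *\<^sub>R h) + t *\<^sub>R (?c *\<^sub>R k) = y + ((1 + s) / 2) *\<^sub>R (c *\<^sub>R h) + (t / 2) *\<^sub>R (c *\<^sub>R k)"
          by (simp add: algebra_simps add_divide_distrib)
        also have "\<dots> \<in> K" using st by (intro Suc.prems) (auto simp: field_simps)
        finally show "y + ?c *\<^sub>R h + s *\<^sub>R (?c *\<^sub>R h) + t *\<^sub>R (?c *\<^sub>R k) \<in> K" .
      qed (use Suc.prems in auto)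
      have q': "norm (triangle_integral (y + ?c *\<^sub>R k) (?c *\<^sub>R h) (?c *\<^sub>R k)) \<le> 4 * (?c * e)"
      proof (rule Suc.IH)
        fix s t :: real assume st: "0 \<le> s" "0 \<le> t" "s + t \<le> 1"
        have "y + ?c *\<^sub>R k + s *\<^sub>R (?c *\<^sub>R h) + t *\<^sub>R (?c *\<^sub>R k) = y + (s / 2) *\<^sub>R (c *\<^sub>R h) + ((1 + t) / 2) *\<^sub>R (c *\<^sub>R k)"
          by (simp add: algebra_simps add_divide_distrib)
        also have "\<dots> \<in> K" using st by (intro Suc.prems) (auto simp: field_simps)
        finally show "y + ?c *\<^sub>R k + s *\<^sub>R (?c *\<^sub>R h) + t *\<^sub>R (?c *\<^sub>R k) \<in> K" .
      qed (use Suc.prems in auto)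
      have "triangle_integral y (c *\<^sub>R h) (c *\<^sub>R k) =
        triangle_integral (y + ?c *\<^sub>R h) (?c *\<^sub>R h) (?c *\<^sub>R k) + triangle_integral (y + ?c *\<^sub>R k) (?c *\<^sub>R h) (?c *\<^sub>R k)"
        using triangle_integral_halve[of y "c *\<^sub>R h" "c *\<^sub>R k"] Suc.prems(3) KW unfolding half by blast
      also have "norm \<dots> \<le> 4 * (?c * e) + 4 * (?c * e)" by (intro norm_triangle_mono q q')
      finally show ?case by simp
    qed
    obtain i :: nat where "1 / c0 < 2 ^ i" using real_arch_pow[of 2 "1 / c0"] by auto
    then have "1 \<le> c0 * 2 ^ i" using c0 by (simp add: field_simps)
    moreover have "x + s *\<^sub>R (1 *\<^sub>R h) + t *\<^sub>R (1 *\<^sub>R k) \<in> K" if "0 \<le> s" "0 \<le> t" "s + t \<le> 1" for s t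
      unfolding K_def using that by (intro image_eqI[of _ _ "(s, t)"]) auto
    ultimately show ?thesis using ind[of 1 i x] by simp
  qed
  then have b: "norm (triangle_integral x h k) \<le> 4 * e" if "e > 0" for e using that by blast
  have "norm (triangle_integral x h k) \<le> 0"
  proof (rule field_le_epsilon)
    fix e :: real assume "0 < e"
    then show "norm (triangle_integral x h k) \<le> 0 + e" using b[of "e / 4"] by simp
  qed
  then show ?thesis by simp
qed

lemma seg_integral_triangle:
  assumes "convex C" "C \<subseteq> W" "x \<in> C" "y \<in> C" "z \<in> C"
  shows "seg_integral \<omega> x y + seg_integral \<omega> y z = seg_integral \<omega> x z"
proof -
  have "triangle_integral x (y - x) (z - x) = 0"
  proof (rule triangle_integral_zero)
    fix s t :: real assume st: "0 \<le> s" "0 \<le> t" "s + t \<le> 1"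
    have "x + s *\<^sub>R (y - x) + t *\<^sub>R (z - x) = (1 - s - t) *\<^sub>R x + s *\<^sub>R y + t *\<^sub>R z"
      by (simp add: algebra_simps)
    also have "\<dots> \<in> convex hull {x, y, z}"
      unfolding convex_hull_3
      by (rule CollectI, rule exI[of _ "1 - s - t"], rule exI[of _ s], rule exI[of _ t]) (use st in simp)
    also have "\<dots> \<subseteq> C" by (rule hull_minimal) (use assms in auto)
    finally show "x + s *\<^sub>R (y - x) + t *\<^sub>R (z - x) \<in> W" using assms(2) by blast
  qed
  moreover have "closed_segment x z \<subseteq> W" using closed_segment_subset[of x C z] assms by blast
  ultimately show ?thesis
    using seg_integral_reverse[OF form, of x z] by (simp add: triangle_integral_def)
qed

end

section \<open>Homotopy invariance\<close>

context closed_form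
begin

text \<open>
  Sums over inscribed polygons with equidistant parameters. They make sense for paths that are merely
  continuous, as the intermediate paths of a homotopy are.
\<close>

definition step_sum :: "(real \<Rightarrow> 'e) \<Rightarrow> nat \<Rightarrow> 'v" where
  "step_sum p N = (\<Sum>i<N. seg_integral \<omega> (p (real i / real N)) (p (real (Suc i) / real N)))"

text \<open>
  In a fine grid on the parameter square of the homotopy every cell is mapped into a ball in which
  triangles integrate to zero. So the sums for two consecutive rows differ by a telescoping sum, which
  vanishes because the rows are loops.
\<close>

lemma step_sum_homotopic:
  assumes "homotopic_loops W p q"
  shows "\<forall>\<^sub>F N in sequentially. step_sum p N = step_sum q N"
proof -
  obtain h where ch: "continuous_on ({0..1::real} \<times> {0..1::real}) h" and hW: "h ` ({0..1} \<times> {0..1}) \<subseteq> W"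
    and h0: "\<And>x. x \<in> {0..1} \<Longrightarrow> h (0, x) = p x" and h1: "\<And>x. x \<in> {0..1} \<Longrightarrow> h (1, x) = q x"
    and loop: "\<And>t. t \<in> {0..1} \<Longrightarrow> h (t, 1) = h (t, 0)"
  proof -
    obtain h where h: "continuous_on ({0..1::real} \<times> {0..1::real}) h" "h \<in> ({0..1} \<times> {0..1}) \<rightarrow> W"
      "\<forall>x\<in>{0..1}. h (0, x) = p x" "\<forall>x\<in>{0..1}. h (1, x) = q x"
      "\<forall>t\<in>{0..1}. pathfinish (h \<circ> Pair t) = pathstart (h \<circ> Pair t)"
      using assms unfolding homotopic_loops by blast
    show thesis
    proof (rule that[OF h(1)])
      show "h ` ({0..1} \<times> {0..1}) \<subseteq> W" using h(2) by (rule funcset_image)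
      show "h (t, 1) = h (t, 0)" if "t \<in> {0..1}" for t
        using bspec[OF h(5) that] by (simp add: pathfinish_def pathstart_def)
    qed (rule bspec[OF h(3)] bspec[OF h(4)], assumption)+
  qed
  let ?Q = "{0..1::real} \<times> {0..1::real}"
  have cQ: "compact ?Q" by (intro compact_Times) auto
  obtain r where r: "r > 0" "\<And>z. z \<in> h ` ?Q \<Longrightarrow> ball z r \<subseteq> W"
    using Heine_Borel_lemma[OF compact_continuous_image[OF ch cQ], of "{W}"] hW open_W by auto
  have "uniformly_continuous_on ?Q h" by (rule compact_uniformly_continuous[OF ch cQ])
  then obtain d where d: "d > 0" "\<And>x y. x \<in> ?Q \<Longrightarrow> y \<in> ?Q \<Longrightarrow> dist y x < d \<Longrightarrow> dist (h y) (h x) < r"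
    using r(1) unfolding uniformly_continuous_on_def by meson
  have "\<forall>\<^sub>F N in sequentially. 2 / real N < d"
    using lim_const_over_n[of "2 :: real"] d(1) by (intro order_tendstoD(2)) auto
  then show ?thesis using eventually_gt_at_top[of 0]
  proof eventually_elim
    case (elim N)
    define A where "A a i = h (real a / real N, real i / real N)" for a i
    have inQ: "(real a / real N, real i / real N) \<in> ?Q" if "a \<le> N" "i \<le> N" for a i
      using that elim by simp
    have near: "A b j \<in> ball (A a i) r" if "a \<le> N" "i \<le> N" "b \<le> N" "j \<le> N" "b \<in> {a, Suc a}" "j \<in> {i, Suc i}" for a i b j
    proof -
      have "dist (real b / real N, real j / real N) (real a / real N, real i / real N)
          \<le> \<bar>real b / real N - real a / real N\<bar> + \<bar>real j / real N - real i / real N\<bar>"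
        using dist_le_abs[of "(real b / real N, real j / real N)" "(real a / real N, real i / real N)"] by simp
      also have "\<dots> = (\<bar>real b - real a\<bar> + \<bar>real j - real i\<bar>) / real N"
        by (simp add: add_divide_distrib flip: diff_divide_distrib)
      also have "\<dots> \<le> 2 / real N"
        using that by (intro divide_right_mono) auto
      also have "\<dots> < d" by (rule elim(1))
      finally show ?thesis
        using d(2)[OF inQ[OF that(1,2)] inQ[OF that(3,4)]] by (simp add: A_def dist_commute)
    qed
    have row: "(\<Sum>i<N. seg_integral \<omega> (A a i) (A a (Suc i))) = (\<Sum>i<N. seg_integral \<omega> (A (Suc a) i) (A (Suc a) (Suc i)))"
      if a: "Suc a \<le> N" for a
    proof -
      have "seg_integral \<omega> (A a i) (A a (Suc i)) - seg_integral \<omega> (A (Suc a) i) (A (Suc a) (Suc i)) =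
          seg_integral \<omega> (A a i) (A (Suc a) i) - seg_integral \<omega> (A a (Suc i)) (A (Suc a) (Suc i))" if i: "i < N" for i
      proof -
        let ?B = "ball (A a i) r"
        have W: "?B \<subseteq> W" using r(2)[of "A a i"] inQ[of a i] a i by (auto simp: A_def)
        have pts: "A a i \<in> ?B" "A a (Suc i) \<in> ?B" "A (Suc a) i \<in> ?B" "A (Suc a) (Suc i) \<in> ?B"
          using a i r(1) by (auto intro: near simp del: mem_ball)
        show ?thesis
          using seg_integral_triangle[OF convex_ball W pts(1,2,4)] seg_integral_triangle[OF convex_ball W pts(1,3,4)]
          by (simp add: algebra_simps)
      qed
      then have "(\<Sum>i<N. seg_integral \<omega> (A a i) (A a (Suc i)) - seg_integral \<omega> (A (Suc a) i) (A (Suc a) (Suc i))) =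
          (\<Sum>i<N. seg_integral \<omega> (A a i) (A (Suc a) i) - seg_integral \<omega> (A a (Suc i)) (A (Suc a) (Suc i)))"
        by (intro sum.cong) auto
      also have "\<dots> = seg_integral \<omega> (A a 0) (A (Suc a) 0) - seg_integral \<omega> (A a N) (A (Suc a) N)"
        by (rule sum_lessThan_telescope')
      also have "\<dots> = 0"
      proof -
        have "A b N = A b 0" if "b \<le> N" for b
          using that elim loop[of "real b / real N"] by (simp add: A_def)
        then show ?thesis using a by simp
      qed
      finally show ?thesis by (simp add: sum_subtractf)
    qed
    have "(\<Sum>i<N. seg_integral \<omega> (A a i) (A a (Suc i))) = (\<Sum>i<N. seg_integral \<omega> (A 0 i) (A 0 (Suc i)))"
      if "a \<le> N" for a
      using that by (induction a) (simp_all add: row[symmetric])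
    from this[of N] have "(\<Sum>i<N. seg_integral \<omega> (A N i) (A N (Suc i))) = (\<Sum>i<N. seg_integral \<omega> (A 0 i) (A 0 (Suc i)))"
      by simp
    moreover have "A 0 i = p (real i / real N)" "A N i = q (real i / real N)" if "i \<le> N" for i
      using that elim h0[of "real i / real N"] h1[of "real i / real N"] by (simp_all add: A_def)
    ultimately show ?case unfolding step_sum_def by simp
  qed
qed

text \<open>
  On a short step the form is nearly constant, so the error is at most \<open>e\<close> times the length of the
  step, and these lengths add up to at most \<open>L\<close>.
\<close>

lemma riemann_sum_minus_step_sum:
  assumes p: "path p" "path_image p \<subseteq> W"
    and var: "\<And>N. (\<Sum>i<N. norm (p (real (Suc i) / real N) - p (real i / real N))) \<le> L"
  shows "(\<lambda>N. (\<Sum>i<N. \<omega> (p (real i / real N)) (p (real (Suc i) / real N) - p (real i / real N))) - step_sum p N)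
    \<longlonglongrightarrow> 0"
proof -
  let ?P = "path_image p"
  have cP: "compact ?P" by (rule compact_path_image[OF p(1)])
  obtain r where r: "r > 0" "\<And>z. z \<in> ?P \<Longrightarrow> ball z r \<subseteq> W"
    using Heine_Borel_lemma[OF cP, of "{W}"] p(2) open_W by auto
  define K where "K = {x + y | x y. x \<in> ?P \<and> y \<in> cball 0 (r/2)}"
  have K: "compact K" unfolding K_def by (rule compact_sums[OF cP compact_cball])
  have KW: "K \<subseteq> W"
  proof
    fix z assume "z \<in> K"
    then obtain x y where "z = x + y" "x \<in> ?P" "norm y \<le> r/2" by (auto simp: K_def)
    then have "z \<in> ball x r" using r(1) by (simp add: dist_norm)
    then show "z \<in> W" using r(2)[OF \<open>x \<in> ?P\<close>] by blast
  qed
  have near_K: "z \<in> K" if "x \<in> ?P" "dist x z \<le> r/2" for x z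
  proof -
    have "z = x + (z - x)" "z - x \<in> cball 0 (r/2)" using that by (auto simp: dist_norm norm_minus_commute)
    then show ?thesis using that(1) unfolding K_def by blast
  qed
  have "continuous_on (K \<times> cball 0 1) (\<lambda>z. \<omega> (fst z) (snd z))"
    using form KW unfolding continuous_form_def by (blast intro: continuous_on_subset)
  then have uc: "uniformly_continuous_on (K \<times> cball 0 1) (\<lambda>z. \<omega> (fst z) (snd z))"
    using K by (intro compact_uniformly_continuous compact_Times) auto
  have L0: "L \<ge> 0" using var[of 0] by simp
  show ?thesis
  proof (rule LIMSEQ_I)
    fix \<epsilon> :: real assume "\<epsilon> > 0"
    define e where "e = \<epsilon> / (L + 1)"
    have e: "e > 0" "e * L < \<epsilon>" using \<open>\<epsilon> > 0\<close> L0 by (auto simp: e_def field_simps)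
    obtain d where d: "d > 0" "\<And>x y v. x \<in> K \<Longrightarrow> y \<in> K \<Longrightarrow> norm v \<le> 1 \<Longrightarrow> dist y x < d \<Longrightarrow> norm (\<omega> y v - \<omega> x v) < e"
    proof -
      obtain d where d: "d > 0" "\<And>x y. x \<in> K \<times> cball 0 1 \<Longrightarrow> y \<in> K \<times> cball 0 1 \<Longrightarrow> dist y x < d \<Longrightarrow>
          dist (\<omega> (fst y) (snd y)) (\<omega> (fst x) (snd x)) < e"
        using uc e(1) unfolding uniformly_continuous_on_def by meson
      show thesis
      proof (rule that[OF d(1)])
        fix x y v assume "x \<in> K" "y \<in> K" "norm (v :: 'e) \<le> 1" "dist y x < d"
        then show "norm (\<omega> y v - \<omega> x v) < e"
          using d(2)[of "(x, v)" "(y, v)"] by (simp add: dist_norm dist_Pair_Pair)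
      qed
    qed
    have scaled: "norm (\<omega> y v - \<omega> x v) \<le> e * norm v" if "x \<in> K" "y \<in> K" "dist y x < d" for x y v
    proof (cases "v = 0")
      case True
      then show ?thesis by (simp add: linear_0[OF linear_form])
    next
      case False
      let ?u = "v /\<^sub>R norm v"
      have "\<omega> y v - \<omega> x v = norm v *\<^sub>R (\<omega> y ?u - \<omega> x ?u)"
        using False by (simp add: linear_scale[OF linear_form] scaleR_diff_right)
      then have "norm (\<omega> y v - \<omega> x v) = norm v * norm (\<omega> y ?u - \<omega> x ?u)" by simp
      also have "\<dots> \<le> norm v * e"
        using d(2)[OF that(1,2), of ?u] that(3) False by (intro mult_left_mono) (auto intro: less_imp_le)
      finally show ?thesis by (simp add: mult.commute)
    qed
    have "uniformly_continuous_on {0..1} p"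
      using p(1) unfolding path_def by (intro compact_uniformly_continuous) auto
    then obtain \<delta> where \<delta>: "\<delta> > 0" "\<And>s t. s \<in> {0..1} \<Longrightarrow> t \<in> {0..1} \<Longrightarrow> dist t s < \<delta> \<Longrightarrow> dist (p t) (p s) < min d (r/2)"
      using d(1) r(1) unfolding uniformly_continuous_on_def by (metis half_gt_zero min_less_iff_conj)
    have "\<forall>\<^sub>F N in sequentially. 1 / real N < \<delta>"
      using lim_const_over_n[of "1 :: real"] \<delta>(1) by (intro order_tendstoD(2)) auto
    then have "\<forall>\<^sub>F N in sequentially. norm ((\<Sum>i<N. \<omega> (p (real i / real N)) (p (real (Suc i) / real N) - p (real i / real N))) - step_sum p N - 0) < \<epsilon>"
      using eventually_gt_at_top[of 0]
    proof eventually_elim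
      case (elim N)
      have each: "norm (\<omega> (p (real i / real N)) (p (real (Suc i) / real N) - p (real i / real N)) -
          seg_integral \<omega> (p (real i / real N)) (p (real (Suc i) / real N))) \<le> e * norm (p (real (Suc i) / real N) - p (real i / real N))"
        if i: "i < N" for i
      proof -
        let ?s = "real i / real N" and ?t = "real (Suc i) / real N"
        have st: "?s \<in> {0..1}" "?t \<in> {0..1}" using i by auto
        have "dist ?t ?s = 1 / real N" by (simp add: dist_real_def flip: diff_divide_distrib)
        then have dd: "dist (p ?t) (p ?s) < min d (r/2)" using elim(1) by (intro \<delta>(2) st) simp
        have sP: "p ?s \<in> ?P" using st by (auto simp: path_image_def)
        have seg: "dist (p ?s) z < min d (r/2)" if "z \<in> closed_segment (p ?s) (p ?t)" for z
          using that dd segment_bound(1)[of z "p ?s" "p ?t"] by (simp add: dist_norm norm_minus_commute)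
        have zK: "z \<in> K" if "z \<in> closed_segment (p ?s) (p ?t)" for z
          using seg[OF that] by (intro near_K[OF sP]) simp
        show ?thesis
          unfolding norm_minus_commute[of "\<omega> _ _"]
        proof (rule seg_integral_near_value[OF form])
          show "closed_segment (p ?s) (p ?t) \<subseteq> W" using zK KW by blast
          fix z assume z: "z \<in> closed_segment (p ?s) (p ?t)"
          show "norm (\<omega> z (p ?t - p ?s) - \<omega> (p ?s) (p ?t - p ?s)) \<le> e * norm (p ?t - p ?s)"
            using seg[OF z] by (intro scaled zK[OF z] zK) (auto simp: dist_commute)
        qed
      qed
      have "norm ((\<Sum>i<N. \<omega> (p (real i / real N)) (p (real (Suc i) / real N) - p (real i / real N))) - step_sum p N)
          \<le> (\<Sum>i<N. e * norm (p (real (Suc i) / real N) - p (real i / real N)))"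
        unfolding step_sum_def sum_subtractf[symmetric] by (rule sum_norm_le) (use each in auto)
      also have "\<dots> = e * (\<Sum>i<N. norm (p (real (Suc i) / real N) - p (real i / real N)))"
        by (simp add: sum_distrib_left)
      also have "\<dots> \<le> e * L" using e(1) var[of N] by (intro mult_left_mono) auto
      also have "\<dots> < \<epsilon>" by (rule e(2))
      finally show ?case by simp
    qed
    then show "\<exists>N0. \<forall>N\<ge>N0. norm ((\<Sum>i<N. \<omega> (p (real i / real N)) (p (real (Suc i) / real N) - p (real i / real N))) - step_sum p N - 0) < \<epsilon>"
      by (simp only: eventually_sequentially)
  qed
qed

end

section \<open>Line integrals along rectifiable paths\<close>

text \<open>
  Unlike the increment over an interval, the one over an intersection of two intervals needs a value
  for the empty set; zero makes it additive.
\<close>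

definition increment :: "(real \<Rightarrow> real) \<Rightarrow> real set \<Rightarrow> real" where
  "increment \<alpha> K = (if K = {} then 0 else \<alpha> (Sup K) - \<alpha> (Inf K))"

lemma increment_interval: "increment \<alpha> {a..b} = (if a \<le> b then \<alpha> b - \<alpha> a else 0)"
  by (simp add: increment_def)

lemma increment_degenerate: "b \<le> a \<Longrightarrow> increment \<alpha> {a..b} = 0"
  by (auto simp: increment_interval)

lemma increment_split:
  assumes q: "q tagged_division_of {0..1}" and K: "{k..l} \<subseteq> {0..1}"
  shows "(\<Sum>(s, J)\<in>q. increment \<alpha> (J \<inter> {k..l})) = increment \<alpha> {k..l}"
proof -
  interpret operative_real plus 0 "\<lambda>J. increment \<alpha> (J \<inter> {k..l})"
    rewrites "comm_monoid_set.F (+) 0 = sum"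
  proof -
    show "operative_real (+) 0 (\<lambda>J. increment \<alpha> (J \<inter> {k..l}))"
    proof
      fix a b :: real assume "b \<le> a"
      then show "increment \<alpha> ({a..b} \<inter> {k..l}) = 0"
        unfolding Int_atLeastAtMost by (intro increment_degenerate) linarith
    next
      fix a b c :: real assume "a < c" "c < b"
      then show "increment \<alpha> ({a..c} \<inter> {k..l}) + increment \<alpha> ({c..b} \<inter> {k..l}) = increment \<alpha> ({a..b} \<inter> {k..l})"
        by (auto simp: increment_interval max_def min_def)
    qed
    show "comm_monoid_set.F (+) 0 = sum" by (simp add: sum_def)
  qed
  have "(\<Sum>(s, J)\<in>q. increment \<alpha> (J \<inter> {k..l})) = increment \<alpha> ({0..1} \<inter> {k..l})"
    using q by (intro tagged_division) (simp only: box_real)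
  moreover have "{0..1} \<inter> {k..l} = {k..l}" using K by blast
  ultimately show ?thesis by (simp only:)
qed

text \<open>The pieces of a common refinement are indexed by pairs; pairs that give the same piece give a
  piece without interior, which does not contribute.\<close>

lemma sum_refinement_le:
  assumes p: "p tagged_division_of {0..1}" and q: "q tagged_division_of {0..1}"
    and var: "\<And>d. d division_of {0..1} \<Longrightarrow> (\<Sum>K\<in>d. \<bar>\<alpha> (Sup K) - \<alpha> (Inf K)\<bar>) \<le> L"
  shows "(\<Sum>x\<in>p. \<Sum>y\<in>q. \<bar>increment \<alpha> (snd x \<inter> snd y)\<bar>) \<le> L"
proof -
  let ?f = "\<lambda>z. snd (fst z) \<inter> snd (snd z)"
  define D where "D = {k1 \<inter> k2 |k1 k2. k1 \<in> snd ` p \<and> k2 \<in> snd ` q \<and> k1 \<inter> k2 \<noteq> {}}"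
  have D: "D division_of {0..1}"
    using division_inter[OF division_of_tagged_division[OF p] division_of_tagged_division[OF q]] by (simp add: D_def)
  have fin: "finite (p \<times> q)" using p q by blast
  have collide: "\<bar>increment \<alpha> (?f z)\<bar> = 0" if z: "z \<in> p \<times> q" "z' \<in> p \<times> q" "z \<noteq> z'" "?f z = ?f z'" for z z'
  proof -
    obtain s K where 1: "fst z = (s, K)" by (cases "fst z")
    obtain t J where 2: "snd z = (t, J)" by (cases "snd z")
    obtain s' K' where 3: "fst z' = (s', K')" by (cases "fst z'")
    obtain t' J' where 4: "snd z' = (t', J')" by (cases "snd z'")
    have zz: "z = ((s, K), (t, J))" "z' = ((s', K'), (t', J'))"
      by (rule prod_eqI; simp only: 1 2 3 4 fst_conv snd_conv)+
    have mem: "(s, K) \<in> p" "(t, J) \<in> q" "(s', K') \<in> p" "(t', J') \<in> q" using z(1,2) by (simp_all add: zz)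
    have "(s, K) \<noteq> (s', K') \<or> (t, J) \<noteq> (t', J')" using z(3) by (auto simp: zz)
    then have disj: "interior K \<inter> interior K' = {} \<or> interior J \<inter> interior J' = {}"
      using tagged_division_ofD(5)[OF p mem(1,3)] tagged_division_ofD(5)[OF q mem(2,4)] by blast
    have eq: "K \<inter> J = K' \<inter> J'" using z(4) by (simp add: zz)
    have "interior (K \<inter> J) \<subseteq> interior K" "interior (K \<inter> J) \<subseteq> interior J"
      by (intro interior_mono; simp)+
    moreover have "interior (K \<inter> J) \<subseteq> interior K'" "interior (K \<inter> J) \<subseteq> interior J'"
      unfolding eq by (intro interior_mono; simp)+
    ultimately have i: "interior (K \<inter> J) = {}" using disj by blast
    obtain a b where K: "K = {a..b}" using tagged_division_ofD(4)[OF p mem(1)] by auto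
    obtain c d where J: "J = {c..d}" using tagged_division_ofD(4)[OF q mem(2)] by auto
    have KJ: "K \<inter> J = {max a c..min b d}" unfolding K J by (rule Int_atLeastAtMost)
    have "{max a c<..<min b d} = {}" using i unfolding KJ by (simp only: interior_atLeastAtMost_real)
    then have "min b d \<le> max a c" by (simp only: greaterThanLessThan_empty_iff)
    then show ?thesis unfolding zz by (simp only: KJ increment_degenerate fst_conv snd_conv abs_zero)
  qed
  have "(\<Sum>x\<in>p. \<Sum>y\<in>q. \<bar>increment \<alpha> (snd x \<inter> snd y)\<bar>) = (\<Sum>z\<in>p \<times> q. \<bar>increment \<alpha> (?f z)\<bar>)"
    by (simp add: sum.cartesian_product case_prod_beta)
  also have "\<dots> = (\<Sum>X\<in>?f ` (p \<times> q). \<bar>increment \<alpha> X\<bar>)"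
    using sum.reindex_nontrivial[OF fin, of ?f "\<lambda>X. \<bar>increment \<alpha> X\<bar>"] collide by (simp add: o_def)
  also have "\<dots> = (\<Sum>X\<in>D. \<bar>increment \<alpha> X\<bar>)"
  proof (rule sum.mono_neutral_right)
    show "finite (?f ` (p \<times> q))" using fin by simp
    show "D \<subseteq> ?f ` (p \<times> q)"
    proof
      fix X assume "X \<in> D"
      then obtain x y where "x \<in> p" "y \<in> q" "X = snd x \<inter> snd y" unfolding D_def by blast
      then show "X \<in> ?f ` (p \<times> q)" by (intro image_eqI[of _ _ "(x, y)"]) simp_all
    qed
    show "\<forall>X\<in>?f ` (p \<times> q) - D. \<bar>increment \<alpha> X\<bar> = 0"
    proof
      fix X assume X: "X \<in> ?f ` (p \<times> q) - D"
      then obtain x y where "x \<in> p" "y \<in> q" "X = snd x \<inter> snd y" by auto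
      then have "X = {}" using X unfolding D_def by blast
      then show "\<bar>increment \<alpha> X\<bar> = 0" by (simp add: increment_def)
    qed
  qed
  also have "\<dots> = (\<Sum>K\<in>D. \<bar>\<alpha> (Sup K) - \<alpha> (Inf K)\<bar>)"
    by (intro sum.cong) (auto simp: increment_def D_def)
  also have "\<dots> \<le> L" by (rule var[OF D])
  finally show ?thesis .
qed

definition stieltjes_sum :: "(real \<Rightarrow> real) \<Rightarrow> (real \<Rightarrow> real) \<Rightarrow> (real \<times> real set) set \<Rightarrow> real" where
  "stieltjes_sum u \<alpha> p = (\<Sum>(t, K)\<in>p. u t * (\<alpha> (Sup K) - \<alpha> (Inf K)))"

lemma stieltjes_sum_refine:
  assumes p: "p tagged_division_of {0..1}" and q: "q tagged_division_of {0..1}"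
  shows "stieltjes_sum u \<alpha> p = (\<Sum>x\<in>p. \<Sum>y\<in>q. u (fst x) * increment \<alpha> (snd x \<inter> snd y))"
  unfolding stieltjes_sum_def case_prod_beta
proof (rule sum.cong[OF refl])
  fix x assume x: "x \<in> p"
  obtain t K where tK: "x = (t, K)" by (cases x)
  obtain k l where kl: "K = {k..l}" using tagged_division_ofD(4)[OF p, of t K] x tK by auto
  have sub: "{k..l} \<subseteq> {0..1}" "t \<in> {k..l}" using tagged_division_ofD(2,3)[OF p, of t K] x tK kl by auto
  have "(\<Sum>y\<in>q. increment \<alpha> (snd y \<inter> {k..l})) = increment \<alpha> {k..l}"
    using increment_split[OF q sub(1), of \<alpha>] by (simp add: case_prod_beta)
  then have "(\<Sum>y\<in>q. increment \<alpha> (snd x \<inter> snd y)) = \<alpha> (Sup K) - \<alpha> (Inf K)"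
    using sub(2) by (simp add: tK kl Int_commute increment_def)
  then show "u (fst x) * (\<alpha> (Sup (snd x)) - \<alpha> (Inf (snd x))) = (\<Sum>y\<in>q. u (fst x) * increment \<alpha> (snd x \<inter> snd y))"
    by (simp add: tK sum_distrib_left[symmetric])
qed

text \<open>
  On a common refinement the two sums differ only in the points at which \<open>u\<close> is evaluated.
\<close>

lemma stieltjes_sum_close:
  assumes p: "p tagged_division_of {0..1}" "(\<lambda>t. ball t \<delta>) fine p"
    and q: "q tagged_division_of {0..1}" "(\<lambda>t. ball t \<delta>) fine q"
    and var: "\<And>d. d division_of {0..1} \<Longrightarrow> (\<Sum>K\<in>d. \<bar>\<alpha> (Sup K) - \<alpha> (Inf K)\<bar>) \<le> L"
    and u: "\<And>s t. s \<in> {0..1} \<Longrightarrow> t \<in> {0..1} \<Longrightarrow> \<bar>s - t\<bar> < 2 * \<delta> \<Longrightarrow> \<bar>u s - u t\<bar> \<le> e" and "e \<ge> 0"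
  shows "\<bar>stieltjes_sum u \<alpha> p - stieltjes_sum u \<alpha> q\<bar> \<le> e * L"
proof -
  have "stieltjes_sum u \<alpha> q = (\<Sum>x\<in>p. \<Sum>y\<in>q. u (fst y) * increment \<alpha> (snd x \<inter> snd y))"
    unfolding stieltjes_sum_refine[OF q(1) p(1)] by (subst sum.swap) (simp add: Int_commute)
  then have "stieltjes_sum u \<alpha> p - stieltjes_sum u \<alpha> q =
      (\<Sum>x\<in>p. \<Sum>y\<in>q. (u (fst x) - u (fst y)) * increment \<alpha> (snd x \<inter> snd y))"
    unfolding stieltjes_sum_refine[OF p(1) q(1)] by (simp add: sum_subtractf[symmetric] left_diff_distrib)
  also have "\<bar>\<dots>\<bar> \<le> (\<Sum>x\<in>p. \<Sum>y\<in>q. e * \<bar>increment \<alpha> (snd x \<inter> snd y)\<bar>)"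
  proof (rule order_trans[OF sum_abs], rule sum_mono, rule order_trans[OF sum_abs], rule sum_mono)
    fix x y assume xy: "x \<in> p" "y \<in> q"
    obtain s K t J where z: "x = (s, K)" "y = (t, J)" by (metis surj_pair)
    show "\<bar>(u (fst x) - u (fst y)) * increment \<alpha> (snd x \<inter> snd y)\<bar> \<le> e * \<bar>increment \<alpha> (snd x \<inter> snd y)\<bar>"
    proof (cases "K \<inter> J = {}")
      case True
      then show ?thesis by (simp add: z increment_def)
    next
      case False
      then obtain w where w: "w \<in> K" "w \<in> J" by blast
      have "K \<subseteq> ball s \<delta>" "J \<subseteq> ball t \<delta>" using p(2) q(2) xy unfolding fine_def z by blast+
      then have "\<bar>s - w\<bar> < \<delta>" "\<bar>t - w\<bar> < \<delta>" using w by (auto simp: dist_real_def)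
      then have "\<bar>s - t\<bar> < 2 * \<delta>" by linarith
      moreover have "s \<in> {0..1}" "t \<in> {0..1}"
        using tagged_division_ofD(2,3)[OF p(1), of s K] tagged_division_ofD(2,3)[OF q(1), of t J] xy z by blast+
      ultimately have "\<bar>u s - u t\<bar> \<le> e" by (intro u)
      then show ?thesis by (simp add: z abs_mult mult_right_mono)
    qed
  qed
  also have "\<dots> = e * (\<Sum>x\<in>p. \<Sum>y\<in>q. \<bar>increment \<alpha> (snd x \<inter> snd y)\<bar>)"
    by (simp add: sum_distrib_left)
  also have "\<dots> \<le> e * L"
    using sum_refinement_le[OF p(1) q(1) var] \<open>e \<ge> 0\<close> by (intro mult_left_mono)
  finally show ?thesis .
qed

text \<open>
  For \<open>N = 0\<close> this is the empty set, which is not a division of the unit interval.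
\<close>

definition uniform_division :: "nat \<Rightarrow> (real \<times> real set) set" where
  "uniform_division N = (\<lambda>i. (real i / real N, {real i / real N..real (Suc i) / real N})) ` {..<N}"

lemma inj_uniform: "N > 0 \<Longrightarrow> inj_on (\<lambda>i. (real i / real N, {real i / real N..real (Suc i) / real N})) {..<N}"
  by (auto simp: inj_on_def)

lemma tagged_uniform_division:
  assumes "N > 0"
  shows "uniform_division N tagged_division_of {0..1}"
proof (rule tagged_division_ofI)
  let ?I = "\<lambda>i. {real i / real N..real (Suc i) / real N}"
  have mono: "real i / real N \<le> real j / real N" if "i \<le> j" for i j
    using that by (simp add: divide_right_mono)
  show "finite (uniform_division N)" by (simp add: uniform_division_def)
  fix x K assume "(x, K) \<in> uniform_division N"
  then obtain i where i: "i < N" "x = real i / real N" "K = ?I i" by (auto simp: uniform_division_def)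
  show "x \<in> K" using mono[of i "Suc i"] by (simp add: i)
  have "real (Suc i) / real N \<le> 1" "0 \<le> real i / real N" using i(1) by (simp_all add: divide_le_eq_1)
  then show "K \<subseteq> {0..1}" unfolding i(3) atLeastatMost_subset_iff by blast
  show "\<exists>a b. K = cbox a b" by (auto simp: i)
next
  let ?I = "\<lambda>i. {real i / real N..real (Suc i) / real N}"
  have "interior (?I i) \<inter> interior (?I j) = {}" if "i < j" for i j
  proof -
    have "real (Suc i) / real N \<le> real j / real N" using that by (intro divide_right_mono) auto
    then show ?thesis by (auto simp: interior_atLeastAtMost_real)
  qed
  then show "interior K1 \<inter> interior K2 = {}"
    if c: "(x1, K1) \<in> uniform_division N" "(x2, K2) \<in> uniform_division N" "(x1, K1) \<noteq> (x2, K2)" for x1 K1 x2 K2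
  proof -
    obtain i j where "K1 = ?I i" "K2 = ?I j" "i \<noteq> j" using c by (auto simp: uniform_division_def)
    then show ?thesis using \<open>\<And>j i. i < j \<Longrightarrow> interior (?I i) \<inter> interior (?I j) = {}\<close>[of i j]
        \<open>\<And>j i. i < j \<Longrightarrow> interior (?I i) \<inter> interior (?I j) = {}\<close>[of j i] by (metis Int_commute nat_neq_iff)
  qed
  show "\<Union>{K. \<exists>x. (x, K) \<in> uniform_division N} = {0..1}"
  proof
    show "\<Union>{K. \<exists>x. (x, K) \<in> uniform_division N} \<subseteq> {0..1}"
    proof
      fix y assume "y \<in> \<Union>{K. \<exists>x. (x, K) \<in> uniform_division N}"
      then obtain i where i: "i < N" "real i / real N \<le> y" "y \<le> real (Suc i) / real N"
        by (auto simp: uniform_division_def)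
      moreover have "real (Suc i) / real N \<le> 1" using i(1) by (simp add: field_simps)
      moreover have "0 \<le> real i / real N" by simp
      ultimately show "y \<in> {0..1}" unfolding atLeastAtMost_iff by linarith
    qed
    show "{0..1} \<subseteq> \<Union>{K. \<exists>x. (x, K) \<in> uniform_division N}"
    proof
      fix y :: real assume y: "y \<in> {0..1}"
      define i where "i = (if y = 1 then N - 1 else nat \<lfloor>y * real N\<rfloor>)"
      have i: "i < N \<and> real i \<le> y * real N \<and> y * real N \<le> real (Suc i)"
      proof (cases "y = 1")
        case False
        then have "y * real N < real N" "0 \<le> y * real N" using y assms by auto
        then show ?thesis using False unfolding i_def by (auto simp: nat_less_iff floor_less_iff) linarith+
      qed (use assms in \<open>auto simp: i_def\<close>)
      then have "y \<in> ?I i" using assms by (simp add: field_simps)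
      then show "y \<in> \<Union>{K. \<exists>x. (x, K) \<in> uniform_division N}" using i unfolding uniform_division_def by blast
    qed
  qed
qed

lemma fine_uniform_division:
  assumes "1 / real N < \<delta>"
  shows "(\<lambda>t. ball t \<delta>) fine uniform_division N"
  unfolding fine_def uniform_division_def
proof clarify
  fix i y assume y: "y \<in> {real i / real N..real (Suc i) / real N}"
  have "real (Suc i) / real N = real i / real N + 1 / real N" by (simp add: add_divide_distrib)
  with y assms show "y \<in> ball (real i / real N) \<delta>" by (auto simp: dist_real_def)
qed

lemma sum_uniform_division:
  assumes "N > 0"
  shows "stieltjes_sum u \<alpha> (uniform_division N) =
    (\<Sum>i<N. u (real i / real N) * (\<alpha> (real (Suc i) / real N) - \<alpha> (real i / real N)))"
proof -
  have "Sup {real i / real N..real (Suc i) / real N} = real (Suc i) / real N"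
    "Inf {real i / real N..real (Suc i) / real N} = real i / real N" for i
    by (simp_all add: divide_right_mono)
  then show ?thesis
    unfolding stieltjes_sum_def uniform_division_def by (subst sum.reindex[OF inj_uniform[OF assms]]) simp
qed

lemma variation_uniform:
  fixes \<gamma> :: "real \<Rightarrow> 'b::real_normed_vector"
  assumes "\<And>d. d division_of {0..1} \<Longrightarrow> (\<Sum>K\<in>d. norm (\<gamma> (Sup K) - \<gamma> (Inf K))) \<le> L"
  shows "(\<Sum>i<N. norm (\<gamma> (real (Suc i) / real N) - \<gamma> (real i / real N))) \<le> L"
proof (cases "N = 0")
  case True
  have "{{0..1::real}} division_of {0..1}" by (metis box_real(2) division_of_self zero_le_one atLeastatMost_empty_iff2 linorder_not_less)
  then have "norm (\<gamma> 1 - \<gamma> 0) \<le> L" using assms[of "{{0..1}}"] by simp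
  then have "0 \<le> L" using norm_ge_zero[of "\<gamma> 1 - \<gamma> 0"] by (rule order_trans[rotated])
  then show ?thesis using True by simp
next
  case False
  let ?I = "\<lambda>i. {real i / real N..real (Suc i) / real N}"
  have "?I ` {..<N} = snd ` uniform_division N" by (auto simp: uniform_division_def image_image)
  then have d: "?I ` {..<N} division_of {0..1}"
    using division_of_tagged_division[OF tagged_uniform_division[of N]] False by simp
  have ends: "Sup (?I i) = real (Suc i) / real N" "Inf (?I i) = real i / real N" for i
    by (simp_all add: divide_right_mono)
  have inj: "inj_on ?I {..<N}"
  proof (rule inj_onI)
    fix i j assume "?I i = ?I j"
    then have "real i / real N = real j / real N" using ends(2) by metis
    then show "i = j" using False by simp
  qed
  show ?thesis using assms[OF d] unfolding sum.reindex[OF inj] o_def ends .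
qed

text \<open>
  Existence of the Riemann--Stieltjes integral by Cauchy's criterion; the uniform divisions provide a
  sequence along which the limit can be taken.
\<close>

lemma stieltjes_limit:
  assumes u: "continuous_on {0..1} u"
    and var: "\<And>d. d division_of {0..1} \<Longrightarrow> (\<Sum>K\<in>d. \<bar>\<alpha> (Sup K) - \<alpha> (Inf K)\<bar>) \<le> L"
  obtains I where
    "(\<lambda>N. \<Sum>i<N. u (real i / real N) * (\<alpha> (real (Suc i) / real N) - \<alpha> (real i / real N))) \<longlonglongrightarrow> I"
    "\<forall>\<epsilon>>0. \<exists>\<delta>>0. \<forall>p. p tagged_division_of {0..1} \<and> (\<lambda>t. ball t \<delta>) fine p \<longrightarrow> \<bar>stieltjes_sum u \<alpha> p - I\<bar> < \<epsilon>"
proof -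
  let ?S = "\<lambda>N. stieltjes_sum u \<alpha> (uniform_division N)"
  have L0: "0 \<le> L"
    using variation_uniform[of \<alpha> L 0] var by simp
  have mesh: "\<exists>\<delta>>0. \<forall>p q. p tagged_division_of {0..1} \<and> (\<lambda>t. ball t \<delta>) fine p \<and> q tagged_division_of {0..1} \<and> (\<lambda>t. ball t \<delta>) fine q \<longrightarrow>
      \<bar>stieltjes_sum u \<alpha> p - stieltjes_sum u \<alpha> q\<bar> < \<epsilon>" if "\<epsilon> > 0" for \<epsilon>
  proof -
    define e where "e = \<epsilon> / (L + 1)"
    have e: "e > 0" "e * L < \<epsilon>" using \<open>\<epsilon> > 0\<close> L0 by (auto simp: e_def field_simps)
    have "uniformly_continuous_on {0..1} u" using u by (intro compact_uniformly_continuous) auto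
    then obtain d where d: "d > 0" "\<And>s t. s \<in> {0..1} \<Longrightarrow> t \<in> {0..1} \<Longrightarrow> dist s t < d \<Longrightarrow> dist (u s) (u t) < e"
      using e(1) unfolding uniformly_continuous_on_def by meson
    have "\<bar>stieltjes_sum u \<alpha> p - stieltjes_sum u \<alpha> q\<bar> < \<epsilon>"
      if "p tagged_division_of {0..1}" "(\<lambda>t. ball t (d/2)) fine p" "q tagged_division_of {0..1}" "(\<lambda>t. ball t (d/2)) fine q" for p q
    proof -
      have "\<bar>stieltjes_sum u \<alpha> p - stieltjes_sum u \<alpha> q\<bar> \<le> e * L"
      proof (rule stieltjes_sum_close[OF that var])
        fix s t :: real assume "s \<in> {0..1}" "t \<in> {0..1}" "\<bar>s - t\<bar> < 2 * (d / 2)"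
        then show "\<bar>u s - u t\<bar> \<le> e" using d(2)[of s t] by (simp add: dist_real_def)
      qed (use e in auto)
      then show ?thesis using e(2) by linarith
    qed
    then show ?thesis using d(1) by (intro exI[of _ "d/2"]) auto
  qed
  have ev: "\<forall>\<^sub>F N in sequentially. uniform_division N tagged_division_of {0..1} \<and> (\<lambda>t. ball t \<delta>) fine uniform_division N"
    if "\<delta> > 0" for \<delta>
  proof -
    have "\<forall>\<^sub>F N in sequentially. 1 / real N < \<delta>"
      using lim_const_over_n[of "1 :: real"] that by (intro order_tendstoD(2)) auto
    then show ?thesis using eventually_gt_at_top[of 0]
      by eventually_elim (simp add: tagged_uniform_division fine_uniform_division)
  qed
  have "Cauchy ?S"
  proof (rule CauchyI)
    fix \<epsilon> :: real assume "\<epsilon> > 0"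
    from mesh[OF this] obtain \<delta> where \<delta>: "\<delta> > 0" "\<And>p q. p tagged_division_of {0..1} \<Longrightarrow> (\<lambda>t. ball t \<delta>) fine p \<Longrightarrow>
      q tagged_division_of {0..1} \<Longrightarrow> (\<lambda>t. ball t \<delta>) fine q \<Longrightarrow> \<bar>stieltjes_sum u \<alpha> p - stieltjes_sum u \<alpha> q\<bar> < \<epsilon>" by metis
    obtain N0 where N0: "\<And>N. N \<ge> N0 \<Longrightarrow> uniform_division N tagged_division_of {0..1} \<and> (\<lambda>t. ball t \<delta>) fine uniform_division N"
      using ev[OF \<delta>(1)] unfolding eventually_sequentially by blast
    show "\<exists>M. \<forall>m\<ge>M. \<forall>n\<ge>M. norm (?S m - ?S n) < \<epsilon>"
      using \<delta>(2) N0 by (intro exI[of _ N0]) (simp add: real_norm_def)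
  qed
  then obtain I where I: "?S \<longlonglongrightarrow> I" by (auto simp: Cauchy_convergent_iff convergent_def)
  show thesis
  proof (rule that)
    have "\<forall>\<^sub>F N in sequentially. ?S N = (\<Sum>i<N. u (real i / real N) * (\<alpha> (real (Suc i) / real N) - \<alpha> (real i / real N)))"
      using eventually_gt_at_top[of 0] by eventually_elim (rule sum_uniform_division)
    with I show "(\<lambda>N. \<Sum>i<N. u (real i / real N) * (\<alpha> (real (Suc i) / real N) - \<alpha> (real i / real N))) \<longlonglongrightarrow> I"
      by (rule Lim_transform_eventually)
  next
    show "\<forall>\<epsilon>>0. \<exists>\<delta>>0. \<forall>p. p tagged_division_of {0..1} \<and> (\<lambda>t. ball t \<delta>) fine p \<longrightarrow> \<bar>stieltjes_sum u \<alpha> p - I\<bar> < \<epsilon>"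
    proof (intro allI impI)
    fix \<epsilon> :: real assume "\<epsilon> > 0"
    then have "\<epsilon> / 2 > 0" by simp
    from mesh[OF this] obtain \<delta> where \<delta>: "\<delta> > 0" "\<And>p q. p tagged_division_of {0..1} \<Longrightarrow> (\<lambda>t. ball t \<delta>) fine p \<Longrightarrow>
      q tagged_division_of {0..1} \<Longrightarrow> (\<lambda>t. ball t \<delta>) fine q \<Longrightarrow> \<bar>stieltjes_sum u \<alpha> p - stieltjes_sum u \<alpha> q\<bar> < \<epsilon> / 2" by metis
    have "\<bar>stieltjes_sum u \<alpha> p - I\<bar> < \<epsilon>" if p: "p tagged_division_of {0..1}" "(\<lambda>t. ball t \<delta>) fine p" for p
    proof -
      have "(\<lambda>N. \<bar>stieltjes_sum u \<alpha> p - ?S N\<bar>) \<longlonglongrightarrow> \<bar>stieltjes_sum u \<alpha> p - I\<bar>"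
        by (intro tendsto_intros I)
      moreover have "\<forall>\<^sub>F N in sequentially. \<bar>stieltjes_sum u \<alpha> p - ?S N\<bar> \<le> \<epsilon> / 2"
        using ev[OF \<delta>(1)] by eventually_elim (use \<delta>(2)[OF p] less_imp_le in blast)
      ultimately have "\<bar>stieltjes_sum u \<alpha> p - I\<bar> \<le> \<epsilon> / 2"
        by (rule tendsto_upperbound) simp
      then show ?thesis using \<open>\<epsilon> > 0\<close> by simp
    qed
    then show "\<exists>\<delta>>0. \<forall>p. p tagged_division_of {0..1} \<and> (\<lambda>t. ball t \<delta>) fine p \<longrightarrow> \<bar>stieltjes_sum u \<alpha> p - I\<bar> < \<epsilon>"
      using \<delta>(1) by blast
    qed
  qed
qed

theorem line_integral_limit:
  fixes \<gamma> :: "real \<Rightarrow> real^'k::finite"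
  assumes "path \<gamma>" "rectifiable \<gamma>" "continuous_on (path_image \<gamma>) U"
  shows "(\<lambda>N. \<Sum>i<N. U (\<gamma> (real i / real N)) * (\<gamma> (real (Suc i) / real N) $ j - \<gamma> (real i / real N) $ j))
    \<longlonglongrightarrow> line_integral U j \<gamma>"
proof -
  obtain L where L: "\<And>d. d division_of {0..1} \<Longrightarrow> (\<Sum>K\<in>d. norm (\<gamma> (Sup K) - \<gamma> (Inf K))) \<le> L"
    using assms(2) unfolding rectifiable_def by blast
  have cu: "continuous_on {0..1} (\<lambda>t. U (\<gamma> t))"
    using assms(1) unfolding path_def by (rule continuous_on_compose2[OF assms(3)]) (auto simp: path_image_def)
  have var: "(\<Sum>K\<in>d. \<bar>\<gamma> (Sup K) $ j - \<gamma> (Inf K) $ j\<bar>) \<le> L" if "d division_of {0..1}" for d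
  proof -
    have "(\<Sum>K\<in>d. \<bar>\<gamma> (Sup K) $ j - \<gamma> (Inf K) $ j\<bar>) \<le> (\<Sum>K\<in>d. norm (\<gamma> (Sup K) - \<gamma> (Inf K)))"
      by (intro sum_mono) (metis component_le_norm_cart vector_minus_component)
    also have "\<dots> \<le> L" by (rule L[OF that])
    finally show ?thesis .
  qed
  obtain I where I: "(\<lambda>N. \<Sum>i<N. U (\<gamma> (real i / real N)) * (\<gamma> (real (Suc i) / real N) $ j - \<gamma> (real i / real N) $ j)) \<longlonglongrightarrow> I"
    and fine: "\<forall>\<epsilon>>0. \<exists>\<delta>>0. \<forall>p. p tagged_division_of {0..1} \<and> (\<lambda>t. ball t \<delta>) fine p \<longrightarrow>
      \<bar>stieltjes_sum (\<lambda>t. U (\<gamma> t)) (\<lambda>t. \<gamma> t $ j) p - I\<bar> < \<epsilon>"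
    by (rule stieltjes_limit[of "\<lambda>t. U (\<gamma> t)" "\<lambda>t. \<gamma> t $ j" L, OF cu var]) blast
  have "has_line_integral U j \<gamma> I"
    unfolding has_line_integral_def using fine by (simp add: stieltjes_sum_def)
  then show ?thesis using I by (simp add: line_integral_eqI)
qed

section \<open>The algebra\<close>

lemma bounded_bilinear_times: "bounded_bilinear ((*) :: 'a::{real_algebra_1,euclidean_space} \<Rightarrow> 'a \<Rightarrow> 'a)"
proof -
  have "bilinear ((*) :: 'a \<Rightarrow> 'a \<Rightarrow> 'a)"
    unfolding bilinear_def by (auto intro!: linearI simp: algebra_simps)
  then show ?thesis by (simp add: bilinear_conv_bounded_bilinear)
qed

lemma alg_inverse_works:
  fixes a :: "'a::comm_ring_1"
  assumes "\<exists>b. a * b = 1"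
  shows "a * alg_inverse a = 1"
proof -
  obtain b where b: "a * b = 1" using assms by blast
  have "c = b" if "a * c = 1" for c
  proof -
    have "c = (a * b) * c" using b by simp
    also have "\<dots> = (a * c) * b" by (simp add: mult_ac)
    finally show "c = b" using that by simp
  qed
  then have "\<exists>!b. a * b = 1" using b by blast
  then show ?thesis unfolding alg_inverse_def by (rule theI')
qed

lemma alg_inverse_unique:
  fixes a :: "'a::comm_ring_1"
  assumes "a * b = 1"
  shows "alg_inverse a = b"
proof -
  have "alg_inverse a = (a * b) * alg_inverse a" using assms by simp
  also have "\<dots> = (a * alg_inverse a) * b" by (simp add: mult_ac)
  also have "a * alg_inverse a = 1" using assms by (intro alg_inverse_works exI)
  finally show ?thesis by simp
qed

text \<open>
  From \<open>x\<inverse> - a\<inverse> = x\<inverse> (a - x) a\<inverse>\<close> one first obtains that \<open>x\<inverse>\<close> stays bounded as \<open>x\<close> approaches \<open>a\<close>,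
  and then that the difference tends to zero.
\<close>

lemma tendsto_alg_inverse:
  fixes F :: "'x \<Rightarrow> 'a::{comm_ring_1,real_algebra_1,euclidean_space}"
  assumes F: "(F \<longlongrightarrow> a) G" and inv: "\<forall>\<^sub>F x in G. \<exists>b. F x * b = 1" and a: "\<exists>b. a * b = 1"
  shows "((\<lambda>x. alg_inverse (F x)) \<longlongrightarrow> alg_inverse a) G"
proof -
  obtain K where K: "K > 0" "\<And>x y :: 'a. norm (x * y) \<le> norm x * norm y * K"
    using bounded_bilinear.pos_bounded[OF bounded_bilinear_times] by blast
  let ?b = "alg_inverse a"
  define \<theta> where "\<theta> x = norm (a - F x) * norm ?b * K * K" for x
  have \<theta>0: "(\<theta> \<longlongrightarrow> 0) G"
  proof -
    have "((\<lambda>x. norm (a - F x) * norm ?b * K * K) \<longlongrightarrow> norm (a - a) * norm ?b * K * K) G"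
      by (intro tendsto_intros F)
    then show ?thesis unfolding \<theta>_def by simp
  qed
  have bound: "norm (alg_inverse (F x) - ?b) \<le> norm (alg_inverse (F x)) * \<theta> x" if "\<exists>b. F x * b = 1" for x
  proof -
    let ?c = "alg_inverse (F x)"
    have "?c - ?b = ?c * (a * ?b) - (F x * ?c) * ?b"
      by (simp add: alg_inverse_works[OF that] alg_inverse_works[OF a])
    also have "\<dots> = ?c * ((a - F x) * ?b)" by (simp add: algebra_simps)
    also have "norm \<dots> \<le> norm ?c * norm ((a - F x) * ?b) * K" by (rule K)
    also have "\<dots> \<le> norm ?c * (norm (a - F x) * norm ?b * K) * K"
      using K by (intro mult_right_mono mult_left_mono) auto
    finally show ?thesis by (simp add: \<theta>_def mult_ac)
  qed
  have "\<forall>\<^sub>F x in G. \<theta> x < 1/2" using \<theta>0 by (rule order_tendstoD(2)) simp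
  with inv have ev: "\<forall>\<^sub>F x in G. norm (alg_inverse (F x) - ?b) \<le> 2 * norm ?b * \<theta> x"
  proof eventually_elim
    case (elim x)
    let ?c = "alg_inverse (F x)"
    have t0: "\<theta> x \<ge> 0" using K by (simp add: \<theta>_def)
    have "norm ?c \<le> norm ?b + norm (?c - ?b)" using norm_triangle_ineq[of ?b "?c - ?b"] by simp
    also have "\<dots> \<le> norm ?b + norm ?c * \<theta> x" using bound[OF elim(1)] by simp
    also have "\<dots> \<le> norm ?b + norm ?c * (1/2)" using elim(2) by (intro add_left_mono mult_left_mono) auto
    finally have "norm ?c \<le> 2 * norm ?b" by simp
    then have "norm ?c * \<theta> x \<le> 2 * norm ?b * \<theta> x" using t0 by (rule mult_right_mono)
    with bound[OF elim(1)] show ?case by linarith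
  qed
  have "((\<lambda>x. 2 * norm ?b * \<theta> x) \<longlongrightarrow> 2 * norm ?b * 0) G" by (intro tendsto_intros \<theta>0)
  then have "((\<lambda>x. alg_inverse (F x) - ?b) \<longlongrightarrow> 0) G"
    using Lim_null_comparison[OF ev] by simp
  then show ?thesis by (simp add: LIM_zero_iff)
qed

lemma double_sum_single:
  fixes F :: "'i \<Rightarrow> 'j \<Rightarrow> 'a::comm_monoid_add"
  assumes F: "\<And>r s. r \<in> A \<Longrightarrow> s \<in> B \<Longrightarrow> F r s = (if r = u \<and> s = v then c else 0)"
    and "u \<in> A" "v \<in> B" "finite A \<and> finite B"
  shows "(\<Sum>r\<in>A. \<Sum>s\<in>B. F r s) = c"
proof -
  have "(\<Sum>s\<in>B. F r s) = (if r = u then c else 0)" if "r \<in> A" for r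
  proof -
    have "(\<Sum>s\<in>B. F r s) = (\<Sum>s\<in>B. if s = v then (if r = u then c else 0) else 0)"
      using F[OF that] by (intro sum.cong) auto
    then show ?thesis using assms(3,4) by simp
  qed
  then have "(\<Sum>r\<in>A. \<Sum>s\<in>B. F r s) = (\<Sum>r\<in>A. if r = u then c else 0)" by (intro sum.cong refl)
  then show ?thesis using assms(2,4) by simp
qed

context cartan_algebra
begin

abbreviation coef :: "nat \<Rightarrow> 'a \<Rightarrow> complex" where
  "coef \<equiv> basis_functional scaleC n I"

lemma coef_add: "r \<in> {1..n} \<Longrightarrow> coef r (x + y) = coef r x + coef r y"
  and coef_scale: "r \<in> {1..n} \<Longrightarrow> coef r (scaleC c x) = c * coef r x"
proof -
  assume r: "r \<in> {1..n}"
  interpret L: Vector_Spaces.linear scaleC "(*)" "coef r" by (rule linear_basis_functional[OF r])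
  show "coef r (x + y) = coef r x + coef r y" "coef r (scaleC c x) = c * coef r x"
    by (rule L.add, rule L.scale)
qed

lemma coef_zero: "r \<in> {1..n} \<Longrightarrow> coef r 0 = 0"
  using coef_add[of r 0 0] by simp

lemma coef_sum: "r \<in> {1..n} \<Longrightarrow> coef r (sum g A) = (\<Sum>i\<in>A. coef r (g i))"
  by (induction A rule: infinite_finite_induct) (simp_all add: coef_add coef_zero)

lemma coef_scaleR: "r \<in> {1..n} \<Longrightarrow> coef r (t *\<^sub>R x) = complex_of_real t * coef r x"
  by (simp add: coef_scale flip: scaleC_of_real)

lemma linear_coef:
  assumes "r \<in> {1..n}"
  shows "linear (coef r)"
proof (rule linearI)
  show "coef r (t *\<^sub>R x) = t *\<^sub>R coef r x" for t x
    unfolding coef_scaleR[OF assms] by (simp only: scaleR_conv_of_real)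
qed (rule coef_add[OF assms])

lemma expansion: "x = (\<Sum>r\<in>{1..n}. scaleC (coef r x) (I r))"
proof -
  let ?P = "\<lambda>x. x = (\<Sum>r\<in>{1..n}. scaleC (coef r x) (I r))"
  have "x \<in> span (I ` {1..n})" unfolding basis_span by (rule UNIV_I)
  then show ?thesis
  proof (induction rule: span_induct[where P = ?P])
    case base
    show ?case
    proof (rule subspaceI)
      show "0 \<in> Collect ?P" by (simp add: coef_zero)
      show "x + y \<in> Collect ?P" if "x \<in> Collect ?P" "y \<in> Collect ?P" for x y
      proof -
        have "(\<Sum>r\<in>{1..n}. scaleC (coef r (x + y)) (I r)) = (\<Sum>r\<in>{1..n}. scaleC (coef r x) (I r)) + (\<Sum>r\<in>{1..n}. scaleC (coef r y) (I r))"
          by (simp add: coef_add scale_left_distrib sum.distrib)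
        then show ?thesis using that by simp
      qed
      show "scaleC c x \<in> Collect ?P" if "x \<in> Collect ?P" for c x
      proof -
        have "(\<Sum>r\<in>{1..n}. scaleC (coef r (scaleC c x)) (I r)) = scaleC c (\<Sum>r\<in>{1..n}. scaleC (coef r x) (I r))"
          by (simp add: coef_scale scale_sum_right)
        then show ?thesis using that by simp
      qed
    qed
  next
    case (step x)
    then obtain s where s: "s \<in> {1..n}" "x = I s" by blast
    have "(\<Sum>r\<in>{1..n}. scaleC (coef r (I s)) (I r)) = (\<Sum>r\<in>{1..n}. if r = s then I s else 0)"
    proof (rule sum.cong[OF refl])
      fix r assume r: "r \<in> {1..n}"
      show "scaleC (coef r (I s)) (I r) = (if r = s then I s else 0)"
        unfolding basis_functional_basis[OF r s(1)] by auto
    qed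
    then show ?case using s by simp
  qed
qed

lemma scaleC_mult_right: "scaleC c (x * y) = x * scaleC c y"
  using scaleC_mult_left[of c y x] by (simp add: mult.commute)

lemma scaleC_real_linear: "linear (scaleC c)"
proof (rule linearI)
  show "scaleC c (t *\<^sub>R x) = t *\<^sub>R scaleC c x" for t x
    by (simp add: scale_left_commute flip: scaleC_of_real)
qed (rule scale_right_distrib)

lemma coef_mult:
  assumes "p \<in> {1..n}"
  shows "coef p (x * y) = (\<Sum>r\<in>{1..n}. \<Sum>s\<in>{1..n}. coef r x * coef s y * coef p (I r * I s))"
proof -
  have "x * y = (\<Sum>r\<in>{1..n}. scaleC (coef r x) (I r)) * (\<Sum>s\<in>{1..n}. scaleC (coef s y) (I s))"
    using expansion[of x] expansion[of y] by simp
  also have "\<dots> = (\<Sum>r\<in>{1..n}. \<Sum>s\<in>{1..n}. scaleC (coef s y) (scaleC (coef r x) (I r * I s)))"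
    by (simp only: sum_product scaleC_mult_left[symmetric] scaleC_mult_right[symmetric])
  finally show ?thesis
    by (simp only: coef_sum[OF assms] coef_scale[OF assms] mult.assoc mult.left_commute)
qed

lemma coef_nilpotent_product:
  assumes "r \<in> {m+1..n}" "s \<in> {m+1..n}" "p \<in> {1..n}" "p \<le> max r s"
  shows "coef p (I r * I s) = 0"
proof -
  obtain \<Upsilon> :: "nat \<Rightarrow> nat \<Rightarrow> nat \<Rightarrow> complex" where
    "I r * I s = (\<Sum>q\<in>{max r s + 1..n}. scaleC (\<Upsilon> r q s) (I q))"
    using nilpotents assms(1,2) by blast
  then show ?thesis using assms(3,4)
    by (auto simp: coef_sum coef_scale basis_functional_basis intro!: sum.neutral)
qed

lemma mixedE:
  assumes "s \<in> {m+1..n}"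
  obtains v where "v \<in> {1..m}" "\<forall>r\<in>{1..m}. I r * I s = (if r = v then I s else 0)"
proof -
  obtain v where "v \<in> {1..m} \<and> (\<forall>r\<in>{1..m}. I r * I s = (if r = v then I s else 0))"
    using mixed[OF assms] by (rule ex1E)
  then show thesis by (elim conjE) (rule that)
qed

lemma idempotent_times:
  assumes "r \<in> {1..m}" "s \<in> {m+1..n}"
  shows "I r * I s = I s \<or> I r * I s = 0"
proof -
  obtain v where "\<forall>r\<in>{1..m}. I r * I s = (if r = v then I s else 0)"
    using assms(2) by (rule mixedE) blast
  from bspec[OF this assms(1)] show ?thesis by (simp split: if_splits)
qed

lemma coef_idempotent_product:
  assumes "u \<in> {1..m}" "r \<in> {1..n}" "s \<in> {1..n}"
  shows "coef u (I r * I s) = (if r = u \<and> s = u then 1 else 0)"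
proof -
  have u: "u \<in> {1..n}" using assms(1) m_le_n by auto
  have mixed_case: "coef u (I r * I s) = 0" if "r \<in> {1..m}" "s \<in> {m+1..n}" for r s
  proof -
    have "I r * I s = I s \<or> I r * I s = 0" by (rule idempotent_times[OF that])
    then show ?thesis using that assms(1) u by (auto simp: coef_zero basis_functional_basis)
  qed
  consider "r \<in> {1..m}" "s \<in> {1..m}" | "r \<in> {1..m}" "s \<in> {m+1..n}" | "s \<in> {1..m}" "r \<in> {m+1..n}" | "r \<in> {m+1..n}" "s \<in> {m+1..n}"
    using assms(2,3) by fastforce
  then show ?thesis
  proof cases
    case 1
    then show ?thesis using assms(2) u by (auto simp: idempotents coef_zero basis_functional_basis)
  next
    case 2
    then show ?thesis using mixed_case assms(1) by auto
  next
    case 3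
    then show ?thesis using mixed_case[of s r] assms(1) by (auto simp: mult.commute)
  next
    case 4
    then show ?thesis using coef_nilpotent_product[of r s u] u assms(1) by auto
  qed
qed

lemma coef_multiplicative:
  assumes u: "u \<in> {1..m}"
  shows "coef u (x * y) = coef u x * coef u y"
proof -
  have un: "u \<in> {1..n}" using u m_le_n by auto
  show ?thesis
  proof (rule trans[OF coef_mult[OF un] double_sum_single[OF _ un un]])
    fix r s assume rs: "r \<in> {1..n}" "s \<in> {1..n}"
    show "coef r x * coef s y * coef u (I r * I s) = (if r = u \<and> s = u then coef u x * coef u y else 0)"
      unfolding coef_idempotent_product[OF u rs] by auto
  qed simp
qed

text \<open>
  The functionals \<open>f\<^sub>u\<close> are multiplicative, so the coefficients of \<open>b\<close> at the idempotents vanish. Multiplication by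
  \<open>a\<close> multiplies the first nonzero coefficient of \<open>b\<close> by some \<open>f\<^sub>v(a)\<close>, because products of nilpotent basis elements
  only involve later ones.
\<close>

lemma mult_injective_if_coef_nonzero:
  assumes a: "\<And>u. u \<in> {1..m} \<Longrightarrow> coef u a \<noteq> 0" and "a * b = 0"
  shows "b = 0"
proof (rule ccontr)
  assume "b \<noteq> 0"
  have low: "coef u b = 0" if "u \<in> {1..m}" for u
    using coef_multiplicative[OF that, of a b] a[OF that] that m_le_n by (simp add: \<open>a * b = 0\<close> coef_zero)
  have "\<exists>s. s \<in> {1..n} \<and> coef s b \<noteq> 0"
  proof (rule ccontr)
    assume "\<not> ?thesis"
    then have "(\<Sum>r\<in>{1..n}. scaleC (coef r b) (I r)) = 0" by (intro sum.neutral) auto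
    then show False using expansion[of b] \<open>b \<noteq> 0\<close> by simp
  qed
  then obtain p where p: "p \<in> {1..n}" "coef p b \<noteq> 0" and least: "\<And>s. s < p \<Longrightarrow> s \<in> {1..n} \<Longrightarrow> coef s b = 0"
    using exists_least_iff[of "\<lambda>s. s \<in> {1..n} \<and> coef s b \<noteq> 0"] by blast
  have pm: "p \<in> {m+1..n}" using p low[of p] by (cases "p \<le> m") auto
  obtain v where v: "v \<in> {1..m}" "\<forall>r\<in>{1..m}. I r * I p = (if r = v then I p else 0)"
    using pm by (rule mixedE)
  have term_eq: "coef r a * coef s b * coef p (I r * I s) = (if r = v \<and> s = p then coef v a * coef p b else 0)"
    if r: "r \<in> {1..n}" and s: "s \<in> {1..n}" for r s
  proof -
    consider "s < p" | "s = p" | "p < s" by linarith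
    then show ?thesis
    proof cases
      case 1
      then show ?thesis using least s by simp
    next
      case 2
      have "coef p (I r * I p) = (if r = v then 1 else 0)"
      proof (cases "r \<le> m")
        case True
        then have "I r * I p = (if r = v then I p else 0)" using v(2) r by simp
        then show ?thesis using basis_functional_basis[OF p(1) p(1)] coef_zero[OF p(1)] by simp
      next
        case False
        then have "coef p (I r * I p) = 0" using r pm p(1) by (intro coef_nilpotent_product) auto
        then show ?thesis using False v(1) by auto
      qed
      then show ?thesis using 2 by simp
    next
      case 3
      then have sm: "s \<in> {m+1..n}" using pm s by auto
      have "coef p (I r * I s) = 0"
      proof (cases "r \<le> m")
        case True
        then have rm: "r \<in> {1..m}" using r by auto
        have "I r * I s = I s \<or> I r * I s = 0" by (rule idempotent_times[OF rm sm])
        then show ?thesis using 3 p(1) s by (auto simp: basis_functional_basis coef_zero)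
      next
        case False
        then show ?thesis using r sm p(1) 3 by (intro coef_nilpotent_product) auto
      qed
      then show ?thesis using 3 by simp
    qed
  qed
  have vn: "v \<in> {1..n}" using v(1) m_le_n by auto
  have "coef p (a * b) = coef v a * coef p b"
    by (rule trans[OF coef_mult[OF p(1)] double_sum_single[OF term_eq vn p(1)]]) simp_all
  then show False using a[OF v(1)] p \<open>a * b = 0\<close> by (simp add: coef_zero)
qed

text \<open>In finite dimension an injective multiplication operator is surjective.\<close>

lemma invertible_if_coef_nonzero:
  assumes "\<And>u. u \<in> {1..m} \<Longrightarrow> coef u a \<noteq> 0"
  shows "\<exists>b. a * b = 1"
proof -
  have lin: "linear (\<lambda>x. a * x)" by (rule linearI) (simp_all add: algebra_simps)
  have "inj (\<lambda>x. a * x)"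
    unfolding linear_injective_0[OF lin] using mult_injective_if_coef_nonzero[OF assms] by blast
  then have "surj (\<lambda>x. a * x)" by (rule linear_injective_imp_surjective[OF lin _ refl])
  then show ?thesis unfolding surj_def by metis
qed

lemma linear_elem: "linear (elem e)"
  by (rule linearI) (simp_all add: elem_def scaleR_add_left sum.distrib scaleR_sum_right)

text \<open>
  The line integrals of the components are limits of Riemann sums over the same divisions, and the
  real and imaginary parts of the coefficients recombine to the element itself.
\<close>

lemma alg_integral_limit:
  fixes e :: "'k::finite \<Rightarrow> 'a" and \<gamma> :: "real \<Rightarrow> real^'k"
  assumes \<gamma>: "path \<gamma>" "rectifiable \<gamma>" and \<Psi>: "continuous_on (path_image \<gamma>) \<Psi>"
  shows "(\<lambda>N. \<Sum>i<N. elem e (\<gamma> (real (Suc i) / real N) - \<gamma> (real i / real N)) * \<Psi> (\<gamma> (real i / real N)))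
    \<longlonglongrightarrow> alg_integral scaleC n I e \<gamma> \<Psi>"
proof -
  define \<Delta> where "\<Delta> N i j = \<gamma> (real (Suc i) / real N) $ j - \<gamma> (real i / real N) $ j" for N i j
  define P where "P N i = \<Psi> (\<gamma> (real i / real N))" for N i
  define SR where "SR N = (\<Sum>j\<in>UNIV. e j * (\<Sum>r\<in>{1..n}. (\<Sum>i<N. Re (coef r (P N i)) * \<Delta> N i j) *\<^sub>R I r))" for N
  define SI where "SI N = (\<Sum>j\<in>UNIV. e j * (\<Sum>r\<in>{1..n}. (\<Sum>i<N. Im (coef r (P N i)) * \<Delta> N i j) *\<^sub>R I r))" for N
  have cc: "continuous_on (path_image \<gamma>) (\<lambda>x. coef r (\<Psi> x))" if "r \<in> {1..n}" for r
    by (rule linear_continuous_on_compose[OF \<Psi> linear_coef[OF that]])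
  have limR: "(\<lambda>N. \<Sum>i<N. Re (coef r (P N i)) * \<Delta> N i j) \<longlonglongrightarrow> line_integral (\<lambda>x. Re (coef r (\<Psi> x))) j \<gamma>"
    and limI: "(\<lambda>N. \<Sum>i<N. Im (coef r (P N i)) * \<Delta> N i j) \<longlonglongrightarrow> line_integral (\<lambda>x. Im (coef r (\<Psi> x))) j \<gamma>"
    if "r \<in> {1..n}" for r j
    unfolding \<Delta>_def P_def
    by (rule line_integral_limit[OF \<gamma> continuous_on_Re[OF cc[OF that]]], rule line_integral_limit[OF \<gamma> continuous_on_Im[OF cc[OF that]]])
  note mult_lim = bounded_bilinear.tendsto[OF bounded_bilinear_times tendsto_const]
  have R: "SR \<longlonglongrightarrow> (\<Sum>j\<in>UNIV. e j * (\<Sum>r\<in>{1..n}. line_integral (\<lambda>x. Re (coef r (\<Psi> x))) j \<gamma> *\<^sub>R I r))"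
    unfolding SR_def by (rule tendsto_sum, rule mult_lim, rule tendsto_sum, rule tendsto_scaleR[OF limR tendsto_const])
  have S: "SI \<longlonglongrightarrow> (\<Sum>j\<in>UNIV. e j * (\<Sum>r\<in>{1..n}. line_integral (\<lambda>x. Im (coef r (\<Psi> x))) j \<gamma> *\<^sub>R I r))"
    unfolding SI_def by (rule tendsto_sum, rule mult_lim, rule tendsto_sum, rule tendsto_scaleR[OF limI tendsto_const])
  have bl: "bounded_linear (scaleC \<i>)"
    using scaleC_real_linear by (simp add: linear_conv_bounded_linear)
  have lim: "(\<lambda>N. SR N + scaleC \<i> (SI N)) \<longlonglongrightarrow> alg_integral scaleC n I e \<gamma> \<Psi>"
    unfolding alg_integral_def by (rule tendsto_add[OF R bounded_linear.tendsto[OF bl S]])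
  have "SR N + scaleC \<i> (SI N) = (\<Sum>i<N. elem e (\<gamma> (real (Suc i) / real N) - \<gamma> (real i / real N)) * P N i)" for N
  proof -
    have collect: "(\<Sum>j\<in>UNIV. e j * (\<Sum>r\<in>{1..n}. (\<Sum>i<N. c r i * \<Delta> N i j) *\<^sub>R I r)) =
        (\<Sum>i<N. elem e (\<gamma> (real (Suc i) / real N) - \<gamma> (real i / real N)) * (\<Sum>r\<in>{1..n}. c r i *\<^sub>R I r))" for c :: "nat \<Rightarrow> nat \<Rightarrow> real"
    proof -
      have pull: "x * (\<Sum>i<N. t i *\<^sub>R y i) = (\<Sum>i<N. (t i *\<^sub>R x) * y i)" for x :: 'a and t :: "nat \<Rightarrow> real" and y
        by (simp add: sum_distrib_left)
      have swap: "(\<Sum>r\<in>{1..n}. (\<Sum>i<N. c r i * \<Delta> N i j) *\<^sub>R I r) = (\<Sum>i<N. \<Delta> N i j *\<^sub>R (\<Sum>r\<in>{1..n}. c r i *\<^sub>R I r))" for j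
        by (simp add: scaleR_sum_left scaleR_sum_right mult.commute) (rule sum.swap)
      have "(\<Sum>j\<in>UNIV. e j * (\<Sum>r\<in>{1..n}. (\<Sum>i<N. c r i * \<Delta> N i j) *\<^sub>R I r)) =
          (\<Sum>j\<in>UNIV. \<Sum>i<N. (\<Delta> N i j *\<^sub>R e j) * (\<Sum>r\<in>{1..n}. c r i *\<^sub>R I r))"
      proof (rule sum.cong[OF refl])
        fix j
        show "e j * (\<Sum>r\<in>{1..n}. (\<Sum>i<N. c r i * \<Delta> N i j) *\<^sub>R I r) =
            (\<Sum>i<N. (\<Delta> N i j *\<^sub>R e j) * (\<Sum>r\<in>{1..n}. c r i *\<^sub>R I r))"
          unfolding swap by (rule pull)
      qed
      also have "\<dots> = (\<Sum>i<N. \<Sum>j\<in>UNIV. (\<Delta> N i j *\<^sub>R e j) * (\<Sum>r\<in>{1..n}. c r i *\<^sub>R I r))" by (rule sum.swap)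
      also have "\<dots> = (\<Sum>i<N. elem e (\<gamma> (real (Suc i) / real N) - \<gamma> (real i / real N)) * (\<Sum>r\<in>{1..n}. c r i *\<^sub>R I r))"
        by (simp only: elem_def \<Delta>_def sum_distrib_right vector_minus_component)
      finally show ?thesis .
    qed
    have split: "P N i = (\<Sum>r\<in>{1..n}. Re (coef r (P N i)) *\<^sub>R I r) + scaleC \<i> (\<Sum>r\<in>{1..n}. Im (coef r (P N i)) *\<^sub>R I r)" for i
    proof -
      have dec: "scaleC c x = Re c *\<^sub>R x + scaleC \<i> (Im c *\<^sub>R x)" for c x
      proof -
        have "scaleC c x = scaleC (complex_of_real (Re c) + \<i> * complex_of_real (Im c)) x"
          by (simp only: complex_eq[symmetric])
        also have "\<dots> = scaleC (complex_of_real (Re c)) x + scaleC \<i> (scaleC (complex_of_real (Im c)) x)"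
          by (simp only: scale_left_distrib scale_scale)
        finally show ?thesis by (simp only: scaleC_of_real)
      qed
      have "P N i = (\<Sum>r\<in>{1..n}. scaleC (coef r (P N i)) (I r))" by (rule expansion)
      also have "\<dots> = (\<Sum>r\<in>{1..n}. Re (coef r (P N i)) *\<^sub>R I r + scaleC \<i> (Im (coef r (P N i)) *\<^sub>R I r))"
        by (rule sum.cong[OF refl dec])
      finally show ?thesis by (simp only: sum.distrib scale_sum_right)
    qed
    have "SR N + scaleC \<i> (SI N) = (\<Sum>i<N. elem e (\<gamma> (real (Suc i) / real N) - \<gamma> (real i / real N)) *
        ((\<Sum>r\<in>{1..n}. Re (coef r (P N i)) *\<^sub>R I r) + scaleC \<i> (\<Sum>r\<in>{1..n}. Im (coef r (P N i)) *\<^sub>R I r)))"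
      unfolding SR_def SI_def collect by (simp add: scale_sum_right scaleC_mult_right distrib_left sum.distrib)
    then show ?thesis by (simp only: split[symmetric])
  qed
  with lim show ?thesis by (simp add: P_def)
qed

end

section \<open>Circles\<close>

lemma norm_circle_direction:
  assumes "orthonormal_pair a b"
  shows "norm (cos s *\<^sub>R a + sin s *\<^sub>R b) = 1"
proof -
  have ab: "a \<bullet> a = 1" "b \<bullet> b = 1" "a \<bullet> b = 0" "b \<bullet> a = 0"
    using assms by (auto simp: orthonormal_pair_def norm_eq_1 inner_commute)
  have "(cos s *\<^sub>R a + sin s *\<^sub>R b) \<bullet> (cos s *\<^sub>R a + sin s *\<^sub>R b) = cos s * cos s + sin s * sin s"
    by (simp add: inner_add_left inner_add_right ab)
  also have "\<dots> = 1" using sin_cos_squared_add3[of s] by simp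
  finally show ?thesis by (simp add: norm_eq_1)
qed

lemma circle_lipschitz:
  assumes "orthonormal_pair a b" "\<rho> \<ge> 0"
  shows "norm (circle x0 \<rho> a b s - circle x0 \<rho> a b t) \<le> 4 * pi * \<rho> * \<bar>s - t\<bar>"
proof -
  have n: "norm a = 1" "norm b = 1" using assms(1) by (auto simp: orthonormal_pair_def)
  have c: "\<bar>cos (2 * pi * s) - cos (2 * pi * t)\<bar> \<le> 2 * pi * \<bar>s - t\<bar>"
  proof -
    have "\<bar>cos (2 * pi * s) - cos (2 * pi * t)\<bar> \<le> \<bar>2 * pi * s - 2 * pi * t\<bar>"
      using field_differentiable_bound[of UNIV cos "\<lambda>x. - sin x" 1 "2 * pi * t" "2 * pi * s"]
      by (auto intro!: derivative_eq_intros)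
    also have "\<dots> = 2 * pi * \<bar>s - t\<bar>" by (simp add: abs_mult flip: right_diff_distrib)
    finally show ?thesis .
  qed
  have d: "\<bar>sin (2 * pi * s) - sin (2 * pi * t)\<bar> \<le> 2 * pi * \<bar>s - t\<bar>"
  proof -
    have "\<bar>sin (2 * pi * s) - sin (2 * pi * t)\<bar> \<le> \<bar>2 * pi * s - 2 * pi * t\<bar>"
      using field_differentiable_bound[of UNIV sin cos 1 "2 * pi * t" "2 * pi * s"]
      by (auto intro!: derivative_eq_intros)
    also have "\<dots> = 2 * pi * \<bar>s - t\<bar>" by (simp add: abs_mult flip: right_diff_distrib)
    finally show ?thesis .
  qed
  have "circle x0 \<rho> a b s - circle x0 \<rho> a b t =
      \<rho> *\<^sub>R ((cos (2 * pi * s) - cos (2 * pi * t)) *\<^sub>R a + (sin (2 * pi * s) - sin (2 * pi * t)) *\<^sub>R b)"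
    by (simp add: circle_def algebra_simps)
  then have "norm (circle x0 \<rho> a b s - circle x0 \<rho> a b t) =
      \<rho> * norm ((cos (2 * pi * s) - cos (2 * pi * t)) *\<^sub>R a + (sin (2 * pi * s) - sin (2 * pi * t)) *\<^sub>R b)"
    using assms(2) by simp
  also have "\<dots> \<le> \<rho> * (2 * pi * \<bar>s - t\<bar> + 2 * pi * \<bar>s - t\<bar>)"
    using c d n by (intro mult_left_mono[OF _ assms(2)] norm_triangle_mono) simp_all
  finally show ?thesis by (simp add: mult_ac)
qed

lemma path_circle: "path (circle (x0 :: 'b::real_normed_vector) \<rho> a b)"
  unfolding path_def circle_def by (intro continuous_intros)

lemma loop_circle: "pathfinish (circle x0 \<rho> a b) = pathstart (circle x0 \<rho> a b)"
  by (simp add: pathfinish_def pathstart_def circle_def)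

lemma rectifiable_circle:
  assumes "orthonormal_pair a b" "\<rho> \<ge> 0"
  shows "rectifiable (circle x0 \<rho> a b)"
  unfolding rectifiable_def
proof (intro exI[of _ "4 * pi * \<rho>"] allI impI)
  fix d assume d: "d division_of {0..1 :: real}"
  have "(\<Sum>K\<in>d. norm (circle x0 \<rho> a b (Sup K) - circle x0 \<rho> a b (Inf K))) \<le> (\<Sum>K\<in>d. 4 * pi * \<rho> * measure lborel K)"
  proof (rule sum_mono)
    fix K assume K: "K \<in> d"
    obtain k l where kl: "K = {k..l}" using division_ofD(4)[OF d K] by auto
    have "K \<noteq> {}" using division_ofD(3)[OF d K] .
    then have le: "k \<le> l" by (simp add: kl)
    then have "measure lborel K = \<bar>Sup K - Inf K\<bar>" by (simp add: kl)
    then show "norm (circle x0 \<rho> a b (Sup K) - circle x0 \<rho> a b (Inf K)) \<le> 4 * pi * \<rho> * measure lborel K"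
      using circle_lipschitz[OF assms, of x0 "Sup K" "Inf K"] by simp
  qed
  also have "\<dots> = 4 * pi * \<rho> * sum (measure lborel) d" by (simp add: sum_distrib_left)
  also have "sum (measure lborel) d = 1" using additive_content_division[of d 0 1] d by simp
  finally show "(\<Sum>K\<in>d. norm (circle x0 \<rho> a b (Sup K) - circle x0 \<rho> a b (Inf K))) \<le> 4 * pi * \<rho>" by simp
qed

lemma rectifiable_variation:
  assumes "rectifiable \<gamma>"
  obtains L where "\<And>N. (\<Sum>i<N. norm (\<gamma> (real (Suc i) / real N) - \<gamma> (real i / real N))) \<le> L"
proof -
  obtain L where L: "\<And>d. d division_of {0..1} \<Longrightarrow> (\<Sum>K\<in>d. norm (\<gamma> (Sup K) - \<gamma> (Inf K))) \<le> L"
    using assms unfolding rectifiable_def by blast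
  show thesis by (rule that, rule variation_uniform[OF L])
qed

section \<open>The Cauchy integral formula\<close>

context cartan_algebra
begin

text \<open>
  Riemann sums and polygonal sums have the same limit, and the polygonal sums of the two paths are
  eventually equal.
\<close>

lemma alg_integral_homotopic:
  fixes e :: "'k::finite \<Rightarrow> 'a"
  assumes closed: "closed_form W (\<lambda>x h. elem e h * \<Psi> x)" and \<Psi>: "continuous_on W \<Psi>"
    and \<gamma>: "path \<gamma>" "rectifiable \<gamma>" "path_image \<gamma> \<subseteq> W"
    and \<gamma>': "path \<gamma>'" "rectifiable \<gamma>'" "path_image \<gamma>' \<subseteq> W"
    and hom: "homotopic_loops W \<gamma> \<gamma>'"
  shows "alg_integral scaleC n I e \<gamma> \<Psi> = alg_integral scaleC n I e \<gamma>' \<Psi>"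
proof -
  interpret F: closed_form W "\<lambda>x h. elem e h * \<Psi> x" by (rule closed)
  have lim: "F.step_sum p \<longlonglongrightarrow> alg_integral scaleC n I e p \<Psi>"
    if p: "path p" "rectifiable p" "path_image p \<subseteq> W" for p
  proof -
    obtain L where L: "\<And>N. (\<Sum>i<N. norm (p (real (Suc i) / real N) - p (real i / real N))) \<le> L"
      using rectifiable_variation[OF p(2)] by blast
    have "continuous_on (path_image p) \<Psi>" using \<Psi> p(3) by (rule continuous_on_subset)
    from tendsto_diff[OF alg_integral_limit[OF p(1,2) this, of e] F.riemann_sum_minus_step_sum[OF p(1,3) L]]
    show ?thesis by simp
  qed
  have "F.step_sum \<gamma> \<longlonglongrightarrow> alg_integral scaleC n I e \<gamma>' \<Psi>"
    by (rule tendsto_cong[THEN iffD2, OF F.step_sum_homotopic[OF hom] lim[OF \<gamma>']])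
  then show ?thesis using LIMSEQ_unique lim[OF \<gamma>] by blast
qed

text \<open>
  The product rule for derivatives along rays. The derivative of the inverse comes from
  \<open>x\<inverse> - y\<inverse> = x\<inverse> (y - x) y\<inverse>\<close>, and the symmetry of the derivative of the form from commutativity.
\<close>

lemma closed_form_quotient:
  fixes e :: "'k::finite \<Rightarrow> 'a"
  assumes W: "open W" "W \<subseteq> \<Omega>" and \<Phi>: "monogenic_on e \<Phi> \<Omega>"
    and inv: "\<And>x. x \<in> W \<Longrightarrow> \<exists>b. elem e (x - x0) * b = 1"
  shows "closed_form W (\<lambda>x h. elem e h * (\<Phi> x * alg_inverse (elem e (x - x0))))"
    and "continuous_on W (\<lambda>x. \<Phi> x * alg_inverse (elem e (x - x0)))"
proof -
  let ?z = "\<lambda>x. elem e (x - x0)" and ?J = "\<lambda>x. alg_inverse (elem e (x - x0))"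
  have cz: "continuous_on UNIV ?z"
    by (rule linear_continuous_on_compose[OF _ linear_elem]) (intro continuous_intros)
  have J: "(?J \<longlongrightarrow> ?J x) (at x within W)" if "x \<in> W" for x
  proof (rule tendsto_alg_inverse)
    show "(?z \<longlongrightarrow> ?z x) (at x within W)"
      using continuous_on_subset[OF cz subset_UNIV, of W] that unfolding continuous_on_def by blast
    show "\<forall>\<^sub>F y in at x within W. \<exists>b. ?z y * b = 1" using inv by (auto simp: eventually_at_filter)
  qed (rule inv[OF that])
  then have cJ: "continuous_on W ?J" unfolding continuous_on_def by blast
  have c\<Phi>: "continuous_on W \<Phi>" using \<Phi> W(2) unfolding monogenic_on_def by (blast intro: continuous_on_subset)
  note cont_mult = bounded_bilinear.continuous_on[OF bounded_bilinear_times]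
  show c\<Psi>: "continuous_on W (\<lambda>x. \<Phi> x * ?J x)" by (rule cont_mult[OF c\<Phi> cJ])
  show "closed_form W (\<lambda>x h. elem e h * (\<Phi> x * ?J x))"
  proof
    show "open W" by (rule W(1))
    show "continuous_form W (\<lambda>x h. elem e h * (\<Phi> x * ?J x))"
      unfolding continuous_form_def
    proof
      show "\<forall>x. linear (\<lambda>h. elem e h * (\<Phi> x * ?J x))"
        by (intro allI linearI) (simp_all add: linear_add[OF linear_elem] linear_scale[OF linear_elem] distrib_right)
      have "continuous_on (W \<times> UNIV) (\<lambda>z. elem e (snd z))"
        by (rule linear_continuous_on_compose[OF continuous_on_snd[OF continuous_on_id] linear_elem])
      moreover have "continuous_on (W \<times> UNIV) (\<lambda>z. \<Phi> (fst z) * ?J (fst z))"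
        by (rule continuous_on_compose2[OF c\<Psi> continuous_on_fst[OF continuous_on_id]]) auto
      ultimately show "continuous_on (W \<times> UNIV) (\<lambda>z. elem e (snd z) * (\<Phi> (fst z) * ?J (fst z)))"
        by (rule cont_mult)
    qed
  next
    fix x assume x: "x \<in> W"
    then obtain d where d: "\<And>h. ((\<lambda>\<epsilon>. (\<Phi> (x + \<epsilon> *\<^sub>R h) - \<Phi> x) /\<^sub>R \<epsilon>) \<longlongrightarrow> elem e h * d) (at_right 0)"
      using \<Phi> W(2) unfolding monogenic_on_def by blast
    define D' where "D' = d * ?J x - \<Phi> x * ?J x * ?J x"
    show "\<exists>D. bilinear D \<and> (\<forall>h k. D h k = D k h) \<and>
      (\<forall>h k. ((\<lambda>r. (elem e k * (\<Phi> (x + r *\<^sub>R h) * ?J (x + r *\<^sub>R h)) - elem e k * (\<Phi> x * ?J x)) /\<^sub>R r) \<longlongrightarrow> D h k) (at_right 0))"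
    proof (rule exI[of _ "\<lambda>h k. elem e k * (elem e h * D')"], intro conjI allI)
      show "bilinear (\<lambda>h k. elem e k * (elem e h * D'))"
        unfolding bilinear_def
        by (auto intro!: linearI simp: linear_add[OF linear_elem] linear_scale[OF linear_elem] algebra_simps)
      show "elem e k * (elem e h * D') = elem e h * (elem e k * D')" for h k by (rule mult.left_commute)
      fix h k
      have shift: "((\<lambda>r. x + r *\<^sub>R h) \<longlongrightarrow> x) (at_right 0)"
      proof -
        have "((\<lambda>r. x + r *\<^sub>R h) \<longlongrightarrow> x + 0 *\<^sub>R h) (at_right 0)" by (intro tendsto_intros)
        then show ?thesis by simp
      qed
      have inW: "\<forall>\<^sub>F r in at_right 0. x + r *\<^sub>R h \<in> W"
        using topological_tendstoD[OF shift W(1) x] .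
      have z: "?z (x + r *\<^sub>R h) = ?z x + r *\<^sub>R elem e h" for r
      proof -
        have "x + r *\<^sub>R h - x0 = (x - x0) + r *\<^sub>R h" by simp
        then show ?thesis by (simp only: linear_add[OF linear_elem] linear_scale[OF linear_elem])
      qed
      have Jlim: "((\<lambda>r. ?J (x + r *\<^sub>R h)) \<longlongrightarrow> ?J x) (at_right 0)"
      proof (rule tendsto_alg_inverse)
        have "((\<lambda>r. ?z x + r *\<^sub>R elem e h) \<longlongrightarrow> ?z x + 0 *\<^sub>R elem e h) (at_right 0)"
          by (intro tendsto_intros)
        then show "((\<lambda>r. ?z (x + r *\<^sub>R h)) \<longlongrightarrow> ?z x) (at_right 0)" unfolding z by simp
        show "\<forall>\<^sub>F r in at_right 0. \<exists>b. ?z (x + r *\<^sub>R h) * b = 1"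
          using inW by eventually_elim (rule inv)
      qed (rule inv[OF x])
      note mult_lim = bounded_bilinear.tendsto[OF bounded_bilinear_times]
      have lim: "((\<lambda>r. elem e k * ((\<Phi> (x + r *\<^sub>R h) - \<Phi> x) /\<^sub>R r * ?J (x + r *\<^sub>R h) - \<Phi> x * (?J (x + r *\<^sub>R h) * ?J x * elem e h)))
          \<longlongrightarrow> elem e k * (elem e h * d * ?J x - \<Phi> x * (?J x * ?J x * elem e h))) (at_right 0)"
        by (rule mult_lim[OF tendsto_const tendsto_diff[OF mult_lim[OF d Jlim]
              mult_lim[OF tendsto_const mult_lim[OF mult_lim[OF Jlim tendsto_const] tendsto_const]]]])
      have "\<forall>\<^sub>F r in at_right 0. elem e k * ((\<Phi> (x + r *\<^sub>R h) - \<Phi> x) /\<^sub>R r * ?J (x + r *\<^sub>R h) - \<Phi> x * (?J (x + r *\<^sub>R h) * ?J x * elem e h))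
          = (elem e k * (\<Phi> (x + r *\<^sub>R h) * ?J (x + r *\<^sub>R h)) - elem e k * (\<Phi> x * ?J x)) /\<^sub>R r"
        using inW eventually_at_right_less[of 0]
      proof eventually_elim
        case (elim r)
        let ?j = "?J (x + r *\<^sub>R h)"
        have 1: "?z (x + r *\<^sub>R h) * ?j = 1" by (rule alg_inverse_works[OF inv[OF elim(1)]])
        have 2: "?z x * ?J x = 1" by (rule alg_inverse_works[OF inv[OF x]])
        have "?j - ?J x = ?j * (?z x * ?J x) - (?z (x + r *\<^sub>R h) * ?j) * ?J x" by (simp add: 1 2)
        also have "\<dots> = - (r *\<^sub>R (?j * ?J x * elem e h))" unfolding z by (simp add: algebra_simps)
        finally have j: "?j - ?J x = - (r *\<^sub>R (?j * ?J x * elem e h))" .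
        have "\<Phi> (x + r *\<^sub>R h) * ?j - \<Phi> x * ?J x = (\<Phi> (x + r *\<^sub>R h) - \<Phi> x) * ?j + \<Phi> x * (?j - ?J x)"
          by (simp add: algebra_simps)
        also have "\<dots> = (\<Phi> (x + r *\<^sub>R h) - \<Phi> x) * ?j - r *\<^sub>R (\<Phi> x * (?j * ?J x * elem e h))"
          unfolding j by simp
        finally have diff: "\<Phi> (x + r *\<^sub>R h) * ?j - \<Phi> x * ?J x = (\<Phi> (x + r *\<^sub>R h) - \<Phi> x) * ?j - r *\<^sub>R (\<Phi> x * (?j * ?J x * elem e h))" .
        have "(elem e k * (\<Phi> (x + r *\<^sub>R h) * ?j) - elem e k * (\<Phi> x * ?J x)) /\<^sub>R r = elem e k * ((\<Phi> (x + r *\<^sub>R h) * ?j - \<Phi> x * ?J x) /\<^sub>R r)"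
          by (simp only: right_diff_distrib mult_scaleR_right)
        also have "(\<Phi> (x + r *\<^sub>R h) * ?j - \<Phi> x * ?J x) /\<^sub>R r = (\<Phi> (x + r *\<^sub>R h) - \<Phi> x) /\<^sub>R r * ?j - \<Phi> x * (?j * ?J x * elem e h)"
          unfolding diff using elim(2) by (simp add: scaleR_diff_right left_diff_distrib)
        finally show ?case by simp
      qed
      with lim have "((\<lambda>r. (elem e k * (\<Phi> (x + r *\<^sub>R h) * ?J (x + r *\<^sub>R h)) - elem e k * (\<Phi> x * ?J x)) /\<^sub>R r)
          \<longlongrightarrow> elem e k * (elem e h * d * ?J x - \<Phi> x * (?J x * ?J x * elem e h))) (at_right 0)"
        by (rule Lim_transform_eventually)
      moreover have "elem e k * (elem e h * d * ?J x - \<Phi> x * (?J x * ?J x * elem e h)) = elem e k * (elem e h * D')"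
        by (simp add: D'_def algebra_simps)
      ultimately show "((\<lambda>r. (elem e k * (\<Phi> (x + r *\<^sub>R h) * ?J (x + r *\<^sub>R h)) - elem e k * (\<Phi> x * ?J x)) /\<^sub>R r)
          \<longlongrightarrow> elem e k * (elem e h * D')) (at_right 0)" by (simp only:)
    qed
  qed
qed

lemma singular_set_iff: "y \<in> singular_set scaleC n m I e x0 \<longleftrightarrow> (\<exists>u\<in>{1..m}. coef u (elem e (y - x0)) = 0)"
proof
  assume "\<exists>u\<in>{1..m}. coef u (elem e (y - x0)) = 0"
  then have "y - x0 \<in> (\<Union>u\<in>{1..m}. M_set scaleC n I e u)" by (auto simp: M_set_def)
  moreover have "y = (y - x0) + x0" by simp
  ultimately show "y \<in> singular_set scaleC n m I e x0" unfolding singular_set_def by blast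
qed (auto simp: singular_set_def M_set_def)

lemma closed_singular_set: "closed (singular_set scaleC n m I e x0)"
proof -
  have "closed {y. coef u (elem e (y - x0)) = 0}" if "u \<in> {1..m}" for u
  proof -
    have u: "u \<in> {1..n}" using that m_le_n by auto
    have "continuous_on UNIV (\<lambda>y. coef u (elem e (y - x0)))"
      by (rule linear_continuous_on_compose[OF linear_continuous_on_compose[OF _ linear_elem] linear_coef[OF u]])
        (intro continuous_intros)
    then show ?thesis by (rule closed_Collect_eq[OF _ continuous_on_const])
  qed
  then have "closed (\<Union>u\<in>{1..m}. {y. coef u (elem e (y - x0)) = 0})" by (intro closed_UN) auto
  moreover have "singular_set scaleC n m I e x0 = (\<Union>u\<in>{1..m}. {y. coef u (elem e (y - x0)) = 0})"
    by (simp only: set_eq_iff UN_iff mem_Collect_eq singular_set_iff simp_thms)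
  ultimately show ?thesis by (simp only:)
qed

end

lemma circle_in_plane_disc:
  assumes "orthonormal_pair a b" "r \<le> \<rho>" "0 \<le> r"
  shows "circle x0 r a b t \<in> plane_disc x0 \<rho> a b"
proof -
  let ?v = "r *\<^sub>R (cos (2 * pi * t) *\<^sub>R a + sin (2 * pi * t) *\<^sub>R b)"
  have "?v \<in> span {a, b}" by (intro span_scale span_add span_base) auto
  moreover have "norm ?v \<le> \<rho>"
    using norm_circle_direction[OF assms(1), of "2 * pi * t"] assms(2,3) by simp
  ultimately show ?thesis unfolding plane_disc_def circle_def by blast
qed

context cartan_algebra
begin

text \<open>
  If \<open>f\<^sub>u\<close> vanished at a direction of the circle, then its value at the centre, an interior point of the
  domain bounded by the image of the circle, would lie on the frontier of that domain. Since \<open>f\<^sub>u\<close> is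
  linear, this carries over to smaller radii.
\<close>

lemma circle_avoids_singular_set:
  assumes emb: "circle_embraces scaleC n m I e \<Omega> x0 \<rho> a b" and r: "0 < r" "r \<le> \<rho>"
  shows "circle x0 r a b t \<in> \<Omega>"
    and "t \<in> {0..1} \<Longrightarrow> circle x0 r a b t \<notin> singular_set scaleC n m I e x0"
    and "t \<in> {0..1} \<Longrightarrow> \<exists>c. elem e (circle 0 r a b t) * c = 1"
proof -
  define v where "v t = cos (2 * pi * t) *\<^sub>R a + sin (2 * pi * t) *\<^sub>R b" for t
  have ortho: "orthonormal_pair a b" and disc: "plane_disc x0 \<rho> a b \<subseteq> \<Omega>" and \<rho>: "\<rho> > 0"
    using emb by (auto simp: circle_embraces_def)
  have c: "circle y s a b t = y + s *\<^sub>R v t" for y s t by (simp add: circle_def v_def)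
  show "circle x0 r a b t \<in> \<Omega>" by (rule subsetD[OF disc circle_in_plane_disc[OF ortho r(2) less_imp_le[OF r(1)]]])
  have nz: "coef u (elem e (r *\<^sub>R v t)) \<noteq> 0" if u: "u \<in> {1..m}" and t: "t \<in> {0..1}" for u t
  proof
    have un: "u \<in> {1..n}" using u m_le_n by auto
    assume "coef u (elem e (r *\<^sub>R v t)) = 0"
    then have "coef u (elem e (v t)) = 0"
      using r(1) by (simp add: linear_scale[OF linear_elem] coef_scaleR[OF un])
    then have "coef u (elem e (circle x0 \<rho> a b t)) = coef u (elem e x0)"
      by (simp add: c linear_add[OF linear_elem] linear_scale[OF linear_elem] coef_add[OF un] coef_scaleR[OF un])
    then have img: "coef u (elem e x0) = coef u (elem e (circle x0 \<rho> a b t))" by simp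
    obtain D where D: "is_domain D"
      "frontier D = (\<lambda>x. coef u (elem e x)) ` path_image (circle x0 \<rho> a b)" "coef u (elem e x0) \<in> D"
      using emb u unfolding circle_embraces_def by blast
    have "circle x0 \<rho> a b t \<in> path_image (circle x0 \<rho> a b)" using t by (simp add: path_image_def)
    then have "coef u (elem e x0) \<in> frontier D" unfolding D(2) img by (rule imageI)
    moreover have "open D" using D(1) by (simp add: is_domain_def)
    ultimately show False using D(3) by (simp add: frontier_def interior_open)
  qed
  show "circle x0 r a b t \<notin> singular_set scaleC n m I e x0" if "t \<in> {0..1}"
    using nz[OF _ that] by (auto simp: singular_set_iff c)
  show "\<exists>d. elem e (circle 0 r a b t) * d = 1" if "t \<in> {0..1}"
    using nz[OF _ that] by (intro invertible_if_coef_nonzero) (simp add: c)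
qed

text \<open>The factor \<open>r\<close> of the increment cancels against the inverse, so that the Riemann sums over the
  circle of radius \<open>r\<close> differ from those for \<open>\<lambda>\<close> only in the values of \<open>\<Phi>\<close>.\<close>

lemma alg_integral_small_circle:
  fixes e :: "'k::finite \<Rightarrow> 'a"
  assumes emb: "circle_embraces scaleC n m I e \<Omega> x0 \<rho> a b" and \<Phi>: "continuous_on \<Omega> \<Phi>" "x0 \<in> \<Omega>" "open \<Omega>"
    and same: "\<And>r. 0 < r \<Longrightarrow> r \<le> \<rho> \<Longrightarrow>
      alg_integral scaleC n I e (circle x0 r a b) (\<lambda>x. \<Phi> x * alg_inverse (elem e (x - x0))) = A"
    and \<Psi>: "continuous_on (\<Omega> - singular_set scaleC n m I e x0) (\<lambda>x. \<Phi> x * alg_inverse (elem e (x - x0)))"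
  shows "alg_integral scaleC n I e (circle 0 \<rho> a b) (\<lambda>x. alg_inverse (elem e x)) * \<Phi> x0 = A"
proof -
  let ?inv = "\<lambda>x. alg_inverse (elem e x)"
  define v where "v t = circle 0 \<rho> a b t" for t
  have ortho: "orthonormal_pair a b" and \<rho>: "\<rho> > 0" using emb by (auto simp: circle_embraces_def)
  have vinv: "\<exists>c. elem e (v t) * c = 1" if "t \<in> {0..1}" for t
    unfolding v_def by (rule circle_avoids_singular_set(3)[OF emb \<rho> order_refl that])
  have pv: "path v" "rectifiable v" unfolding v_def[abs_def] using path_circle rectifiable_circle[OF ortho] \<rho> by auto
  have cinv: "continuous_on (path_image v) ?inv"
    unfolding continuous_on_def
  proof
    fix x assume "x \<in> path_image v"
    have inv: "\<exists>c. elem e y * c = 1" if "y \<in> path_image v" for y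
      using that vinv by (auto simp: path_image_def)
    show "(?inv \<longlongrightarrow> ?inv x) (at x within path_image v)"
    proof (rule tendsto_alg_inverse)
      show "(elem e \<longlongrightarrow> elem e x) (at x within path_image v)"
        using linear_continuous_on_compose[OF continuous_on_id linear_elem, of "path_image v"] \<open>x \<in> path_image v\<close>
        unfolding continuous_on_def by blast
      show "\<forall>\<^sub>F y in at x within path_image v. \<exists>c. elem e y * c = 1" using inv by (auto simp: eventually_at_filter)
    qed (rule inv[OF \<open>x \<in> path_image v\<close>])
  qed
  define T where "T i N = elem e (v (real (Suc i) / real N) - v (real i / real N)) * ?inv (v (real i / real N))" for i N
  have lam: "(\<lambda>N. \<Sum>i<N. T i N) \<longlonglongrightarrow> alg_integral scaleC n I e v ?inv"
    unfolding T_def by (rule alg_integral_limit[OF pv cinv])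
  have small: "(\<lambda>N. \<Sum>i<N. T i N * \<Phi> (x0 + s *\<^sub>R v (real i / real N))) \<longlonglongrightarrow> A" if s: "0 < s" "s \<le> 1" for s
  proof -
    have r: "0 < s * \<rho>" "s * \<rho> \<le> \<rho>" using s \<rho> by (auto simp: mult_le_cancel_right1)
    let ?c = "circle x0 (s * \<rho>) a b"
    have cv: "?c t = x0 + s *\<^sub>R v t" for t by (simp add: circle_def v_def)
    have "path_image ?c \<subseteq> \<Omega> - singular_set scaleC n m I e x0"
      using circle_avoids_singular_set(1,2)[OF emb r] by (auto simp: path_image_def)
    then have "continuous_on (path_image ?c) (\<lambda>x. \<Phi> x * alg_inverse (elem e (x - x0)))"
      by (rule continuous_on_subset[OF \<Psi>])
    from alg_integral_limit[OF path_circle rectifiable_circle[OF ortho less_imp_le[OF r(1)]] this, of e]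
    have lim: "(\<lambda>N. \<Sum>i<N. elem e (?c (real (Suc i) / real N) - ?c (real i / real N)) *
        (\<Phi> (?c (real i / real N)) * alg_inverse (elem e (?c (real i / real N) - x0)))) \<longlonglongrightarrow> A"
      unfolding same[OF r] .
    have eq: "elem e (?c (real (Suc i) / real N) - ?c (real i / real N)) *
        (\<Phi> (?c (real i / real N)) * alg_inverse (elem e (?c (real i / real N) - x0))) =
        T i N * \<Phi> (x0 + s *\<^sub>R v (real i / real N))" if i: "i < N" for i N
    proof -
      let ?t = "real i / real N" and ?t' = "real (Suc i) / real N"
      have "?t \<in> {0..1}" using i by simp
      then have one: "elem e (v ?t) * ?inv (v ?t) = 1" by (intro alg_inverse_works vinv)
      have "elem e (?c ?t - x0) = s *\<^sub>R elem e (v ?t)" by (simp add: cv linear_scale[OF linear_elem])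
      moreover have "(s *\<^sub>R elem e (v ?t)) * (?inv (v ?t) /\<^sub>R s) = 1" using one s by simp
      ultimately have inv: "alg_inverse (elem e (?c ?t - x0)) = ?inv (v ?t) /\<^sub>R s"
        by (simp only: alg_inverse_unique)
      have "?c ?t' - ?c ?t = s *\<^sub>R (v ?t' - v ?t)" by (simp add: cv scaleR_diff_right)
      then have d: "elem e (?c ?t' - ?c ?t) = s *\<^sub>R elem e (v ?t' - v ?t)" by (simp only: linear_scale[OF linear_elem])
      show ?thesis unfolding inv d unfolding T_def cv using s by (simp add: mult_ac)
    qed
    have "(\<Sum>i<N. elem e (?c (real (Suc i) / real N) - ?c (real i / real N)) *
        (\<Phi> (?c (real i / real N)) * alg_inverse (elem e (?c (real i / real N) - x0)))) =
        (\<Sum>i<N. T i N * \<Phi> (x0 + s *\<^sub>R v (real i / real N)))" for N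
      by (rule sum.cong[OF refl]) (use eq in auto)
    with lim show ?thesis by (simp only:)
  qed
  obtain K where K: "K > 0" "\<And>x y :: 'a. norm (x * y) \<le> norm x * norm y * K"
    using bounded_bilinear.pos_bounded[OF bounded_bilinear_times] by blast
  obtain E where E: "E > 0" "\<And>x. norm (elem e x) \<le> norm x * E"
    using bounded_linear.pos_bounded[OF linear_conv_bounded_linear[THEN iffD1, OF linear_elem]] by blast
  have "compact (path_image v)" by (rule compact_path_image[OF pv(1)])
  from compact_imp_bounded[OF compact_continuous_image[OF cinv this]]
  obtain M where M: "M > 0" "\<And>x. x \<in> path_image v \<Longrightarrow> norm (?inv x) \<le> M"
    unfolding bounded_pos by blast
  obtain L where L: "\<And>N. (\<Sum>i<N. norm (v (real (Suc i) / real N) - v (real i / real N))) \<le> L"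
    using rectifiable_variation[OF pv(2)] by blast
  have "L \<ge> 0" using L[of 0] by simp
  define C where "C = E * M * K * K * L"
  have C: "C \<ge> 0" using E M K \<open>L \<ge> 0\<close> by (simp add: C_def)
  have bound: "norm (A - alg_integral scaleC n I e v ?inv * \<Phi> x0) \<le> C * \<epsilon>" if "\<epsilon> > 0" for \<epsilon>
  proof -
    have "isCont \<Phi> x0" using \<Phi> by (simp add: continuous_on_eq_continuous_at)
    then obtain d where d: "d > 0" "\<And>x. dist x x0 < d \<Longrightarrow> dist (\<Phi> x) (\<Phi> x0) < \<epsilon>"
      using \<open>\<epsilon> > 0\<close> unfolding continuous_at_eps_delta by blast
    \<comment> \<open>Any factor with \<open>s * \<rho> < d\<close> that is at most one.\<close>
    define s where "s = min 1 (d / (2 * \<rho>))"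
    have s: "0 < s" "s \<le> 1" "s * \<rho> < d"
    proof -
      show "0 < s" "s \<le> 1" using d(1) \<rho> by (auto simp: s_def)
      have "s * \<rho> \<le> d / (2 * \<rho>) * \<rho>" using \<rho> by (intro mult_right_mono) (auto simp: s_def)
      also have "\<dots> < d" using d(1) \<rho> by simp
      finally show "s * \<rho> < d" .
    qed
    have v_norm: "norm (v t) = \<rho>" for t
      using norm_circle_direction[OF ortho, of "2 * pi * t"] \<rho> by (simp add: v_def circle_def)
    have near: "norm (\<Phi> (x0 + s *\<^sub>R v t) - \<Phi> x0) \<le> \<epsilon>" for t
    proof -
      have "dist (x0 + s *\<^sub>R v t) x0 < d" using s v_norm by (simp add: dist_norm)
      from d(2)[OF this] show ?thesis by (simp add: dist_norm)
    qed
    have each: "norm (T i N * (\<Phi> (x0 + s *\<^sub>R v (real i / real N)) - \<Phi> x0)) \<le>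
        norm (v (real (Suc i) / real N) - v (real i / real N)) * (E * M * K * K * \<epsilon>)" if i: "i < N" for i N
    proof -
      let ?d = "v (real (Suc i) / real N) - v (real i / real N)" and ?y = "\<Phi> (x0 + s *\<^sub>R v (real i / real N)) - \<Phi> x0"
      have "v (real i / real N) \<in> path_image v" using i by (auto simp: path_image_def)
      then have y: "norm (?inv (v (real i / real N))) \<le> M" by (rule M(2))
      have "norm (T i N) \<le> norm (elem e ?d) * norm (?inv (v (real i / real N))) * K" unfolding T_def by (rule K(2))
      also have "\<dots> \<le> (norm ?d * E) * M * K" using K(1) E y by (intro mult_right_mono mult_mono) auto
      finally have "norm (T i N) * norm ?y * K \<le> ((norm ?d * E) * M * K) * \<epsilon> * K"
        using near K(1) E(1) M(1) by (intro mult_right_mono mult_mono) auto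
      with K(2)[of "T i N" ?y] show ?thesis by (simp add: mult_ac)
    qed
    have sum: "norm ((\<Sum>i<N. T i N * \<Phi> (x0 + s *\<^sub>R v (real i / real N))) - (\<Sum>i<N. T i N) * \<Phi> x0) \<le> C * \<epsilon>" for N
    proof -
      have "(\<Sum>i<N. T i N * \<Phi> (x0 + s *\<^sub>R v (real i / real N))) - (\<Sum>i<N. T i N) * \<Phi> x0 =
          (\<Sum>i<N. T i N * (\<Phi> (x0 + s *\<^sub>R v (real i / real N)) - \<Phi> x0))"
        by (simp add: sum_distrib_right right_diff_distrib sum_subtractf)
      also have "norm \<dots> \<le> (\<Sum>i<N. norm (v (real (Suc i) / real N) - v (real i / real N)) * (E * M * K * K * \<epsilon>))"
        by (rule sum_norm_le) (use each in auto)
      also have "\<dots> = (\<Sum>i<N. norm (v (real (Suc i) / real N) - v (real i / real N))) * (E * M * K * K * \<epsilon>)"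
        by (rule sum_distrib_right[symmetric])
      also have "\<dots> \<le> L * (E * M * K * K * \<epsilon>)"
        using L[of N] E M K \<open>\<epsilon> > 0\<close> by (intro mult_right_mono) auto
      finally show ?thesis by (simp add: C_def mult_ac)
    qed
    have "(\<lambda>N. norm ((\<Sum>i<N. T i N * \<Phi> (x0 + s *\<^sub>R v (real i / real N))) - (\<Sum>i<N. T i N) * \<Phi> x0))
        \<longlonglongrightarrow> norm (A - alg_integral scaleC n I e v ?inv * \<Phi> x0)"
      by (rule tendsto_norm[OF tendsto_diff[OF small[OF s(1,2)] bounded_bilinear.tendsto[OF bounded_bilinear_times lam tendsto_const]]])
    then show ?thesis by (rule LIMSEQ_le_const2) (use sum in blast)
  qed
  have "norm (A - alg_integral scaleC n I e v ?inv * \<Phi> x0) \<le> 0"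
  proof (rule field_le_epsilon)
    fix \<epsilon> :: real assume "\<epsilon> > 0"
    have "C * (\<epsilon> / (C + 1)) \<le> \<epsilon>" using C \<open>\<epsilon> > 0\<close> by (simp add: field_simps)
    moreover have "\<epsilon> / (C + 1) > 0" using C \<open>\<epsilon> > 0\<close> by simp
    ultimately show "norm (A - alg_integral scaleC n I e v ?inv * \<Phi> x0) \<le> 0 + \<epsilon>"
      using bound[of "\<epsilon> / (C + 1)"] by linarith
  qed
  moreover have "v = circle 0 \<rho> a b" by (rule ext) (simp add: v_def)
  ultimately show ?thesis by simp
qed

end

theorem theorem4:
  fixes scaleC :: "complex \<Rightarrow> 'a::{comm_ring_1,real_algebra_1,euclidean_space} \<Rightarrow> 'a"
    and n m :: nat and I :: "nat \<Rightarrow> 'a"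
    and e :: "'k::finite \<Rightarrow> 'a" and j1 :: 'k
    and \<Omega> :: "(real^'k) set" and \<Phi> :: "real^'k \<Rightarrow> 'a"
    and \<zeta>0 :: "real^'k" and \<gamma> :: "real \<Rightarrow> real^'k"
    and \<rho> :: real and a b :: "real^'k"
  assumes "cartan_algebra scaleC n m I"
    and "2 \<le> CARD('k)" and "CARD('k) \<le> 2 * n"
    and "e j1 = 1" and "inj e" and "independent (range e)"
    and "is_domain \<Omega>"
    and "\<And>u. u \<in> {1..m} \<Longrightarrow> convex_wrt_directions (M_set scaleC n I e u) \<Omega>"
    and "\<And>u. u \<in> {1..m} \<Longrightarrow> basis_functional scaleC n I u ` range (elem e) = UNIV"
    and "monogenic_on e \<Phi> \<Omega>"
    and "\<zeta>0 \<in> \<Omega>"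
    and "closed_jordan_rectifiable \<gamma>" and "path_image \<gamma> \<subseteq> \<Omega>"
    and "embraces_once_via scaleC n m I e \<Omega> \<zeta>0 \<rho> a b \<gamma>"
  shows "alg_integral scaleC n I e (circle 0 \<rho> a b) (\<lambda>\<zeta>. alg_inverse (elem e \<zeta>)) * \<Phi> \<zeta>0 =
         alg_integral scaleC n I e \<gamma> (\<lambda>\<zeta>. \<Phi> \<zeta> * alg_inverse (elem e (\<zeta> - \<zeta>0)))"
proof -
  interpret cartan_algebra scaleC n m I by (rule assms(1))
  let ?S = "singular_set scaleC n m I e \<zeta>0"
  let ?\<Psi> = "\<lambda>\<zeta>. \<Phi> \<zeta> * alg_inverse (elem e (\<zeta> - \<zeta>0))"
  define W where "W = \<Omega> - ?S"
  have emb: "circle_embraces scaleC n m I e \<Omega> \<zeta>0 \<rho> a b" and hom: "homotopic_loops W \<gamma> (circle \<zeta>0 \<rho> a b)"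
    using assms(14) by (auto simp: embraces_once_via_def W_def)
  have ortho: "orthonormal_pair a b" and \<rho>: "\<rho> > 0" using emb by (auto simp: circle_embraces_def)
  have \<Omega>: "open \<Omega>" using assms(7) by (simp add: is_domain_def)
  have W: "open W" unfolding W_def by (rule open_Diff[OF \<Omega> closed_singular_set])
  have W\<Omega>: "W \<subseteq> \<Omega>" by (auto simp: W_def)
  have inv: "\<exists>b. elem e (x - \<zeta>0) * b = 1" if "x \<in> W" for x
    using that by (intro invertible_if_coef_nonzero) (auto simp: W_def singular_set_iff)
  note form = closed_form_quotient[OF W W\<Omega> assms(10) inv]
  have onW: "circle \<zeta>0 r a b t \<in> W" if "0 < r" "r \<le> \<rho>" "t \<in> {0..1}" for r t
    using circle_avoids_singular_set(1,2)[OF emb that(1,2)] that(3) by (auto simp: W_def)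
  have same: "alg_integral scaleC n I e \<gamma> ?\<Psi> = alg_integral scaleC n I e (circle \<zeta>0 r a b) ?\<Psi>"
    if r: "0 < r" "r \<le> \<rho>" for r
  proof (rule alg_integral_homotopic[OF form])
    show "path \<gamma>" "rectifiable \<gamma>"
      using assms(12) by (auto simp: closed_jordan_rectifiable_def simple_path_imp_path)
    show "path_image \<gamma> \<subseteq> W" using homotopic_loops_imp_subset[OF hom] by blast
    show "path (circle \<zeta>0 r a b)" by (rule path_circle)
    show "rectifiable (circle \<zeta>0 r a b)" using r by (intro rectifiable_circle[OF ortho]) simp
    show "path_image (circle \<zeta>0 r a b) \<subseteq> W" using onW[OF r] by (auto simp: path_image_def)
    have "homotopic_loops W (circle \<zeta>0 \<rho> a b) (circle \<zeta>0 r a b)"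
    proof (rule homotopic_loops_linear)
      fix t :: real assume t: "t \<in> {0..1}"
      show "closed_segment (circle \<zeta>0 \<rho> a b t) (circle \<zeta>0 r a b t) \<subseteq> W"
      proof
        fix x assume "x \<in> closed_segment (circle \<zeta>0 \<rho> a b t) (circle \<zeta>0 r a b t)"
        then obtain u where u: "0 \<le> u" "u \<le> 1" "x = (1 - u) *\<^sub>R circle \<zeta>0 \<rho> a b t + u *\<^sub>R circle \<zeta>0 r a b t"
          by (auto simp: in_segment)
        have "x = circle \<zeta>0 ((1 - u) * \<rho> + u * r) a b t"
          unfolding u(3) circle_def by (simp add: algebra_simps)
        moreover have "0 < (1 - u) * \<rho> + u * r"
        proof -
          have "(1 - u) * r \<le> (1 - u) * \<rho>" using u r by (intro mult_left_mono) auto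
          then show ?thesis using r(1) by (simp add: algebra_simps)
        qed
        moreover have "(1 - u) * \<rho> + u * r \<le> \<rho>"
          using mult_left_mono[OF r(2) u(1)] by (simp add: algebra_simps)
        ultimately show "x \<in> W" using onW t by simp
      qed
    qed (rule path_circle loop_circle)+
    with hom show "homotopic_loops W \<gamma> (circle \<zeta>0 r a b)" by (rule homotopic_loops_trans)
  qed
  have "continuous_on \<Omega> \<Phi>" using assms(10) by (simp add: monogenic_on_def)
  from alg_integral_small_circle[OF emb this assms(11) \<Omega> same[symmetric] form(2)[unfolded W_def]]
  show ?thesis .
qed

end
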